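(* Let $q$ and $p>2$ be primes with $q=2p+1$, and let $L=\mathbb Q(\zeta_q+\zeta_q^{-1})$, where $\zeta_q$ is a primitive $q$-th root of unity. Assume that the prime $2$ is inert in the extension $\mathbb Q(\zeta_p)^+/\mathbb Q$, where $\mathbb Q(\zeta_p)^+$ is the maximal real subfield of $\mathbb Q(\zeta_p)$. Then $\rho_\infty=\dim_{\mathbb F_2}\mathcal O_L^{\times,+}/(\mathcal O_L^\times)^2=0$.
   Context: $\mathcal O_L^\times$ is the unit group of the ring of integers of $L$ and $\mathcal O_L^{\times,+}$ is its subgroup of totally positive units. *)

theory Defs
  imports
    "HOL-Algebra.Algebraic_Closure_Type"
    "HOL-Algebra.Generated_Fields"
    "HOL-Number_Theory.Residues"
    "Jordan_Normal_Form.Missing_VectorSpace"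
begin

text \<open>
  Number fields are represented as subfields of \<^typ>\<open>complex\<close>, given by their carrier sets.
\<close>

definition primitive_root_of_unity :: "nat \<Rightarrow> complex \<Rightarrow> bool" where
  "primitive_root_of_unity n z \<longleftrightarrow> n > 0 \<and> z ^ n = 1 \<and> (\<forall>k. 0 < k \<and> k < n \<longrightarrow> z ^ k \<noteq> 1)"

text \<open>
  The field \<open>\<rat>(S)\<close>: as the characteristic is 0, the subfield of \<^typ>\<open>complex\<close> generated by
  \<open>S\<close> contains \<open>\<rat>\<close>.
\<close>

definition rat_adjoin :: "complex set \<Rightarrow> complex set" where
  "rat_adjoin S = generate_field ring_of_type_algebra S"

definition maximal_real_subfield :: "complex set \<Rightarrow> complex set" where
  "maximal_real_subfield K = K \<inter> \<real>"

definition subfield_ring :: "complex set \<Rightarrow> complex ring" where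
  "subfield_ring K = ring_of_type_algebra \<lparr>carrier := K\<rparr>"

definition ring_of_integers :: "complex set \<Rightarrow> complex ring" where
  "ring_of_integers K = ring_of_type_algebra \<lparr>carrier := {x \<in> K. algebraic_int x}\<rparr>"

text \<open>A rational prime \<open>l\<close> is inert in \<open>K\<close> if \<open>l\<close> generates a prime ideal of the ring of integers.\<close>

definition inert_in :: "nat \<Rightarrow> complex set \<Rightarrow> bool" where
  "inert_in l K \<longleftrightarrow>
     primeideal (PIdl\<^bsub>ring_of_integers K\<^esub> (of_nat l)) (ring_of_integers K)"

definition totally_positive :: "complex set \<Rightarrow> complex \<Rightarrow> bool" where
  "totally_positive K x \<longleftrightarrow>
     (\<forall>\<sigma> \<in> ring_hom (subfield_ring K) (ring_of_type_algebra :: real ring). \<sigma> x > 0)"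

definition unit_group :: "complex set \<Rightarrow> complex monoid" where
  "unit_group K = units_of (ring_of_integers K)"

definition totally_positive_unit_group :: "complex set \<Rightarrow> complex monoid" where
  "totally_positive_unit_group K =
     (unit_group K) \<lparr>carrier := {u \<in> carrier (unit_group K). totally_positive K u}\<rparr>"

definition unit_squares :: "complex set \<Rightarrow> complex set" where
  "unit_squares K = {u [^]\<^bsub>unit_group K\<^esub> (2::nat) | u. u \<in> carrier (unit_group K)}"

definition F2 :: "int ring" where
  "F2 = residue_ring 2"

text \<open>
  An abelian group of exponent dividing 2, written multiplicatively, as a vector space over
  \<open>F2\<close>: vector addition is the group operation, and the scalars 0 and 1 act as exponents.
  The fields \<open>mult\<close> and \<open>one\<close> of the record have no meaning for modules.
\<close>

definition F2_module :: "('a, 'b) monoid_scheme \<Rightarrow> (int, 'a) module" where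
  "F2_module G =
     \<lparr>carrier = carrier G, monoid.mult = monoid.mult G, one = \<one>\<^bsub>G\<^esub>,
      ring.zero = \<one>\<^bsub>G\<^esub>, add = monoid.mult G, module.smult = (\<lambda>a x. x [^]\<^bsub>G\<^esub> a)\<rparr>"

lemma F2_module_vectorspace:
  fixes G (structure)
  assumes "comm_group G" and exponent: "\<And>x. x \<in> carrier G \<Longrightarrow> x \<otimes> x = \<one>"
  shows "vectorspace F2 (F2_module G)"
proof -
  interpret comm_group G by fact
  have field: "field F2"
    unfolding F2_def using residues_prime.is_field[of 2] by (simp add: residues_prime_def)
  have carrier: "carrier F2 = {0, 1}"
    unfolding F2_def residue_ring_def by auto
  show ?thesis
    by (rule vs_criteria[OF field], unfold carrier)
       (use exponent in \<open>auto simp: F2_module_def m_ac F2_def residue_ring_def\<close>)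
qed

definition positive_units_mod_squares :: "complex set \<Rightarrow> (int, complex set) module" where
  "positive_units_mod_squares K =
     F2_module (totally_positive_unit_group K Mod unit_squares K)"

definition rho_infinity :: "complex set \<Rightarrow> nat" where
  "rho_infinity K = vectorspace.dim F2 (positive_units_mod_squares K)"

end

theory Submission
  imports Defs "Jordan_Normal_Form.Char_Poly" "HOL-Number_Theory.Number_Theory" "HOL-Library.Z2"
begin

text \<open>
  The field \<open>L\<close> has degree \<open>p\<close>, and the powers of 2 together with \<open>-1\<close> exhaust the residues modulo
  \<open>q\<close>, so the conjugates of \<open>2 cos (2 \<pi> / q)\<close> form a single cycle under doubling the angle. Let \<open>v\<close>
  be a totally positive unit. By a pigeonhole argument, \<open>v\<close> and \<open>p - 1\<close> of these conjugates satisfy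
  a multiplicative relation up to sign, and dividing exponents by 2 makes one of them odd. Comparing
  signs under all real embeddings, the exponents of the conjugates, taken modulo 2, have constant
  cyclic correlation with the sign sequence \<open>s\<close> of \<open>2 cos (2 \<pi> / q)\<close>. Inertness of 2 means that 2
  and \<open>-1\<close> generate the units modulo \<open>p\<close>: the subset sums of the \<open>\<zeta>\<^sub>p ^ k + \<zeta>\<^sub>p ^ - k\<close> are
  \<open>2 ^ ((p - 1) / 2)\<close> incongruent roots modulo 2 of \<open>X ^ (2 ^ f) - X\<close>, where \<open>2 ^ f\<close> is \<open>1\<close> or
  \<open>-1\<close> modulo \<open>p\<close>. Consequently the correlation with a reflection-invariant sequence over the field
  with two elements is either constant or injective modulo constants. If \<open>p\<close> is 1 modulo 4, all
  sequences behave in this way and \<open>s\<close> is not constant; if \<open>p\<close> is 3 modulo 4, this applies to the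
  autocorrelation of \<open>s\<close>, which is not constant by a computation with sums over the residues
  modulo \<open>q\<close>. So the exponents of the conjugates are all even, the exponent of \<open>v\<close> is odd, and \<open>v\<close>
  is a square.
\<close>

section \<open>Algebraic integers\<close>

text \<open>Correlation with the signs can be inverted only modulo constant sequences: the product
  of all \<open>p\<close> conjugates is 1 or -1, so the all-ones exponent vector has constant
  correlation. Taking only \<open>p - 1\<close> conjugates settles this. Together with
  \<open>v\<close> they are \<open>p\<close> units, enough for the pigeonhole, and the exponent
  recorded for the missing conjugate is 0, so exponents that are constant modulo 2 vanish modulo 2.
  The split by \<open>p\<close> modulo 4 comes from the place of -1 among the powers of 2 modulo
  \<open>p\<close>. If \<open>p\<close> is 1 modulo 4, then -1 is such a power and 2 alone generates
  all units. If \<open>p\<close> is 3 modulo 4, 2 may generate only the subgroup of index 2; the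
  sums of X^i over this subgroup and over its complement are then idempotents modulo X^p - 1,
  exchanged by reflecting exponents. Passing from \<open>s\<close> to its autocorrelation gives a
  reflection-invariant factor and keeps the hypothesis: multiplying a constant correlation by the
  reflected \<open>s\<close> leaves it constant.\<close>

lemma algebraic_int_if_finite_module:
  fixes w :: "'i \<Rightarrow> complex" and a :: "'i \<Rightarrow> 'i \<Rightarrow> int"
  assumes fin: "finite I" and i0: "i0 \<in> I" "w i0 \<noteq> 0"
    and eq: "\<And>i. i \<in> I \<Longrightarrow> z * w i = (\<Sum>j\<in>I. of_int (a i j) * w j)"
  shows "algebraic_int z"
proof -
  define n where "n = card I"
  obtain h where h: "bij_betw h {0..<n} I"
    using ex_bij_betw_nat_finite[OF fin] unfolding n_def by blast
  define A :: "int mat" where "A = mat n n (\<lambda>(i, j). a (h i) (h j))"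
  define v :: "complex vec" where "v = vec n (\<lambda>i. w (h i))"
  have A: "A \<in> carrier_mat n n" unfolding A_def by simp
  let ?A = "map_mat of_int A :: complex mat"
  have A': "?A \<in> carrier_mat n n" using A by simp
  obtain k where k: "k < n" "h k = i0"
    using h i0(1) unfolding bij_betw_def by force
  have "v \<noteq> 0\<^sub>v n"
    using k i0(2) unfolding v_def by (auto simp: vec_eq_iff)
  moreover have "?A *\<^sub>v v = z \<cdot>\<^sub>v v"
  proof (rule eq_vecI)
    fix i assume "i < dim_vec (z \<cdot>\<^sub>v v)"
    hence i: "i < n" by (simp add: v_def)
    have "(?A *\<^sub>v v) $ i = (\<Sum>j\<in>{0..<n}. of_int (a (h i) (h j)) * w (h j))"
      using i by (simp add: A_def v_def scalar_prod_def)
    also have "\<dots> = (\<Sum>j\<in>I. of_int (a (h i) j) * w j)"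
      by (rule sum.reindex_bij_betw[OF h])
    also have "\<dots> = z * w (h i)"
      using eq[of "h i"] h i by (auto simp: bij_betw_def)
    finally show "(?A *\<^sub>v v) $ i = (z \<cdot>\<^sub>v v) $ i" using i by (simp add: v_def)
  qed (simp add: A_def v_def)
  moreover have "v \<in> carrier_vec n" by (simp add: v_def)
  \<comment> \<open>Multiplication by \<open>z\<close> acts on the \<open>w i\<close> through an
    integer matrix, so \<open>z\<close> is a root of its characteristic polynomial, which is monic
    and integral.\<close>
  ultimately have "eigenvalue ?A z"
    using A' unfolding eigenvalue_def eigenvector_def by auto
  hence "poly (char_poly ?A) z = 0"
    using eigenvalue_root_char_poly[OF A'] by simp
  hence "poly (map_poly of_int (char_poly A)) z = 0"
    by (simp add: of_int_hom.char_poly_hom[OF A])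
  moreover have "lead_coeff (char_poly A) = 1" using degree_monic_char_poly[OF A] by simp
  ultimately show ?thesis unfolding algebraic_int_altdef_ipoly by blast
qed

lemma algebraic_int_power_basis:
  fixes x :: complex
  assumes "algebraic_int x"
  obtains m :: nat and \<alpha> :: "nat \<Rightarrow> nat \<Rightarrow> int"
  where "m > 0" "\<And>i. i < m \<Longrightarrow> x * x ^ i = (\<Sum>k<m. of_int (\<alpha> i k) * x ^ k)"
proof -
  obtain P :: "int poly" where P: "poly (map_poly of_int P) x = 0" "lead_coeff P = 1"
    using assms unfolding algebraic_int_altdef_ipoly by blast
  define m where "m = degree P"
  have m: "m > 0"
  proof (rule ccontr)
    assume "\<not> m > 0"
    then obtain c where c: "P = [:c:]" using degree_eq_zeroE[of P] by (auto simp: m_def)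
    with P(2) have "P = 1" by (simp add: one_pCons)
    with P(1) show False by simp
  qed
  have "0 = (\<Sum>k\<le>m. of_int (coeff P k) * x ^ k)"
    using P(1) by (simp add: poly_altdef m_def)
  also have "{..m} = insert m {..<m}" by auto
  finally have top: "x ^ m = (\<Sum>k<m. of_int (- coeff P k) * x ^ k)"
    using P(2) by (simp add: m_def sum_negf eq_neg_iff_add_eq_0 add.commute)
  \<comment> \<open>The companion matrix of \<open>P\<close>: multiplication by \<open>x\<close>
    shifts the powers, and the highest one is reduced by \<open>top\<close>.\<close>
  define \<alpha> where "\<alpha> = (\<lambda>i k. if Suc i < m then (if k = Suc i then 1 else 0) else - coeff P k)"
  have "x * x ^ i = (\<Sum>k<m. of_int (\<alpha> i k) * x ^ k)" if "i < m" for i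
  proof (cases "Suc i < m")
    case True
    have "(\<Sum>k<m. of_int (\<alpha> i k) * x ^ k) = (\<Sum>k<m. if k = Suc i then x ^ k else 0)"
      by (rule sum.cong) (auto simp: \<alpha>_def True)
    then show ?thesis using True by simp
  next
    case False
    with that have "Suc i = m" by simp
    then show ?thesis using top False by (simp add: \<alpha>_def flip: power_Suc)
  qed
  with m show ?thesis by (rule that)
qed

text \<open>The products \<open>x ^ i * y ^ j\<close> span a finite module stable under both
  factors, so one family \<open>w\<close> serves sum and product.\<close>

lemma
  fixes x y :: complex
  assumes x: "algebraic_int x" and y: "algebraic_int y"
  shows algebraic_int_add [intro]: "algebraic_int (x + y)"
    and algebraic_int_mult [intro]: "algebraic_int (x * y)"
proof -
  obtain m \<alpha> where m: "m > 0"
    and \<alpha>: "\<And>i. i < m \<Longrightarrow> x * x ^ i = (\<Sum>k<m. of_int (\<alpha> i k) * x ^ k)"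
    using algebraic_int_power_basis[OF x] by metis
  obtain n \<beta> where n: "n > 0"
    and \<beta>: "\<And>i. i < n \<Longrightarrow> y * y ^ i = (\<Sum>k<n. of_int (\<beta> i k) * y ^ k)"
    using algebraic_int_power_basis[OF y] by metis
  define I where "I = {..<m} \<times> {..<n}"
  define w where "w = (\<lambda>(i, j). x ^ i * y ^ j)"
  have fin: "finite I" and i0: "(0, 0) \<in> I" "w (0, 0) \<noteq> 0"
    using m n by (auto simp: I_def w_def)
  have xw: "x * w (i, j) = (\<Sum>(k, l)\<in>I. of_int (\<alpha> i k * (if l = j then 1 else 0)) * w (k, l))"
    and yw: "y * w (i, j) = (\<Sum>(k, l)\<in>I. of_int (\<beta> j l * (if k = i then 1 else 0)) * w (k, l))"
    and xyw: "x * y * w (i, j) = (\<Sum>(k, l)\<in>I. of_int (\<alpha> i k * \<beta> j l) * w (k, l))"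
    if "i < m" "j < n" for i j
  proof -
    have "(\<Sum>(k, l)\<in>I. of_int (\<alpha> i k * (if l = j then 1 else 0)) * w (k, l)) =
      (\<Sum>k<m. \<Sum>l<n. if l = j then of_int (\<alpha> i k) * w (k, l) else 0)"
      unfolding I_def sum.cartesian_product by (intro sum.cong) auto
    also have "\<dots> = (\<Sum>k<m. of_int (\<alpha> i k) * x ^ k) * y ^ j"
      using that by (simp add: w_def sum_distrib_right mult.assoc)
    also have "\<dots> = x * w (i, j)" using \<alpha>[OF that(1)] by (simp add: w_def mult.assoc)
    finally show "x * w (i, j) = (\<Sum>(k, l)\<in>I. of_int (\<alpha> i k * (if l = j then 1 else 0)) * w (k, l))" ..
    have "(\<Sum>(k, l)\<in>I. of_int (\<beta> j l * (if k = i then 1 else 0)) * w (k, l)) =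
      (\<Sum>k<m. if k = i then (\<Sum>l<n. of_int (\<beta> j l) * w (k, l)) else 0)"
      unfolding I_def sum.cartesian_product[symmetric] by (intro sum.cong) auto
    also have "\<dots> = (\<Sum>l<n. of_int (\<beta> j l) * y ^ l) * x ^ i"
      using that by (simp add: w_def sum_distrib_left mult_ac)
    also have "\<dots> = y * w (i, j)" using \<beta>[OF that(2)] by (simp add: w_def mult_ac)
    finally show "y * w (i, j) = (\<Sum>(k, l)\<in>I. of_int (\<beta> j l * (if k = i then 1 else 0)) * w (k, l))" ..
    have "x * y * w (i, j) = (x * x ^ i) * (y * y ^ j)" by (simp add: w_def mult_ac)
    also have "\<dots> = (\<Sum>k<m. \<Sum>l<n. of_int (\<alpha> i k * \<beta> j l) * w (k, l))"
      unfolding \<alpha>[OF that(1)] \<beta>[OF that(2)] sum_product by (simp add: w_def mult_ac)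
    finally show "x * y * w (i, j) = (\<Sum>(k, l)\<in>I. of_int (\<alpha> i k * \<beta> j l) * w (k, l))"
      unfolding I_def sum.cartesian_product .
  qed
  show "algebraic_int (x + y)"
  proof (rule algebraic_int_if_finite_module[where I = I and ?i0.0 = "(0, 0)" and w = w])
    fix ij assume "ij \<in> I"
    then obtain i j where ij: "ij = (i, j)" "i < m" "j < n" by (auto simp: I_def)
    show "(x + y) * w ij = (\<Sum>kl\<in>I. of_int ((\<lambda>(i, j) (k, l).
      \<alpha> i k * (if l = j then 1 else 0) + \<beta> j l * (if k = i then 1 else 0)) ij kl) * w kl)"
      unfolding ij(1) distrib_right xw[OF ij(2,3)] yw[OF ij(2,3)] sum.distrib[symmetric]
      by (rule sum.cong) (auto simp: distrib_right)
  qed (use fin i0 in auto)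
  show "algebraic_int (x * y)"
  proof (rule algebraic_int_if_finite_module[where I = I and ?i0.0 = "(0, 0)" and w = w])
    fix ij assume "ij \<in> I"
    then obtain i j where ij: "ij = (i, j)" "i < m" "j < n" by (auto simp: I_def)
    show "x * y * w ij = (\<Sum>kl\<in>I. of_int ((\<lambda>(i, j) (k, l). \<alpha> i k * \<beta> j l) ij kl) * w kl)"
      unfolding ij(1) xyw[OF ij(2,3)] by (rule sum.cong) auto
  qed (use fin i0 in auto)
qed

lemma algebraic_int_diff [intro]:
  fixes x y :: complex
  assumes "algebraic_int x" "algebraic_int y"
  shows "algebraic_int (x - y)"
  using algebraic_int_add[OF assms(1) algebraic_int_minus[OF assms(2)]] by simp

lemma algebraic_int_sum [intro]:
  fixes f :: "'a \<Rightarrow> complex"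
  assumes "\<And>i. i \<in> A \<Longrightarrow> algebraic_int (f i)"
  shows "algebraic_int (\<Sum>i\<in>A. f i)"
  using assms by (induction A rule: infinite_finite_induct) auto

lemma algebraic_int_prod [intro]:
  fixes f :: "'a \<Rightarrow> complex"
  assumes "\<And>i. i \<in> A \<Longrightarrow> algebraic_int (f i)"
  shows "algebraic_int (\<Prod>i\<in>A. f i)"
  using assms by (induction A rule: infinite_finite_induct) (auto simp: int_imp_algebraic_int)

lemma algebraic_int_power [intro]:
  fixes x :: complex
  assumes "algebraic_int x"
  shows "algebraic_int (x ^ n)"
  using algebraic_int_prod[of "{..<n}" "\<lambda>_. x"] assms by simp

lemma algebraic_int_root_of_unity:
  fixes z :: complex
  assumes "z ^ n = 1" "n > 0"
  shows "algebraic_int z"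
  using algebraic_int_root[of 1 "monom 1 n" z] assms
  by (auto simp: poly_monom degree_monom_eq)

text \<open>A congruence in the ring of all algebraic integers, carried by the explicit quotient
  \<open>h\<close>; the inner binomial coefficients are divisible by \<open>p\<close>.\<close>

lemma prime_power_add_cong:
  fixes x y :: complex
  assumes p: "Factorial_Ring.prime (p :: nat)" and x: "algebraic_int x" and y: "algebraic_int y"
  obtains h where "algebraic_int h" "(x + y) ^ p = x ^ p + y ^ p + of_nat p * h"
proof -
  let ?t = "\<lambda>k. of_nat (p choose k) * x ^ k * y ^ (p - k)"
  have p1: "p > 0" using p prime_gt_0_nat by blast
  define h where "h = (\<Sum>k\<in>{0<..<p}. of_nat ((p choose k) div p) * x ^ k * y ^ (p - k))"
  have "{..p} = insert 0 (insert p {0<..<p})" using p1 by auto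
  hence "(x + y) ^ p = y ^ p + x ^ p + (\<Sum>k\<in>{0<..<p}. ?t k)"
    using p1 by (simp add: binomial_ring)
  also have "(\<Sum>k\<in>{0<..<p}. ?t k) = of_nat p * h"
    unfolding h_def sum_distrib_left
  proof (rule sum.cong[OF refl])
    fix k assume "k \<in> {0<..<p}"
    hence "p dvd (p choose k)" using p by (intro dvd_choose_prime) auto
    hence "(of_nat (p choose k) :: complex) = of_nat p * of_nat ((p choose k) div p)"
      by (metis dvd_mult_div_cancel of_nat_mult)
    thus "?t k = of_nat p * (of_nat ((p choose k) div p) * x ^ k * y ^ (p - k))"
      by (simp add: mult.assoc)
  qed
  moreover have "algebraic_int h"
    unfolding h_def using x y by (intro algebraic_int_sum algebraic_int_mult algebraic_int_power) auto
  ultimately show ?thesis using that by (simp add: add.commute)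
qed

lemma prime_power_sum_cong:
  fixes f :: "'a \<Rightarrow> complex"
  assumes p: "Factorial_Ring.prime (p :: nat)" and fin: "finite A"
    and f: "\<And>i. i \<in> A \<Longrightarrow> algebraic_int (f i)"
  shows "\<exists>h. algebraic_int h \<and> (\<Sum>i\<in>A. f i) ^ p = (\<Sum>i\<in>A. f i ^ p) + of_nat p * h"
  using fin f
proof (induction A)
  case empty
  then show ?case using p prime_gt_0_nat[OF p] by (intro exI[of _ 0]) auto
next
  case (insert a A)
  then obtain h where h: "algebraic_int h" "(\<Sum>i\<in>A. f i) ^ p = (\<Sum>i\<in>A. f i ^ p) + of_nat p * h"
    by auto
  have "algebraic_int (\<Sum>i\<in>A. f i)" using insert by auto
  from prime_power_add_cong[OF p _ this, of "f a"] insert obtain h' where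
    h': "algebraic_int h'" "(f a + (\<Sum>i\<in>A. f i)) ^ p = f a ^ p + (\<Sum>i\<in>A. f i) ^ p + of_nat p * h'"
    by auto
  show ?case
    using insert.hyps h h' by (intro exI[of _ "h + h'"]) (auto simp: algebra_simps)
qed

text \<open>Brings divisibility back to the integers: the quotient \<open>h\<close> is rational and
  integral, hence an integer.\<close>

lemma int_dvd_if_algebraic_int:
  assumes "algebraic_int (h :: complex)" "of_int a = of_int b * h" "b \<noteq> 0"
  shows "b dvd a"
proof -
  have "h = of_rat (of_int a / of_int b)" using assms(2,3) by (simp add: of_rat_divide field_simps)
  hence "h \<in> \<rat>" by simp
  with assms(1) have "h \<in> \<int>" by (rule rational_algebraic_int_is_int)
  then obtain c where "h = of_int c" by (elim Ints_cases)
  with assms(2) have "of_int a = (of_int (b * c) :: complex)" by simp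
  hence "a = b * c" by (simp only: of_int_eq_iff)
  thus ?thesis by simp
qed

section \<open>Galois conjugation in prime cyclotomic fields\<close>

definition rat_eval :: "rat poly \<Rightarrow> complex \<Rightarrow> complex" where
  "rat_eval f x = poly (map_poly of_rat f) x"

interpretation rat_poly_hom: map_poly_idom_hom "of_rat :: rat \<Rightarrow> complex" ..

lemma rat_eval_simps [simp]:
  "rat_eval 0 x = 0" "rat_eval 1 x = 1"
  "rat_eval (f + g) x = rat_eval f x + rat_eval g x"
  "rat_eval (f - g) x = rat_eval f x - rat_eval g x"
  "rat_eval (- f) x = - rat_eval f x"
  "rat_eval (f * g) x = rat_eval f x * rat_eval g x"
  "rat_eval (monom c i) x = of_rat c * x ^ i"
  "rat_eval (smult c f) x = of_rat c * rat_eval f x"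
  "rat_eval [:c:] x = of_rat c"
  by (simp_all add: rat_eval_def of_rat_hom.map_poly_hom_monom poly_monom hom_distribs
      rat_poly_hom.hom_minus rat_poly_hom.hom_uminus rat_poly_hom.hom_mult)

lemma rat_eval_pcompose [simp]: "rat_eval (pcompose f g) x = rat_eval f (rat_eval g x)"
  by (simp add: rat_eval_def of_rat_hom.map_poly_pcompose poly_pcompose)

lemma rat_eval_altdef: "rat_eval f x = (\<Sum>i\<le>degree f. of_rat (coeff f i) * x ^ i)"
  by (simp add: rat_eval_def poly_altdef)

lemma int_dvd_power_prime_minus:
  fixes c :: int
  assumes n: "Factorial_Ring.prime (n :: nat)"
  shows "int n dvd c ^ n - c"
proof (cases "int n dvd c")
  case True
  then show ?thesis using prime_gt_0_nat[OF n] by (intro dvd_diff) (auto intro: dvd_trans[OF _ dvd_power])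
next
  case False
  define a where "a = nat (c mod int n)"
  have n0: "int n > 0" using prime_gt_0_nat[OF n] by simp
  have a: "int a = c mod int n" using n0 by (simp add: a_def)
  have "\<not> n dvd a"
  proof
    assume "n dvd a"
    hence "int n dvd c mod int n" by (simp flip: a)
    with False show False by (simp add: dvd_mod_iff)
  qed
  hence "[a ^ (n - 1) = 1] (mod n)" using n fermat_theorem by blast
  hence "[a * a ^ (n - 1) = a * 1] (mod n)" by (rule cong_scalar_left)
  hence "[a ^ n = a] (mod n)" using prime_gt_0_nat[OF n] by (simp flip: power_Suc)
  hence "[int a ^ n = int a] (mod int n)" using cong_int_iff by force
  moreover have "[int a = c] (mod int n)" by (simp add: a cong_def)
  ultimately have "[c ^ n = c] (mod int n)" using cong_pow cong_sym cong_trans by metis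
  thus ?thesis by (simp add: cong_iff_dvd_diff)
qed

text \<open>Descent for the irreducibility of the cyclotomic polynomial of prime order \<open>n\<close>: an integral
  relation between the powers of \<open>z\<close> with coefficient sum 0 is an iterated forward difference of
  such a relation, and the \<open>n\<close>-th forward difference of an \<open>n\<close>-periodic sequence is divisible by
  \<open>n\<close>. So the coefficients are divisible by all powers of \<open>n\<close>.\<close>

definition fdiff :: "(nat \<Rightarrow> int) \<Rightarrow> nat \<Rightarrow> int" where
  "fdiff d i = d (i + 1) - d i"

lemma funpow_fdiff:
  "(fdiff ^^ m) d i = (\<Sum>k\<le>m. (-1) ^ (m + k) * int (m choose k) * d (i + k))"
proof (induction m arbitrary: i)
  case 0
  then show ?case by simp
next
  case (Suc m)
  let ?t = "\<lambda>k. (-1) ^ (m + k) * int (m choose k)"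
  have "(\<Sum>k\<le>Suc m. (-1) ^ (Suc m + k) * int (Suc m choose k) * d (i + k)) =
    (-1) ^ Suc m * d i + (\<Sum>k\<le>m. ?t k * d (i + Suc k) + (-1) ^ (m + k) * int (m choose Suc k) * d (i + Suc k))"
    by (subst sum.atMost_Suc_shift) (simp add: algebra_simps)
  also have "\<dots> = (\<Sum>k\<le>m. ?t k * d (i + Suc k)) +
     ((-1) ^ Suc m * d i + (\<Sum>k\<le>m. (-1) ^ (m + k) * int (m choose Suc k) * d (i + Suc k)))"
    by (simp add: sum.distrib)
  also have "(-1) ^ Suc m * d i + (\<Sum>k\<le>m. (-1) ^ (m + k) * int (m choose Suc k) * d (i + Suc k)) =
     - (\<Sum>k\<le>Suc m. ?t k * d (i + k))"
    by (subst sum.atMost_Suc_shift) (simp add: sum_negf)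
  also have "(\<Sum>k\<le>Suc m. ?t k * d (i + k)) = (\<Sum>k\<le>m. ?t k * d (i + k))"
    by simp
  also have "(\<Sum>k\<le>m. ?t k * d (i + Suc k)) + - (\<Sum>k\<le>m. ?t k * d (i + k)) =
    (fdiff ^^ m) d (i + 1) - (fdiff ^^ m) d i"
    by (simp add: Suc.IH)
  also have "\<dots> = (fdiff ^^ Suc m) d i" by (simp add: fdiff_def)
  finally show ?case ..
qed

lemma fdiff_prime_dvd:
  assumes n: "Factorial_Ring.prime (n :: nat)" and "odd n" and per: "\<And>i. d (i + n) = d i"
  shows "int n dvd (fdiff ^^ n) d i"
proof -
  have "{..n} = insert 0 (insert n {0<..<n})" using prime_gt_0_nat[OF n] by auto
  moreover have "(-1::int) ^ (n + n) = 1" by simp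
  \<comment> \<open>The two outer terms \<open>d (i + n)\<close> and \<open>- d i\<close> cancel by
    periodicity.\<close>
  ultimately have "(fdiff ^^ n) d i = (\<Sum>k\<in>{0<..<n}. (-1) ^ (n + k) * int (n choose k) * d (i + k))"
    using per[of i] \<open>odd n\<close> prime_gt_0_nat[OF n] by (simp add: funpow_fdiff)
  also have "int n dvd \<dots>"
    using n by (intro dvd_sum dvd_mult2 dvd_mult) (auto intro!: dvd_choose_prime)
  finally show ?thesis .
qed

section \<open>Linear relations between the powers of a root of unity of prime order\<close>

locale prime_root_of_unity =
  fixes n :: nat and z :: complex
  assumes n: "Factorial_Ring.prime n" "odd n" and z: "z ^ n = 1" "z \<noteq> 1"
begin

lemma n_pos [simp]: "n > 0" using prime_gt_0_nat[OF n(1)] .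

lemma n_nonzero [simp]: "n \<noteq> 0" using n_pos by linarith

lemma n_gt_2: "n > 2" using n prime_ge_2_nat[OF n(1)] by (cases "n = 2") auto

lemma z_nonzero [simp]: "z \<noteq> 0" using z(1) n_pos by (metis power_0_left neq0_conv zero_neq_one)

lemma algebraic_int_z [intro]: "algebraic_int z"
  using algebraic_int_root_of_unity[OF z(1)] by simp

lemma power_mod: "z ^ (i mod n) = z ^ i"
proof -
  have "z ^ i = z ^ (n * (i div n) + i mod n)" by simp
  also have "\<dots> = z ^ (i mod n)" unfolding power_add power_mult z(1) by simp
  finally show ?thesis ..
qed

lemma power_eq_1_iff: "z ^ i = 1 \<longleftrightarrow> n dvd i"
proof
  assume i: "z ^ i = 1"
  show "n dvd i"
  proof (rule ccontr)
    assume "\<not> n dvd i"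
    hence "coprime i n" using n(1) by (metis coprime_commute prime_imp_coprime)
    then obtain x where "[i * x = Suc 0] (mod n)" using cong_solve_coprime_nat by blast
    hence "i * x mod n = 1" using n_gt_2 by (simp add: cong_def)
    hence "z = z ^ (i * x)" using power_mod[of "i * x"] by simp
    also have "\<dots> = 1" using i by (simp add: power_mult)
    finally show False using z by simp
  qed
qed (auto simp: power_mult z)

lemma sum_powers: "(\<Sum>i<n. z ^ (a * i)) = (if n dvd a then of_nat n else 0)"
proof (cases "n dvd a")
  case True
  hence "z ^ (a * i) = 1" for i using power_eq_1_iff by simp
  thus ?thesis using True by simp
next
  case False
  hence "z ^ a \<noteq> 1" using power_eq_1_iff by simp
  moreover have "(z ^ a) ^ n = 1" by (metis power_mult mult.commute z(1) power_one)
  ultimately show ?thesis using False by (simp add: power_mult sum_gp_strict)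
qed

text \<open>Modulo \<open>n\<close>, the \<open>n\<close>-th power of the sum is the sum of the
  \<open>c i ^ n\<close>, since every \<open>z ^ i\<close> has \<open>n\<close>-th power 1; Fermat
  then replaces \<open>c i ^ n\<close> by \<open>c i\<close>.\<close>

lemma dvd_sum_if_eval_zero:
  fixes c :: "nat \<Rightarrow> int"
  assumes "(\<Sum>i<n. of_int (c i) * z ^ i) = 0"
  shows "int n dvd (\<Sum>i<n. c i)"
proof -
  have int: "algebraic_int (of_int (c i) * z ^ i)" for i
    by (intro algebraic_int_mult algebraic_int_power algebraic_int_of_int algebraic_int_z)
  obtain h where h: "algebraic_int h"
    "(\<Sum>i<n. of_int (c i) * z ^ i) ^ n = (\<Sum>i<n. (of_int (c i) * z ^ i) ^ n) + of_nat n * h"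
    using prime_power_sum_cong[OF n(1) finite_lessThan[of n], of "\<lambda>i. of_int (c i) * z ^ i", OF int]
    by metis
  have zi: "(z ^ i) ^ n = 1" for i by (metis power_mult mult.commute z(1) power_one)
  have "(of_int (c i) * z ^ i) ^ n = of_int (c i ^ n)" for i
    unfolding power_mult_distrib zi by simp
  hence "0 = of_int (\<Sum>i<n. c i ^ n) + of_nat n * h"
    using h(2) unfolding assms by (simp add: power_0_left)
  hence eq: "of_int (\<Sum>i<n. c i ^ n) = (of_int (int n) * (- h) :: complex)"
    by (metis add_eq_0_iff mult_minus_right of_int_of_nat_eq minus_minus)
  have "int n dvd (\<Sum>i<n. c i ^ n)"
    by (rule int_dvd_if_algebraic_int[OF _ eq]) (simp_all add: h(1))
  moreover have "int n dvd (\<Sum>i<n. c i ^ n) - (\<Sum>i<n. c i)"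
    unfolding sum_subtractf[symmetric] using int_dvd_power_prime_minus[OF n(1)] by (intro dvd_sum) auto
  ultimately show ?thesis using dvd_diff[of "int n" "\<Sum>i<n. c i ^ n" "(\<Sum>i<n. c i ^ n) - (\<Sum>i<n. c i)"] by simp
qed

definition relation :: "(nat \<Rightarrow> int) \<Rightarrow> bool" where
  "relation c \<longleftrightarrow> (\<forall>i. c (i + n) = c i) \<and> (\<Sum>i<n. c i) = 0 \<and> (\<Sum>i<n. of_int (c i) * z ^ i) = 0"

lemma relation_fdiff:
  assumes "relation c"
  shows "\<exists>d. relation d \<and> c = fdiff d"
proof -
  have c: "c (i + n) = c i" "(\<Sum>i<n. c i) = 0" "(\<Sum>i<n. of_int (c i) * z ^ i) = 0" for i
    using assms by (auto simp: relation_def)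
  \<comment> \<open>Partial sums invert the forward difference; they are periodic because the
    coefficients add up to 0.\<close>
  define e where "e = (\<lambda>i. \<Sum>j<i. c j)"
  have e_Suc: "e (Suc i) = e i + c i" for i by (simp add: e_def)
  have e_per: "e (i + n) = e i" for i
  proof (induction i)
    case 0
    then show ?case using c(2) by (simp add: e_def)
  next
    case (Suc i)
    then show ?case using c(1)[of i] by (simp add: e_Suc)
  qed
  have "(\<Sum>i<n. of_int (e i) * z ^ i) = 0" (is "?E = 0")
  proof -
    have "(\<Sum>i<n. of_int (e (Suc i)) * z ^ Suc i) = ?E + of_int (e n) * z ^ n - of_int (e 0)"
      using sum.lessThan_Suc_shift[of "\<lambda>i. of_int (e i) * z ^ i" n] by simp
    also have "\<dots> = ?E" using e_per[of 0] z(1) by simp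
    finally have "z * (\<Sum>i<n. of_int (e (Suc i)) * z ^ i) = ?E"
      by (simp add: sum_distrib_left mult_ac)
    hence "z * ?E + z * (\<Sum>i<n. of_int (c i) * z ^ i) = ?E"
      by (simp add: e_Suc sum.distrib distrib_right distrib_left)
    hence "(z - 1) * ?E = 0" using c(3) by (simp add: algebra_simps)
    thus ?thesis using z(2) by simp
  qed
  \<comment> \<open>The coefficient sum of \<open>e\<close> is a multiple of \<open>n\<close>, so
    subtracting a constant makes it 0. This changes neither the differences nor the value at
    \<open>z\<close>.\<close>
  from dvd_sum_if_eval_zero[OF this] obtain k where k: "(\<Sum>i<n. e i) = int n * k" by blast
  define d where "d = (\<lambda>i. e i - k)"
  have "(\<Sum>i<n. of_int (d i) * z ^ i) = 0"
    using \<open>?E = 0\<close> sum_powers[of 1] n_gt_2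
    by (simp add: d_def left_diff_distrib sum_subtractf flip: sum_distrib_left)
  hence "relation d" using k e_per by (simp add: relation_def d_def sum_subtractf)
  moreover have "c = fdiff d" by (auto simp: fdiff_def d_def e_Suc)
  ultimately show ?thesis by blast
qed

lemma relation_funpow_fdiff:
  assumes "relation c"
  shows "\<exists>d. relation d \<and> c = (fdiff ^^ m) d"
proof (induction m)
  case 0
  then show ?case using assms by auto
next
  case (Suc m)
  then obtain d d' where "relation d'" "c = (fdiff ^^ m) d" "d = fdiff d'"
    using relation_fdiff by blast
  then show ?case by (intro exI[of _ d']) (simp add: funpow_swap1)
qed

lemma relation_power_dvd:
  assumes "relation c"
  shows "int n ^ k dvd c i"
  using assms
proof (induction k arbitrary: c i)
  case (Suc k)
  obtain d where "relation d" and d: "c = (fdiff ^^ n) d"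
    using relation_funpow_fdiff[OF Suc.prems] by blast
  hence dvd: "int n dvd c i" for i
    using fdiff_prime_dvd[OF n] by (auto simp: relation_def)
  define e where "e = (\<lambda>i. c i div int n)"
  have e: "c i = int n * e i" for i using dvd[of i] by (simp add: e_def)
  have "relation e"
    using Suc.prems unfolding relation_def e
    by (simp add: mult.assoc flip: sum_distrib_left)
  from Suc.IH[OF this] show ?case by (simp add: e)
qed simp

lemma relation_zero:
  assumes "relation c"
  shows "c i = 0"
proof (rule ccontr)
  assume c: "c i \<noteq> 0"
  define k where "k = nat \<bar>c i\<bar>"
  have "\<bar>int n ^ k\<bar> \<le> \<bar>c i\<bar>"
    using dvd_imp_le_int[OF c relation_power_dvd[OF assms]] .
  moreover have "k < n ^ k" using n_gt_2 by (intro power_gt_expt) simp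
  hence "int k < int n ^ k" by (metis of_nat_less_iff of_nat_power)
  ultimately show False by (simp add: k_def)
qed

lemma coeffs_eq_if_eval_zero_int:
  fixes c :: "nat \<Rightarrow> int"
  assumes "(\<Sum>i<n. of_int (c i) * z ^ i) = 0" "i < n" "j < n"
  shows "c i = c j"
proof -
  \<comment> \<open>Subtracting the mean makes the coefficient sum 0; the factor \<open>n\<close>
    keeps the coefficients integral.\<close>
  define d where "d = (\<lambda>i. int n * c (i mod n) - (\<Sum>i<n. c i))"
  have "(\<Sum>i<n. of_int (d i) * z ^ i) = of_nat n * (\<Sum>i<n. of_int (c i) * z ^ i) - (\<Sum>i<n. of_int (c i)) * (\<Sum>i<n. z ^ i)"
    by (simp add: d_def left_diff_distrib sum_subtractf sum_distrib_left mult.assoc)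
  also have "\<dots> = 0" using assms(1) sum_powers[of 1] n_gt_2 by simp
  moreover have "(\<Sum>i<n. d i) = 0" by (simp add: d_def sum_subtractf flip: sum_distrib_left)
  ultimately have "relation d" by (simp add: relation_def d_def)
  from relation_zero[OF this, of i] relation_zero[OF this, of j] assms(2,3)
  have "int n * c i = int n * c j" by (simp add: d_def)
  thus ?thesis by simp
qed

lemma common_denominator:
  fixes c :: "nat \<Rightarrow> rat"
  shows "\<exists>D e. D \<noteq> 0 \<and> (\<forall>i<m. of_int D * c i = of_int (e i))"
proof (induction m)
  case 0
  have "(1::int) \<noteq> 0 \<and> (\<forall>i<0. of_int 1 * c i = of_int 0)" by simp
  then show ?case by blast
next
  case (Suc m)
  then obtain D e where D: "D \<noteq> 0" "\<And>i. i < m \<Longrightarrow> of_int D * c i = of_int (e i)" by blast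
  obtain a b where "quotient_of (c m) = (a, b)" by fastforce
  hence ab: "c m = of_int a / of_int b" "b \<noteq> 0"
    using quotient_of_div[of "c m" a b] quotient_of_denom_pos[of "c m" a b] by simp_all
  define e' where "e' = (\<lambda>i. if i = m then D * a else b * e i)"
  have "of_int (D * b) * c i = of_int (e' i)" if "i < Suc m" for i
  proof (cases "i = m")
    case True
    then show ?thesis using ab by (simp add: e'_def)
  next
    case False
    hence "i < m" using that by simp
    hence "of_int b * (of_int D * c i) = of_int b * of_int (e i)" using D(2) by simp
    then show ?thesis using False by (simp add: e'_def mult_ac)
  qed
  moreover have "D * b \<noteq> 0" using D ab by simp
  ultimately show ?case by blast
qed

lemma coeffs_eq_if_eval_zero:
  fixes c :: "nat \<Rightarrow> rat"
  assumes "(\<Sum>i<n. of_rat (c i) * z ^ i) = 0" "i < n" "j < n"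
  shows "c i = c j"
proof -
  obtain D e where D: "D \<noteq> 0" "\<And>i. i < n \<Longrightarrow> of_int D * c i = of_int (e i)"
    using common_denominator[of n c] by blast
  have De: "of_int (e i) = of_int D * (of_rat (c i) :: complex)" if "i < n" for i
  proof -
    have "(of_rat (of_int D * c i) :: complex) = of_rat (of_int (e i))" using D(2)[OF that] by simp
    thus ?thesis unfolding of_rat_mult of_rat_of_int_eq by simp
  qed
  have "(\<Sum>i<n. of_int (e i) * z ^ i) = of_int D * (\<Sum>i<n. of_rat (c i) * z ^ i)"
    unfolding sum_distrib_left by (rule sum.cong) (simp_all add: De)
  also have "\<dots> = 0" unfolding assms(1) by simp
  finally have "e i = e j" by (rule coeffs_eq_if_eval_zero_int[OF _ assms(2,3)])
  hence "of_int D * c i = of_int D * c j" using D(2)[OF assms(2)] D(2)[OF assms(3)] by simp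
  thus ?thesis using D(1) by simp
qed

text \<open>Exponents are collected modulo \<open>n\<close> with coefficients that do not depend on
  \<open>a\<close>, so conjugates can be compared term by term.\<close>

lemma rat_eval_fold:
  "rat_eval f (z ^ a) = (\<Sum>i<n. of_rat (\<Sum>j | j \<le> degree f \<and> j mod n = i. coeff f j) * z ^ (a * i))"
proof -
  let ?g = "\<lambda>j. of_rat (coeff f j) * z ^ (a * (j mod n))"
  have "z ^ (a * (j mod n)) = (z ^ a) ^ j" for j
    by (metis power_mod mod_mult_right_eq power_mult)
  hence "rat_eval f (z ^ a) = (\<Sum>j\<in>{..degree f}. ?g j)"
    unfolding rat_eval_altdef by simp
  also have "\<dots> = (\<Sum>i\<in>{..<n}. \<Sum>j\<in>{j \<in> {..degree f}. j mod n = i}. ?g j)"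
    by (rule sum.group[symmetric]) auto
  also have "\<dots> = (\<Sum>i\<in>{..<n}. of_rat (\<Sum>j | j \<le> degree f \<and> j mod n = i. coeff f j) * z ^ (a * i))"
    unfolding of_rat_sum sum_distrib_right by (intro sum.cong) auto
  finally show ?thesis .
qed

text \<open>This expresses the irreducibility of the \<open>n\<close>-th cyclotomic polynomial.\<close>

theorem rat_eval_conjugate_zero:
  assumes "rat_eval f z = 0" "\<not> n dvd a"
  shows "rat_eval f (z ^ a) = 0"
proof -
  define c where "c = (\<lambda>i. \<Sum>j | j \<le> degree f \<and> j mod n = i. coeff f j)"
  have c0: "(\<Sum>i<n. of_rat (c i) * z ^ i) = 0"
    using rat_eval_fold[of f 1] by (simp only: power_one_right mult_1 c_def assms(1))
  have const: "c i = c 0" if "i < n" for i by (rule coeffs_eq_if_eval_zero[OF c0 that n_pos])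
  have "rat_eval f (z ^ a) = (\<Sum>i<n. of_rat (c i) * z ^ (a * i))"
    by (simp only: c_def rat_eval_fold)
  also have "\<dots> = (\<Sum>i<n. of_rat (c 0) * z ^ (a * i))"
    by (rule sum.cong[OF refl], subst const) simp_all
  also have "\<dots> = of_rat (c 0) * (\<Sum>i<n. z ^ (a * i))" by (rule sum_distrib_left[symmetric])
  also have "\<dots> = 0" using sum_powers[of a] assms(2) by simp
  finally show ?thesis .
qed

end

section \<open>Signs modulo a safe prime\<close>

text \<open>By \<open>ord\<close>, the class of 2 has order at least \<open>e\<close> in the group
  of units modulo sign, which has only \<open>e\<close> elements. Applied modulo \<open>q\<close>
  with \<open>e = p\<close>, and modulo \<open>p\<close> with
  \<open>e = (p - 1) / 2\<close>.\<close>

lemma bij_betw_signed_powers_of_2: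
  fixes n e :: nat and m :: int
  assumes n: "Factorial_Ring.prime n" "n = 2 * e + 1"
    and ord: "\<And>j. 0 < j \<Longrightarrow> j < e \<Longrightarrow>
      \<not> ([(2::int) ^ j = 1] (mod int n) \<or> [(2::int) ^ j = - 1] (mod int n))"
    and m: "\<not> int n dvd m"
  shows "bij_betw (\<lambda>(i, s). s * 2 ^ i * m mod int n) ({..<e} \<times> {1, -1}) {1..<int n}"
proof -
  let ?f = "\<lambda>(i, s). s * 2 ^ i * m mod int n" and ?A = "{..<e} \<times> {1, -1 :: int}"
  have pr: "Factorial_Ring.prime (int n)" using n(1) by simp
  have n3: "n \<ge> 3" using n prime_ge_2_nat[OF n(1)] by simp
  have n2: "\<not> int n dvd 2" using n3 zdvd_imp_le[of "int n" 2] by auto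
  have pow: "\<not> int n dvd 2 ^ j" for j using prime_dvd_power[OF pr, of 2 j] n2 by blast
  have unit: "\<not> int n dvd a * b" if "\<not> int n dvd a" "\<not> int n dvd b" for a b
    using that pr by (simp add: prime_dvd_mult_iff)
  have aux: "i = j \<and> s = t"
    if "i \<le> j" "j < e" "s \<in> {1, -1}" "t \<in> {1, -1}"
      and eq: "s * 2 ^ i * m mod int n = t * 2 ^ j * m mod int n" for i j s t
  proof -
    have st: "s * s = 1" "t * t = 1" using that by auto
    have "int n dvd s * 2 ^ i * m - t * 2 ^ j * m" using eq by (simp add: mod_eq_dvd_iff)
    also have "s * 2 ^ i * m - t * 2 ^ j * m = s * (2 ^ i * m * (1 - s * t * 2 ^ (j - i)))"
      using that(1) st by (simp add: algebra_simps flip: power_add)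
    finally have "int n dvd s * (2 ^ i * m * (1 - s * t * 2 ^ (j - i)))" .
    hence "int n dvd 2 ^ i * m * (1 - s * t * 2 ^ (j - i))"
      using that(3) by auto
    hence d: "int n dvd 1 - s * t * 2 ^ (j - i)" using m unit pow by blast
    hence "[(2::int) ^ (j - i) = 1] (mod int n) \<or> [(2::int) ^ (j - i) = - 1] (mod int n)"
      using that(3,4) by (auto simp: cong_iff_dvd_diff dvd_diff_commute add.commute)
    moreover have "j - i < e" using that(2) by simp
    ultimately have "\<not> 0 < j - i" using ord by blast
    hence "i = j" using that(1) by simp
    moreover have "s = t"
    proof (rule ccontr)
      assume "s \<noteq> t"
      hence "s * t = - 1" using that(3,4) by auto
      hence "int n dvd 2" using d \<open>i = j\<close> by simp
      thus False using n2 by simp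
    qed
    ultimately show ?thesis by simp
  qed
  have inj: "inj_on ?f ?A"
  proof (rule inj_onI)
    fix x y assume x: "x \<in> ?A" "y \<in> ?A" "?f x = ?f y"
    obtain i s j t where xy: "x = (i, s)" "y = (j, t)" by fastforce
    show "x = y"
    proof (cases "i \<le> j")
      case True
      with x xy aux[of i j s t] show ?thesis by auto
    next
      case False
      with x xy aux[of j i t s] show ?thesis by auto
    qed
  qed
  have "?f ` ?A \<subseteq> {1..<int n}"
  proof
    fix y assume "y \<in> ?f ` ?A"
    then obtain i s where y: "s \<in> {1, -1}" "y = s * 2 ^ i * m mod int n" by auto
    have "\<not> int n dvd s * 2 ^ i * m" using y(1) unit[OF pow m, of i] by auto
    hence "y \<noteq> 0" using y by (simp add: dvd_eq_mod_eq_0)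
    moreover have "0 \<le> y" "y < int n" using y n3 by (simp_all add: pos_mod_sign pos_mod_bound)
    ultimately show "y \<in> {1..<int n}" by simp
  qed
  moreover have "card (?f ` ?A) = card {1..<int n}"
    using inj n by (simp add: card_image card_cartesian_product)
  ultimately show ?thesis using inj by (simp add: bij_betw_def card_subset_eq)
qed

section \<open>Residues modulo a safe prime and their halves\<close>

locale safe_prime =
  fixes p q :: nat
  assumes p: "Factorial_Ring.prime p" "p > 2" and q: "Factorial_Ring.prime q" "q = 2 * p + 1"
begin

lemma odd_p: "odd p"
  using p primes_dvd_imp_eq[of 2 p] by auto

lemma q_ge: "q \<ge> 7" using p q by simp

lemma q_neq_Suc_0 [simp]: "q \<noteq> Suc 0" using q_ge by simp

lemma int_q: "int q = 2 * int p + 1" using q(2) by simp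

lemma mod_bounds: "0 \<le> x mod int q" "x mod int q < int q"
  using q_ge by (simp_all add: pos_mod_sign pos_mod_bound)

lemma units_def: "\<not> int q dvd a * b \<longleftrightarrow> \<not> int q dvd a \<and> \<not> int q dvd b"
  using q(1) by (simp add: prime_dvd_mult_iff)

lemma not_dvd_power2 [simp]: "\<not> int q dvd 2 ^ j"
proof
  assume "int q dvd 2 ^ j"
  moreover have "Factorial_Ring.prime (int q)" using q(1) by simp
  ultimately have "int q dvd 2" using prime_dvd_power by blast
  hence "int q \<le> 2" by (rule zdvd_imp_le) simp
  thus False using q_ge by linarith
qed

lemma not_dvd_small: "0 < k \<Longrightarrow> k < int q \<Longrightarrow> \<not> int q dvd k"
  by (simp add: zdvd_not_zless)

text \<open>Squaring removes the sign, and 4 has order \<open>p\<close> modulo \<open>q\<close>: its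
  order divides the prime \<open>p\<close>, and it is not 1 since \<open>q\<close> does not divide
  3.\<close>

lemma power2_cong_1_imp:
  assumes "[(2::int) ^ j = 1] (mod int q) \<or> [(2::int) ^ j = - 1] (mod int q)"
  shows "p dvd j"
proof (rule ccontr)
  assume "\<not> p dvd j"
  hence cop: "coprime p j" using p(1) by (simp add: prime_imp_coprime)
  have "[((2::int) ^ j) ^ 2 = 1] (mod int q)"
    using assms cong_pow[of "2 ^ j :: int" 1 "int q" 2] cong_pow[of "2 ^ j :: int" "-1" "int q" 2] by auto
  hence "[int (4 ^ j) = int 1] (mod int q)" by (simp add: power2_eq_square flip: power_mult_distrib)
  hence "[4 ^ j = 1] (mod q)" using cong_int_iff by blast
  hence "ord q 4 dvd j" by (simp only: ord_divides)
  moreover have "[4 ^ p = 1] (mod q)"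
  proof -
    have "\<not> q dvd 2" using q_ge by (auto dest: dvd_imp_le)
    hence "[2 ^ (q - 1) = 1] (mod q)" using q(1) fermat_theorem by blast
    thus ?thesis using q(2) by (simp add: power_mult)
  qed
  hence "ord q 4 dvd p" by (simp only: ord_divides)
  ultimately have "ord q 4 dvd 1" using cop by (meson coprime_common_divisor_nat coprime_def)
  hence "[4 ^ 1 = 1] (mod q)" using ord_divides by blast
  hence "q dvd 3" using cong_iff_dvd_diff[of "4::int" 1 "int q"] cong_int_iff[of 4 1 q]
    by (simp add: cong_def) (metis int_dvd_int_iff of_nat_numeral)
  thus False using q_ge by (auto dest: dvd_imp_le)
qed

lemma bij_signed_powers:
  assumes m: "\<not> int q dvd m"
  shows "bij_betw (\<lambda>(i, s). s * 2 ^ i * m mod int q) ({..<p} \<times> {1, -1}) {1..<int q}"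
proof (rule bij_betw_signed_powers_of_2[OF q _ m])
  fix j assume j: "0 < j" "j < p"
  hence "\<not> p dvd j" by (auto dest: dvd_imp_le)
  thus "\<not> ([(2::int) ^ j = 1] (mod int q) \<or> [(2::int) ^ j = - 1] (mod int q))"
    using power2_cong_1_imp by blast
qed

lemma signed_power2:
  assumes "\<not> int q dvd a"
  obtains i where "i < p" "[a = 2 ^ i] (mod int q) \<or> [a = - (2 ^ i)] (mod int q)"
proof -
  have "a mod int q \<in> {1..<int q}"
    using assms mod_bounds[of a] by (simp add: dvd_eq_mod_eq_0)
  moreover have "\<not> int q dvd 1" using q_ge by (simp add: zdvd_not_zless)
  ultimately have "a mod int q \<in> (\<lambda>(i, s). s * 2 ^ i * 1 mod int q) ` ({..<p} \<times> {1, -1})"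
    using bij_signed_powers[of 1] unfolding bij_betw_def by blast
  then obtain x where x: "x \<in> {..<p} \<times> {1, -1 :: int}"
    "a mod int q = (\<lambda>(i, s). s * 2 ^ i * 1 mod int q) x"
    by (rule imageE)
  obtain i s where "x = (i, s)" by (cases x)
  with x have i: "i < p" and s: "s \<in> {1, -1 :: int}" and eq: "a mod int q = s * 2 ^ i * 1 mod int q"
    by simp_all
  have "[a = s * 2 ^ i] (mod int q)" using eq by (simp add: cong_def)
  moreover from s have "s = 1 \<or> s = - 1" by blast
  ultimately show ?thesis using that[OF i] by (elim disjE) simp_all
qed

definition even_periodic :: "(int \<Rightarrow> 'a) \<Rightarrow> bool" where
  "even_periodic F \<longleftrightarrow> (\<forall>x. F (x mod int q) = F x) \<and> (\<forall>x. \<not> int q dvd x \<longrightarrow> F (- x) = F x)"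

text \<open>One cycle of doublings represents the nonzero residues up to sign, so every value is met
  twice.\<close>

lemma sum_even_periodic:
  fixes F :: "int \<Rightarrow> 'a :: comm_ring_1"
  assumes F: "even_periodic F" and m: "\<not> int q dvd m"
  shows "(\<Sum>k\<in>{1..<int q}. F k) = 2 * (\<Sum>i<p. F (2 ^ i * m))"
proof -
  have F1: "F (x mod int q) = F x" and F2: "\<not> int q dvd x \<Longrightarrow> F (- x) = F x" for x
    using F unfolding even_periodic_def by blast+
  let ?A = "{..<p} \<times> {1, -1 :: int}"
  have "(\<Sum>k\<in>{1..<int q}. F k) = (\<Sum>x\<in>?A. F ((\<lambda>(i, s). s * 2 ^ i * m mod int q) x))"
    by (rule sum.reindex_bij_betw[OF bij_signed_powers[OF m], symmetric])
  also have "\<dots> = (\<Sum>(i, s)\<in>?A. F (s * 2 ^ i * m))"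
    by (rule sum.cong[OF refl]) (simp only: F1 split: prod.split, simp)
  also have "\<dots> = (\<Sum>i<p. \<Sum>s\<in>{1, -1}. F (s * 2 ^ i * m))"
    by (rule sum.cartesian_product[symmetric])
  also have "\<dots> = (\<Sum>i<p. 2 * F (2 ^ i * m))"
  proof (rule sum.cong[OF refl])
    fix i
    have "\<not> int q dvd 2 ^ i * m" using m by (simp add: units_def)
    from F2[OF this] have "F (- 1 * 2 ^ i * m) = F (2 ^ i * m)"
      by (simp only: mult_minus_left mult_1)
    moreover have "(\<Sum>s\<in>{1, -1}. f s) = f 1 + f (- 1)" for f :: "int \<Rightarrow> 'a" by simp
    ultimately show "(\<Sum>s\<in>{1, -1}. F (s * 2 ^ i * m)) = 2 * F (2 ^ i * m)"
      by (simp only: mult_1 mult_2)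
  qed
  finally show ?thesis by (simp add: sum_distrib_left)
qed

lemma sum_mult:
  assumes F: "\<And>x. F (x mod int q) = F x" and a: "\<not> int q dvd a"
  shows "(\<Sum>k\<in>{1..<int q}. F (a * k)) = (\<Sum>k\<in>{1..<int q}. (F k :: int))"
proof -
  have inj: "inj_on (\<lambda>k. a * k mod int q) {1..<int q}"
  proof (rule inj_onI)
    fix k l assume kl: "k \<in> {1..<int q}" "l \<in> {1..<int q}" "a * k mod int q = a * l mod int q"
    hence "int q dvd a * (k - l)" by (simp add: mod_eq_dvd_iff right_diff_distrib)
    hence "int q dvd k - l" using a units_def by blast
    thus "k = l" using kl by (simp flip: mod_eq_dvd_iff)
  qed
  have "(\<lambda>k. a * k mod int q) ` {1..<int q} \<subseteq> {1..<int q}"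
  proof
    fix y assume "y \<in> (\<lambda>k. a * k mod int q) ` {1..<int q}"
    then obtain k where k: "1 \<le> k" "k < int q" "y = a * k mod int q" by auto
    hence "\<not> int q dvd a * k" using a not_dvd_small[of k] units_def[of a k] by simp
    hence "y \<noteq> 0" using k by (simp add: dvd_eq_mod_eq_0)
    moreover have "0 \<le> y" "y < int q" using k q_ge by auto
    ultimately show "y \<in> {1..<int q}" by simp
  qed
  hence "bij_betw (\<lambda>k. a * k mod int q) {1..<int q} {1..<int q}"
    using inj by (simp add: bij_betw_def card_image card_subset_eq)
  from sum.reindex_bij_betw[OF this, of F] show ?thesis using F by simp
qed

text \<open>\<open>hi\<close> is the indicator of the residues in the upper half; \<open>sg\<close> is the sign of
  the conjugate of \<open>2 cos (2 \<pi> / q)\<close> indexed by \<open>x\<close>.\<close>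

definition hi :: "int \<Rightarrow> int" where
  "hi x = (if x mod int q > int p then 1 else 0)"

definition dis :: "nat \<Rightarrow> int \<Rightarrow> int" where
  "dis j x = (if hi x = hi (2 ^ j * x) then 0 else 1)"

abbreviation sg :: "int \<Rightarrow> int" where "sg \<equiv> dis 1"

lemma hi_01: "hi x = 0 \<or> hi x = 1" by (simp add: hi_def)

lemma hi_mod [simp]: "hi (x mod int q) = hi x" by (simp add: hi_def)

lemma hi_mult_mod [simp]: "hi (a * (x mod int q)) = hi (a * x)" by (simp add: hi_def mod_mult_right_eq)

lemma hi_cong: "[x = y] (mod int q) \<Longrightarrow> hi x = hi y" by (simp add: hi_def cong_def)

lemma hi_minus:
  assumes "\<not> int q dvd x"
  shows "hi (- x) = 1 - hi x"
proof -
  have "x mod int q \<noteq> 0" using assms by (simp add: dvd_eq_mod_eq_0)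
  hence "(- x) mod int q = int q - x mod int q" by (simp add: zmod_zminus1_eq_if)
  moreover have "int q - x mod int q > int p \<longleftrightarrow> \<not> x mod int q > int p"
    using int_q by linarith
  ultimately show ?thesis by (simp add: hi_def)
qed

text \<open>The bit \<open>hi x\<close> is the carry in doubling; this links sums of residues to
  sums of \<open>hi\<close>.\<close>

lemma double_mod: "2 * x mod int q = 2 * (x mod int q) - int q * hi x"
proof -
  define d r where "d = x div int q" and "r = x mod int q"
  have eq: "x = int q * d + r" unfolding d_def r_def by (rule mult_div_mod_eq[symmetric])
  have r: "0 \<le> r" "r < int q" using mod_bounds[of x] by (simp_all add: r_def)
  show ?thesis
  proof (cases "r > int p")
    case True
    have "2 * x = (2 * r - int q) + int q * (2 * d + 1)"
      unfolding eq by (simp add: algebra_simps)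
    hence "2 * x mod int q = (2 * r - int q) mod int q" by (metis mod_mult_self2)
    also have "\<dots> = 2 * r - int q"
      using True int_q r by (intro mod_pos_pos_trivial) linarith+
    finally show ?thesis using True by (simp add: hi_def r_def)
  next
    case False
    have "2 * x = 2 * r + int q * (2 * d)"
      unfolding eq by (simp add: algebra_simps)
    hence "2 * x mod int q = (2 * r) mod int q" by (metis mod_mult_self2)
    also have "\<dots> = 2 * r"
      using False int_q r by (intro mod_pos_pos_trivial) linarith+
    finally show ?thesis using False by (simp add: hi_def r_def)
  qed
qed

lemma even_periodic_dis: "even_periodic (dis j)"
  unfolding even_periodic_def
proof (intro conjI allI impI)
  fix x assume x: "\<not> int q dvd x"
  hence "\<not> int q dvd 2 ^ j * x" by (simp add: units_def)
  hence "hi (2 ^ j * - x) = 1 - hi (2 ^ j * x)" using hi_minus by simp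
  thus "dis j (- x) = dis j x" using hi_minus[OF x] by (simp add: dis_def)
qed (simp add: dis_def)

text \<open>Exclusive or written in the integers as \<open>a + b - 2 * a * b\<close>; the exact
  correction term is kept for the computation modulo 4.\<close>

lemma dis_Suc: "dis (Suc j) x = dis j x + sg (2 ^ j * x) - 2 * (dis j x * sg (2 ^ j * x))"
  using hi_01[of x] hi_01[of "2 ^ j * x"] hi_01[of "2 * 2 ^ j * x"]
  by (auto simp: dis_def mult.assoc)

lemma dis_sum_cong: "[dis j x = (\<Sum>l<j. sg (2 ^ l * x))] (mod 2)"
proof (induction j)
  case 0
  then show ?case by (simp add: dis_def)
next
  case (Suc j)
  have "[dis (Suc j) x = dis j x + sg (2 ^ j * x)] (mod 2)"
    unfolding dis_Suc[of j x] by (simp add: cong_iff_dvd_diff)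
  also have "[dis j x + sg (2 ^ j * x) = (\<Sum>l<Suc j. sg (2 ^ l * x))] (mod 2)"
    using Suc.IH by (simp add: cong_add)
  finally show ?case .
qed

lemma sum_shift:
  fixes F :: "int \<Rightarrow> int"
  assumes F: "even_periodic F" and m: "\<not> int q dvd m"
  shows "(\<Sum>i<p. F (2 ^ l * (2 ^ i * m))) = (\<Sum>i<p. F (2 ^ i * m))"
proof -
  have "\<not> int q dvd 2 ^ l * m" using m by (simp add: units_def)
  from sum_even_periodic[OF F this] sum_even_periodic[OF F m]
  have "(\<Sum>i<p. F (2 ^ i * (2 ^ l * m))) = (\<Sum>i<p. F (2 ^ i * m))" by simp
  thus ?thesis by (simp add: mult.left_commute)
qed

text \<open>The cosine is negative on the half of the circle opposite to 1. For
  \<open>q = 4 * t + 3\<close> this half contains \<open>2 * t + 2\<close> residues, and one cycle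
  of doublings sees half of them.\<close>

lemma sum_sg:
  assumes m: "\<not> int q dvd m"
  shows "(\<Sum>i<p. sg (2 ^ i * m)) = (int p + 1) div 2"
proof -
  obtain t where t: "p = 2 * t + 1" using odd_p by (elim oddE)
  have pt: "int p = 2 * int t + 1" "int q = 4 * int t + 3" using t int_q by linarith+
  let ?I = "{int t + 1..3 * int t + 2}"
  have "sg k = (if k \<in> ?I then 1 else 0)" if k: "k \<in> {1..<int q}" for k
  proof -
    have k': "1 \<le> k" "k < 4 * int t + 3" using k pt by auto
    have k1: "k mod int q = k" using k by simp
    hence hk: "hi k = (if k \<ge> 2 * int t + 2 then 1 else 0)" by (simp add: hi_def pt(1))
    have k2: "2 * k mod int q = 2 * k - int q * hi k" using double_mod[of k] k1 by simp
    show ?thesis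
    proof (cases "k \<ge> 2 * int t + 2")
      case True
      hence "2 * k mod int q = 2 * k - 4 * int t - 3" using k2 hk pt by simp
      hence "hi (2 * k) = (if k \<ge> 3 * int t + 3 then 1 else 0)"
        unfolding hi_def pt(1) by (simp add: pt(1))
      thus ?thesis using True hk k' by (simp add: dis_def)
    next
      case False
      hence "2 * k mod int q = 2 * k" using k2 hk by simp
      hence "hi (2 * k) = (if k \<ge> int t + 1 then 1 else 0)"
        unfolding hi_def pt(1) by simp
      thus ?thesis using False hk k' by (simp add: dis_def)
    qed
  qed
  hence "(\<Sum>k\<in>{1..<int q}. sg k) = (\<Sum>k\<in>{1..<int q}. if k \<in> ?I then 1 else 0)"
    by (intro sum.cong refl) blast
  also have "\<dots> = (\<Sum>k\<in>{1..<int q} \<inter> ?I. 1)"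
    by (rule sum.inter_restrict[symmetric]) simp
  also have "{1..<int q} \<inter> ?I = ?I" using pt by auto
  also have "(\<Sum>k\<in>?I. 1) = (2 * int t + 2 :: int)" by simp
  finally show ?thesis using sum_even_periodic[OF even_periodic_dis m, of 1] pt(1) by simp
qed

lemma power2_p: "[(2::int) ^ p = 1] (mod int q) \<or> [(2::int) ^ p = - 1] (mod int q)"
proof -
  have "\<not> q dvd 2" using q_ge by (auto dest: dvd_imp_le)
  hence "[2 ^ (q - 1) = 1] (mod q)" using q(1) fermat_theorem by blast
  hence "[int (2 ^ (q - 1)) = int 1] (mod int q)" using cong_int_iff by blast
  hence "int q dvd 2 ^ (2 * p) - 1" using q(2) by (simp add: cong_iff_dvd_diff)
  also have "(2::int) ^ (2 * p) - 1 = (2 ^ p - 1) * (2 ^ p - (- 1))"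
    by (simp add: algebra_simps power_mult power2_eq_square mult_2 flip: power_add)
  finally show ?thesis using q(1) by (simp add: prime_dvd_mult_iff cong_iff_dvd_diff)
qed

text \<open>If the autocorrelation of the signs over the field with two elements were constant, then \<open>Y\<close>,
  and hence \<open>G\<close>, would be determined modulo 4 by whether the quotient of the arguments is a power of
  2 modulo \<open>q\<close>. For the least positive \<open>n\<close> that is no power of 2 modulo \<open>q\<close> this contradicts the
  value of the sum of the squares of \<open>(k mod q) + ((n - 1) k mod q) - (n k mod q)\<close>, whose terms
  are \<open>0\<close> or \<open>q\<^sup>2\<close>.\<close>

definition Y :: "int \<Rightarrow> int \<Rightarrow> int" where
  "Y a b = (\<Sum>k\<in>{1..<int q}. hi (a * k) * hi (b * k))"

definition U :: "int \<Rightarrow> int \<Rightarrow> int" where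
  "U a b = (\<Sum>k\<in>{1..<int q}. (a * k mod int q) * hi (b * k))"

definition G :: "int \<Rightarrow> int \<Rightarrow> int" where
  "G a b = (\<Sum>k\<in>{1..<int q}. (a * k mod int q) * (b * k mod int q))"

lemma Y_commute: "Y a b = Y b a" by (simp add: Y_def mult.commute)

lemma not_dvd_1 [simp]: "\<not> int q dvd 1" using q_ge by (simp add: zdvd_not_zless)

lemma not_dvd_2 [simp]: "\<not> int q dvd 2" using q_ge by (simp add: zdvd_not_zless)

text \<open>The residues of \<open>k\<close> and \<open>- k\<close> add up to \<open>q\<close>, and
  multiplication by a unit only permutes the summands.\<close>

lemma sum_mod:
  assumes "\<not> int q dvd a"
  shows "(\<Sum>k\<in>{1..<int q}. a * k mod int q) = int q * int p"
proof -
  have S: "(\<Sum>k\<in>{1..<int q}. a * k mod int q) = (\<Sum>k\<in>{1..<int q}. k mod int q)"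
    if "\<not> int q dvd a" for a
    using that by (rule sum_mult[where F = "\<lambda>x. x mod int q", rotated]) simp
  have "(\<Sum>k\<in>{1..<int q}. k mod int q) = (\<Sum>k\<in>{1..<int q}. - 1 * k mod int q)"
    by (rule S[symmetric]) simp
  also have "\<dots> = (\<Sum>k\<in>{1..<int q}. int q - k mod int q)"
    by (rule sum.cong[OF refl]) (simp add: zmod_zminus1_eq_if)
  also have "\<dots> = (int q - 1) * int q - (\<Sum>k\<in>{1..<int q}. k mod int q)"
    using q_ge by (simp add: sum_subtractf)
  finally show ?thesis using S[OF assms] int_q by simp
qed

lemma sum_hi:
  assumes "\<not> int q dvd a"
  shows "(\<Sum>k\<in>{1..<int q}. hi (a * k)) = int p"
proof -
  have "(\<Sum>k\<in>{1..<int q}. 2 * (a * k) mod int q) = 2 * (\<Sum>k\<in>{1..<int q}. a * k mod int q) - int q * (\<Sum>k\<in>{1..<int q}. hi (a * k))"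
    unfolding double_mod by (simp add: sum_subtractf sum_distrib_left)
  moreover have "\<not> int q dvd 2 * a" using assms by (simp add: units_def)
  ultimately have "int q * int p = int q * (\<Sum>k\<in>{1..<int q}. hi (a * k))"
    using sum_mod[of a] sum_mod[of "2 * a"] assms by (simp add: mult.assoc)
  thus ?thesis using q_ge by simp
qed

text \<open>Replacing \<open>k\<close> by \<open>2 * k\<close> permutes the residues, and the
  residue of \<open>2 * x\<close> has the parity of \<open>hi x\<close> because \<open>q\<close> is
  odd.\<close>

lemma U_cong:
  assumes "\<not> int q dvd a"
  shows "[U a b = Y a (2 * b)] (mod 2)"
proof -
  have "U a b = (\<Sum>k\<in>{1..<int q}. (a * (2 * k) mod int q) * hi (b * (2 * k)))"
    unfolding U_def
    by (rule sum_mult[where F = "\<lambda>x. (a * x mod int q) * hi (b * x)", symmetric])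
       (simp_all add: mod_mult_right_eq)
  also have "[\<dots> = (\<Sum>k\<in>{1..<int q}. hi (a * k) * hi (2 * b * k))] (mod 2)"
  proof (rule cong_sum)
    fix k
    have "a * (2 * k) mod int q = 2 * (a * k mod int q) - int q * hi (a * k)"
      using double_mod[of "a * k"] by (simp add: mult.left_commute)
    also have "[\<dots> = hi (a * k)] (mod 2)"
      by (simp add: cong_iff_dvd_diff int_q algebra_simps)
    finally have "[a * (2 * k) mod int q = hi (a * k)] (mod 2)" .
    moreover have "b * (2 * k) = 2 * b * k" by simp
    ultimately show "[(a * (2 * k) mod int q) * hi (b * (2 * k)) = hi (a * k) * hi (2 * b * k)] (mod 2)"
      by (simp only: cong_mult cong_refl)
  qed
  finally show ?thesis by (simp add: Y_def)
qed

text \<open>The same substitution reproduces \<open>4 * G a b\<close> up to carries, which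
  contribute \<open>U\<close> and \<open>Y\<close>.\<close>

lemma G_eq: "3 * G a b = 2 * int q * (U a b + U b a) - int q ^ 2 * Y a b"
proof -
  have "G a b = (\<Sum>k\<in>{1..<int q}. (a * (2 * k) mod int q) * (b * (2 * k) mod int q))"
    unfolding G_def
    by (rule sum_mult[where F = "\<lambda>x. (a * x mod int q) * (b * x mod int q)", symmetric])
       (simp_all add: mod_mult_right_eq)
  also have "\<dots> = (\<Sum>k\<in>{1..<int q}. (2 * (a * k mod int q) - int q * hi (a * k)) *
      (2 * (b * k mod int q) - int q * hi (b * k)))"
    by (simp add: mult.left_commute[of _ 2] double_mod)
  also have "\<dots> = (\<Sum>k\<in>{1..<int q}. 4 * ((a * k mod int q) * (b * k mod int q))
      - 2 * int q * ((a * k mod int q) * hi (b * k) + (b * k mod int q) * hi (a * k))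
      + int q ^ 2 * (hi (a * k) * hi (b * k)))"
    by (rule sum.cong[OF refl]) (simp add: algebra_simps power2_eq_square)
  also have "\<dots> = 4 * G a b - 2 * int q * (U a b + U b a) + int q ^ 2 * Y a b"
    unfolding G_def U_def Y_def
    by (simp add: sum.distrib sum_subtractf sum_distrib_left distrib_left mult.assoc)
  finally show ?thesis by simp
qed

lemma sum_squares: "6 * (\<Sum>k\<in>{1..<int n}. k ^ 2) = (int n - 1) * int n * (2 * int n - 1)"
proof (induction n)
  case (Suc n)
  show ?case
  proof (cases "n = 0")
    case False
    hence "{1..<int (Suc n)} = insert (int n) {1..<int n}" by auto
    thus ?thesis using Suc by (simp add: algebra_simps power2_eq_square)
  qed simp
qed simp

text \<open>Once \<open>2 ^ p\<close> is known to be 1 modulo \<open>q\<close>, this is a subgroup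
  of index 2 in the units that does not contain -1.\<close>

definition cls :: "int \<Rightarrow> bool" where
  "cls a \<longleftrightarrow> (\<exists>j. [a = 2 ^ j] (mod int q))"

lemma cls_unit: "cls a \<Longrightarrow> \<not> int q dvd a"
  unfolding cls_def using not_dvd_power2 cong_dvd_iff by blast

lemma cls_1: "cls 1" unfolding cls_def by (rule exI[of _ 0]) simp

lemma cls_double: "cls a \<Longrightarrow> cls (2 * a)"
  unfolding cls_def by (metis cong_scalar_left power_Suc)

text \<open>The assumption \<open>H\<close> is to be refuted: every autocorrelation has the parity
  of the one at shift 0, which is the sum of the signs because \<open>sg\<close> only takes the
  values 0 and 1.\<close>

context
  fixes m :: int
  assumes m: "\<not> int q dvd m" and p3: "p mod 4 = 3"
    and H: "\<And>j. [(\<Sum>i<p. sg (2 ^ i * m) * sg (2 ^ j * (2 ^ i * m))) = (\<Sum>i<p. sg (2 ^ i * m))] (mod 2)"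
begin

lemma sg_sum_even: "even (\<Sum>i<p. sg (2 ^ i * m))"
  unfolding sum_sg[OF m] using p3 by presburger

text \<open>By \<open>dis_Suc\<close>, each step adds the sum of the signs and subtracts twice a
  cross term \<open>W\<close>. Modulo 2, \<open>W\<close> is a sum of autocorrelations, all even by
  \<open>H\<close>, so this correction vanishes modulo 4.\<close>

lemma dis_sum_mod_4: "[(\<Sum>i<p. dis j (2 ^ i * m)) = int j * (\<Sum>i<p. sg (2 ^ i * m))] (mod 4)"
proof (induction j)
  case 0
  then show ?case by (simp add: dis_def)
next
  case (Suc j)
  let ?S = "\<Sum>i<p. sg (2 ^ i * m)"
  define W where "W = (\<Sum>i<p. dis j (2 ^ i * m) * sg (2 ^ j * (2 ^ i * m)))"
  have "[W = (\<Sum>i<p. (\<Sum>l<j. sg (2 ^ l * (2 ^ i * m))) * sg (2 ^ j * (2 ^ i * m)))] (mod 2)"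
    unfolding W_def by (intro cong_sum cong_mult dis_sum_cong cong_refl)
  also have "(\<Sum>i<p. (\<Sum>l<j. sg (2 ^ l * (2 ^ i * m))) * sg (2 ^ j * (2 ^ i * m))) =
    (\<Sum>l<j. \<Sum>i<p. sg (2 ^ l * (2 ^ i * m)) * sg (2 ^ j * (2 ^ i * m)))"
    unfolding sum_distrib_right by (rule sum.swap)
  also have "[\<dots> = (\<Sum>l<j. 0)] (mod 2)"
  proof (rule cong_sum)
    fix l assume "l \<in> {..<j}"
    hence lj: "j = (j - l) + l" by simp
    define F where "F = (\<lambda>x. sg x * sg (2 ^ (j - l) * x))"
    have F: "even_periodic F"
      using even_periodic_dis[of 1] not_dvd_power2 units_def unfolding even_periodic_def F_def
      by (metis mod_mult_right_eq mult_minus_right)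
    have "(2::int) ^ j = 2 ^ (j - l) * 2 ^ l" by (subst lj) (rule power_add)
    hence "(\<Sum>i<p. sg (2 ^ l * (2 ^ i * m)) * sg (2 ^ j * (2 ^ i * m))) = (\<Sum>i<p. F (2 ^ l * (2 ^ i * m)))"
      unfolding F_def by (simp add: mult.assoc)
    also have "\<dots> = (\<Sum>i<p. F (2 ^ i * m))" by (rule sum_shift[OF F m])
    also have "[\<dots> = ?S] (mod 2)" unfolding F_def by (rule H)
    also have "[?S = 0] (mod 2)" using sg_sum_even by (simp add: cong_0_iff)
    finally show "[(\<Sum>i<p. sg (2 ^ l * (2 ^ i * m)) * sg (2 ^ j * (2 ^ i * m))) = 0] (mod 2)" .
  qed
  finally have "[W = 0] (mod 2)" by simp
  then obtain x where x: "W = 2 * x" by (auto simp: cong_0_iff)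
  have "(\<Sum>i<p. dis (Suc j) (2 ^ i * m)) =
    (\<Sum>i<p. dis j (2 ^ i * m)) + (\<Sum>i<p. sg (2 ^ j * (2 ^ i * m))) - 2 * W"
    unfolding dis_Suc[of j] W_def by (simp only: sum.distrib sum_subtractf sum_distrib_left)
  also have "(\<Sum>i<p. sg (2 ^ j * (2 ^ i * m))) = ?S"
    by (rule sum_shift[OF even_periodic_dis m])
  also have "[(\<Sum>i<p. dis j (2 ^ i * m)) + ?S - 2 * W = int j * ?S + ?S - 0] (mod 4)"
    using Suc.IH by (intro cong_diff cong_add) (simp_all add: x cong_0_iff)
  finally show ?case by (simp add: algebra_simps)
qed

text \<open>If \<open>2 ^ p\<close> were -1, all values of \<open>dis p\<close> would be 1, and
  \<open>dis_sum_mod_4\<close> at \<open>p\<close> would make \<open>p\<close> even.\<close>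

lemma power2_p_eq: "[(2::int) ^ p = 1] (mod int q)"
proof (rule ccontr)
  assume "\<not> [(2::int) ^ p = 1] (mod int q)"
  hence neg: "[(2::int) ^ p = - 1] (mod int q)" using power2_p by blast
  have "dis p (2 ^ i * m) = 1" for i
  proof -
    have u: "\<not> int q dvd 2 ^ i * m" using m by (simp add: units_def)
    have "[2 ^ p * (2 ^ i * m) = - (2 ^ i * m)] (mod int q)"
      using cong_scalar_right[OF neg, of "2 ^ i * m"] by simp
    hence "hi (2 ^ p * (2 ^ i * m)) = 1 - hi (2 ^ i * m)" using hi_cong hi_minus[OF u] by metis
    thus ?thesis using hi_01[of "2 ^ i * m"] by (auto simp: dis_def)
  qed
  hence "[int p = int p * (\<Sum>i<p. sg (2 ^ i * m))] (mod 4)" using dis_sum_mod_4[of p] by simp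
  hence "[int p = int p * (\<Sum>i<p. sg (2 ^ i * m))] (mod 2)" by (rule cong_dvd_modulus) simp
  hence "even (int p)" using sg_sum_even by (simp add: cong_iff_dvd_diff)
  thus False using odd_p by simp
qed

text \<open>Now \<open>dis p\<close> vanishes along the cycle, so 4 divides \<open>p\<close> times
  the sum of the signs. Hence 4 divides this sum, which is \<open>(p + 1) / 2\<close>.\<close>

lemma dis_sum_cong_0: "[(\<Sum>i<p. dis j (2 ^ i * m)) = 0] (mod 4)"
  and p7: "p mod 8 = 7"
proof -
  let ?S = "\<Sum>i<p. sg (2 ^ i * m)"
  have "dis p (2 ^ i * m) = 0" for i
    using hi_cong[OF cong_scalar_right[OF power2_p_eq, of "2 ^ i * m"]] by (simp add: dis_def)
  hence "[0 = int p * ?S] (mod 4)" using dis_sum_mod_4[of p] by simp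
  hence "4 dvd int p * ?S" using cong_0_iff cong_sym by blast
  then obtain c where c: "int p * ?S = 4 * c" by blast
  obtain t where t: "int p = 2 * t + 1" using odd_p by (metis even_of_nat oddE)
  obtain s where s: "?S = 2 * s" using sg_sum_even by blast
  have "?S = 4 * (c - t * s)" using c unfolding t s by (simp add: algebra_simps)
  hence S: "4 dvd ?S" by simp
  show "p mod 8 = 7" using S p3 unfolding sum_sg[OF m] by presburger
  have "[int j * ?S = 0] (mod 4)" using S by (simp add: cong_0_iff)
  with dis_sum_mod_4[of j] show "[(\<Sum>i<p. dis j (2 ^ i * m)) = 0] (mod 4)" by (rule cong_trans)
qed

text \<open>Twice the product of two bits is their sum minus their disagreement, and the
  disagreements over a cycle add up to 0 modulo 4.\<close>

lemma Y_power2: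
  assumes a: "\<not> int q dvd a" and b: "[b = 2 ^ j * a] (mod int q)"
  shows "[Y a b = int p] (mod 4)"
proof -
  have "hi (b * k) = hi (2 ^ j * (a * k))" for k
    using hi_cong[OF cong_scalar_right[OF b, of k]] by (simp add: mult.assoc)
  hence "Y a b = (\<Sum>k\<in>{1..<int q}. hi (a * k) * hi (2 ^ j * (a * k)))"
    by (simp add: Y_def)
  also have "\<dots> = (\<Sum>k\<in>{1..<int q}. hi k * hi (2 ^ j * k))"
    by (rule sum_mult[where F = "\<lambda>x. hi x * hi (2 ^ j * x)"]) (simp_all add: a)
  finally have "2 * Y a b = (\<Sum>k\<in>{1..<int q}. 2 * (hi k * hi (2 ^ j * k)))"
    by (simp add: sum_distrib_left)
  also have "\<dots> = (\<Sum>k\<in>{1..<int q}. hi k + hi (2 ^ j * k) - dis j k)"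
  proof (rule sum.cong[OF refl])
    fix k show "2 * (hi k * hi (2 ^ j * k)) = hi k + hi (2 ^ j * k) - dis j k"
      using hi_01[of k] hi_01[of "2 ^ j * k"] by (auto simp: dis_def)
  qed
  also have "\<dots> = int p + int p - 2 * (\<Sum>i<p. dis j (2 ^ i * m))"
    using sum_hi[of 1] sum_hi[of "2 ^ j"] sum_even_periodic[OF even_periodic_dis m, of j]
    by (simp add: sum.distrib sum_subtractf)
  finally have "Y a b = int p - (\<Sum>i<p. dis j (2 ^ i * m))" by simp
  thus ?thesis using cong_diff[OF cong_refl[of "int p"] dis_sum_cong_0[of j]] by simp
qed

lemma power2_mult_p: "[(2::int) ^ (p * i) = 1] (mod int q)"
  using cong_pow[OF power2_p_eq, of i] by (simp add: power_mult)

lemma Y_same: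
  assumes "cls a" "cls b"
  shows "[Y a b = int p] (mod 4)"
proof -
  obtain i j where ij: "[a = 2 ^ i] (mod int q)" "[b = 2 ^ j] (mod int q)"
    using assms by (auto simp: cls_def)
  \<comment> \<open>The exponent \<open>j + (p - 1) * i\<close> stands for \<open>j - i\<close>, as
    \<open>2 ^ p\<close> is 1 modulo \<open>q\<close>.\<close>
  have "[2 ^ (j + (p - 1) * i) * a = 2 ^ (j + (p - 1) * i) * 2 ^ i] (mod int q)"
    by (rule cong_scalar_left[OF ij(1)])
  also have "(2::int) ^ (j + (p - 1) * i) * 2 ^ i = 2 ^ j * 2 ^ (p * i)"
    using p(2) by (cases p) (simp_all add: power_add mult_ac)
  also have "[\<dots> = 2 ^ j * 1] (mod int q)" by (rule cong_scalar_left[OF power2_mult_p])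
  also have "[2 ^ j * 1 = b] (mod int q)" using ij(2) by (simp add: cong_sym)
  finally show ?thesis using Y_power2[OF cls_unit[OF assms(1)]] cong_sym by blast
qed

lemma not_cls_minus_1: "\<not> cls (- 1)"
proof
  assume "cls (- 1)"
  then obtain j where j: "[- 1 = (2::int) ^ j] (mod int q)" by (auto simp: cls_def)
  hence "p dvd j" using power2_cong_1_imp cong_sym by blast
  then obtain i where "j = p * i" by blast
  hence "[- 1 = (1::int)] (mod int q)" using j power2_mult_p cong_trans by blast
  hence "int q dvd 2" by (simp add: cong_iff_dvd_diff)
  thus False by simp
qed

lemma cls_minus:
  assumes "\<not> int q dvd a" "\<not> cls a"
  shows "cls (- a)"
proof -
  obtain i where "[a = 2 ^ i] (mod int q) \<or> [a = - (2 ^ i)] (mod int q)"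
    using signed_power2[OF assms(1)] by metis
  hence "[a = - (2 ^ i)] (mod int q)" using assms(2) unfolding cls_def by blast
  hence "[- a = 2 ^ i] (mod int q)" using cong_minus_minus_iff[of a "- (2 ^ i)"] by simp
  thus ?thesis unfolding cls_def by blast
qed

text \<open>Here \<open>- b\<close> is a power of 2 and \<open>hi (b * k)\<close> is the complement
  of \<open>hi (- b * k)\<close>, so \<open>Y a b\<close> is \<open>p - Y a (- b)\<close>.\<close>

lemma Y_diff:
  assumes "cls a" "\<not> cls b" "\<not> int q dvd b"
  shows "[Y a b = 0] (mod 4)"
proof -
  have b: "cls (- b)" using assms cls_minus by blast
  have "Y a b = (\<Sum>k\<in>{1..<int q}. hi (a * k) - hi (a * k) * hi (- b * k))"
    unfolding Y_def
  proof (rule sum.cong[OF refl])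
    fix k assume "k \<in> {1..<int q}"
    hence "\<not> int q dvd - b * k" using assms(3) not_dvd_small[of k] units_def[of "- b" k] by simp
    from hi_minus[OF this] have "hi (b * k) = 1 - hi (- b * k)" by simp
    thus "hi (a * k) * hi (b * k) = hi (a * k) - hi (a * k) * hi (- b * k)"
      by (simp only: right_diff_distrib mult_1_right)
  qed
  also have "\<dots> = int p - Y a (- b)"
    unfolding sum_subtractf sum_hi[OF cls_unit[OF assms(1)]] Y_def ..
  also have "[\<dots> = int p - int p] (mod 4)"
    by (rule cong_diff[OF cong_refl Y_same[OF assms(1) b]])
  finally show ?thesis by simp
qed

lemma not_cls_double: "\<not> cls b \<Longrightarrow> \<not> cls (2 * b)"
proof
  assume "cls (2 * b)" and b: "\<not> cls b"
  then obtain j where "[2 * b = 2 ^ j] (mod int q)" by (auto simp: cls_def)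
  hence "[2 ^ (p - 1) * (2 * b) = 2 ^ (p - 1) * 2 ^ j] (mod int q)" by (rule cong_scalar_left)
  moreover have "(2::int) ^ (p - 1) * (2 * b) = 2 ^ p * b"
    using p(2) by (cases p) simp_all
  moreover have "[2 ^ p * b = b] (mod int q)" using cong_scalar_right[OF power2_p_eq, of b] by simp
  ultimately have "[b = 2 ^ (p - 1 + j)] (mod int q)" by (metis cong_sym cong_trans power_add)
  thus False using b by (auto simp: cls_def)
qed

text \<open>The two values of \<open>U\<close> in \<open>G_eq\<close> are congruent to
  \<open>c\<close> modulo 2, so their sum is even and its multiple by \<open>2 * q\<close> is 0
  modulo 4. What remains is \<open>- Y a b\<close>, and 3 is -1 modulo 4.\<close>

lemma G_mod_4:
  assumes "\<not> int q dvd a" "\<not> int q dvd b" "[Y a (2 * b) = c] (mod 4)" "[Y b (2 * a) = c] (mod 4)" "[Y a b = c] (mod 4)"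
  shows "[G a b = c] (mod 4)"
proof -
  obtain u where u: "U a b = Y a (2 * b) + 2 * u"
    using U_cong[OF assms(1), of b] by (metis cong_iff_lin cong_sym mult.commute)
  obtain v where v: "U b a = Y b (2 * a) + 2 * v"
    using U_cong[OF assms(2), of a] by (metis cong_iff_lin cong_sym mult.commute)
  obtain x where x: "Y a (2 * b) = c + 4 * x" using assms(3) by (metis cong_iff_lin cong_sym)
  obtain y where y: "Y b (2 * a) = c + 4 * y" using assms(4) by (metis cong_iff_lin cong_sym)
  obtain z where z: "Y a b = c + 4 * z" using assms(5) by (metis cong_iff_lin cong_sym)
  obtain t where t: "p = 2 * t + 1" using odd_p by (elim oddE)
  have Q: "int q = 4 * int t + 3" using int_q t by simp
  have "3 * G a b + c = 4 * (int q * (c + 2 * x + 2 * y + u + v) - (4 * int t ^ 2 + 6 * int t + 2) * c - int q ^ 2 * z)"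
    unfolding G_eq u v x y z Q by (simp add: algebra_simps power2_eq_square)
  thus ?thesis by (simp add: cong_iff_dvd_diff) presburger
qed

lemma sign_autocorrelation_const_imp_False: False
proof -
  have "\<not> cls (int (q - 1))"
  proof
    assume "cls (int (q - 1))"
    then obtain j where "[int (q - 1) = 2 ^ j] (mod int q)" by (auto simp: cls_def)
    moreover have "[- 1 = int (q - 1)] (mod int q)" using q_ge by (simp add: cong_iff_dvd_diff of_nat_diff)
    ultimately have "cls (- 1)" unfolding cls_def using cong_trans by blast
    thus False using not_cls_minus_1 by simp
  qed
  hence ex: "0 < q - 1 \<and> \<not> cls (int (q - 1))" using q_ge by simp
  define n where "n = (LEAST n. 0 < n \<and> \<not> cls (int n))"
  have n: "0 < n" "\<not> cls (int n)" using LeastI[of "\<lambda>n. 0 < n \<and> \<not> cls (int n)", OF ex] by (simp_all add: n_def)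
  have "n \<le> q - 1" unfolding n_def by (rule Least_le[of "\<lambda>n. 0 < n \<and> \<not> cls (int n)", OF ex])
  moreover have "n \<noteq> 1" using n(2) cls_1 by auto
  ultimately have n2: "2 \<le> n" "n < q" using n(1) q_ge by linarith+
  \<comment> \<open>By minimality \<open>1\<close> and \<open>n - 1\<close> are powers of 2 modulo
    \<open>q\<close>, while their sum \<open>n\<close> is not.\<close>
  have "cls (int (n - 1))"
  proof (rule ccontr)
    assume "\<not> cls (int (n - 1))"
    hence "n \<le> n - 1" unfolding n_def[symmetric] using n2 Least_le[of "\<lambda>n. 0 < n \<and> \<not> cls (int n)" "n - 1"]
      by (simp add: n_def)
    thus False using n(1) by simp
  qed
  hence c1: "cls (int n - 1)" using n(1) by (simp add: of_nat_diff)
  have un: "\<not> int q dvd int n" using not_dvd_small[of "int n"] n2 by simp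
  have un1: "\<not> int q dvd int n - 1" using cls_unit[OF c1] .
  have G1: "[G 1 (int n - 1) = int p] (mod 4)"
    using un1 c1 cls_1 by (intro G_mod_4 Y_same cls_double) simp_all
  have u2n: "\<not> int q dvd 2 * int n" using un by (simp add: units_def)
  have G_diff: "[G a (int n) = 0] (mod 4)" if a: "cls a" for a
  proof (rule G_mod_4)
    show "[Y a (2 * int n) = 0] (mod 4)" by (rule Y_diff[OF a not_cls_double[OF n(2)] u2n])
    show "[Y (int n) (2 * a) = 0] (mod 4)"
      unfolding Y_commute[of "int n"] by (rule Y_diff[OF cls_double[OF a] n(2) un])
    show "[Y a (int n) = 0] (mod 4)" by (rule Y_diff[OF a n(2) un])
  qed (rule cls_unit[OF a] un)+
  have G2: "[G 1 (int n) = 0] (mod 4)" by (rule G_diff[OF cls_1])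
  have G3: "[G (int n - 1) (int n) = 0] (mod 4)" by (rule G_diff[OF c1])
  \<comment> \<open>This is \<open>q\<close> times the carry in adding the residues of
    \<open>k\<close> and \<open>(n - 1) * k\<close>.\<close>
  define \<delta> where "\<delta> k = (1 * k mod int q) + ((int n - 1) * k mod int q) - (int n * k mod int q)" for k
  have \<delta>: "\<delta> k = 0 \<or> \<delta> k = int q" for k
  proof -
    let ?a = "1 * k mod int q" and ?b = "(int n - 1) * k mod int q"
    have "int n * k mod int q = (?a + ?b) mod int q"
      by (simp add: mod_add_eq algebra_simps)
    also have "\<dots> = (if ?a + ?b < int q then ?a + ?b else ?a + ?b - int q)"
    proof (cases "?a + ?b < int q")
      case True
      thus ?thesis using mod_bounds[of "1 * k"] mod_bounds[of "(int n - 1) * k"]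
        by (simp only: if_True) (rule mod_pos_pos_trivial, linarith+)
    next
      case False
      have "(?a + ?b) mod int q = (?a + ?b - int q) mod int q" by (rule minus_mod_self2[symmetric])
      also have "\<dots> = ?a + ?b - int q"
        using False mod_bounds[of "1 * k"] mod_bounds[of "(int n - 1) * k"]
        by (intro mod_pos_pos_trivial) linarith+
      finally show ?thesis using False by simp
    qed
    finally have "int n * k mod int q = ?a + ?b \<or> int n * k mod int q = ?a + ?b - int q" by presburger
    thus ?thesis unfolding \<delta>_def by linarith
  qed
  have "(\<Sum>k\<in>{1..<int q}. \<delta> k) = int q * int p"
    unfolding \<delta>_def sum.distrib sum_subtractf using un un1 sum_mod[of 1] by (simp add: sum_mod)
  moreover have "(\<Sum>k\<in>{1..<int q}. \<delta> k ^ 2) = (\<Sum>k\<in>{1..<int q}. int q * \<delta> k)"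
  proof (rule sum.cong[OF refl])
    fix k show "\<delta> k ^ 2 = int q * \<delta> k" using \<delta>[of k] by (auto simp: power2_eq_square)
  qed
  ultimately have D: "(\<Sum>k\<in>{1..<int q}. \<delta> k ^ 2) = int q ^ 2 * int p"
    by (simp add: power2_eq_square mult.assoc flip: sum_distrib_left)
  define Q where "Q = (\<Sum>k\<in>{1..<int q}. k ^ 2)"
  have Q1: "(\<Sum>k\<in>{1..<int q}. (a * k mod int q) ^ 2) = Q" if "\<not> int q dvd a" for a
  proof -
    have "(\<Sum>k\<in>{1..<int q}. (a * k mod int q) ^ 2) = (\<Sum>k\<in>{1..<int q}. (k mod int q) ^ 2)"
      using that by (intro sum_mult[where F = "\<lambda>x. (x mod int q) ^ 2"]) simp_all
    thus ?thesis by (simp add: Q_def)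
  qed
  have "(\<Sum>k\<in>{1..<int q}. \<delta> k ^ 2) = (\<Sum>k\<in>{1..<int q}.
      (1 * k mod int q) ^ 2 + ((int n - 1) * k mod int q) ^ 2 + (int n * k mod int q) ^ 2
      + 2 * ((1 * k mod int q) * ((int n - 1) * k mod int q))
      - 2 * ((1 * k mod int q) * (int n * k mod int q))
      - 2 * (((int n - 1) * k mod int q) * (int n * k mod int q)))"
    unfolding \<delta>_def by (rule sum.cong[OF refl]) (simp only: power2_eq_square algebra_simps)
  also have "\<dots> = 3 * Q + 2 * G 1 (int n - 1) - 2 * G 1 (int n) - 2 * G (int n - 1) (int n)"
    unfolding sum.distrib sum_subtractf G_def sum_distrib_left[symmetric]
      Q1[OF not_dvd_1] Q1[OF un] Q1[OF un1] by simp
  finally have E: "3 * Q + 2 * G 1 (int n - 1) - 2 * G 1 (int n) - 2 * G (int n - 1) (int n) = int q ^ 2 * int p"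
    using D by simp
  have "6 * Q = (int q - 1) * int q * (2 * int q - 1)" unfolding Q_def by (rule sum_squares)
  hence Q3: "3 * Q = int p * int q * (2 * int q - 1)" using int_q by simp
  obtain x where x: "G 1 (int n - 1) = int p + 4 * x" using G1 by (metis cong_iff_lin cong_sym)
  obtain y where y: "G 1 (int n) = 4 * y" using G2 by (auto simp: cong_0_iff)
  obtain z where z: "G (int n - 1) (int n) = 4 * z" using G3 by (auto simp: cong_0_iff)
  define w where "w = int (p div 8)"
  have w: "int p = 8 * w + 7" using p7 unfolding w_def by presburger
  \<comment> \<open>For \<open>p = 8 * w + 7\<close> the right-hand side turns out to be an odd
    multiple of 4.\<close>
  have "8 * (x - y - z) = int p * (int q * int q - int q * (2 * int q - 1) - 2)"
    using E unfolding Q3 x y z by (simp add: algebra_simps power2_eq_square)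
  also have "\<dots> = 8 * (- (8 * w + 7) * (32 * w ^ 2 + 58 * w + 26)) - 4 * (8 * w + 7)"
    unfolding int_q w by (simp add: algebra_simps power2_eq_square)
  finally show False by presburger
qed

end

theorem sign_autocorrelation_not_const:
  assumes "\<not> int q dvd m" "p mod 4 = 3"
  obtains j where "\<not> [(\<Sum>i<p. sg (2 ^ i * m) * sg (2 ^ (i + j) * m)) = (\<Sum>i<p. sg (2 ^ i * m))] (mod 2)"
  using sign_autocorrelation_const_imp_False[OF assms] that
  by (simp add: power_add mult_ac) blast

end

section \<open>Polynomials over the field with two elements\<close>

lemma pcompose_monom_monom:
  fixes c :: "'a :: comm_ring_1"
  shows "pcompose (monom c i) (monom 1 a) = monom c (a * i)"
  by (induction i) (simp_all add: monom_0 monom_Suc pcompose_pCons smult_monom mult_monom)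

lemma pcompose_pcompose_monom:
  fixes f :: "'a :: comm_ring_1 poly"
  shows "pcompose (pcompose f (monom 1 a)) (monom 1 b) = pcompose f (monom 1 (a * b))"
  by (simp add: pcompose_monom_monom mult.commute flip: pcompose_assoc)

lemma pcompose_monom_1 [simp]:
  fixes f :: "'a :: comm_ring_1 poly"
  shows "pcompose f (monom 1 1) = f"
  using pcompose_idR[of f] by (simp add: monom_Suc monom_0)

text \<open>The Frobenius map: the mixed term has the factor 2, and every coefficient equals its
  square.\<close>

lemma bit_poly_square:
  fixes f :: "bit poly"
  shows "f ^ 2 = pcompose f (monom 1 2)"
proof (induction f)
  case (pCons a f)
  have "pCons a f = [:a:] + monom 1 1 * f" by (simp add: monom_altdef)
  hence "(pCons a f) ^ 2 = ([:a:] + monom 1 1 * f) ^ 2" by simp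
  also have "\<dots> = [:a:] ^ 2 + (monom 1 1 * f) ^ 2 + 2 * ([:a:] * (monom 1 1 * f))"
    by (simp only: power2_sum mult.assoc)
  also have "(2 :: bit poly) = 0" by (simp add: numeral_poly)
  also have "[:a:] ^ 2 = [:a:]" by (cases a) (simp_all add: power2_eq_square one_pCons)
  also have "(monom 1 1 * f) ^ 2 = monom 1 2 * pcompose f (monom 1 2)"
    by (simp add: power_mult_distrib monom_power pCons.IH)
  finally show ?case by (simp add: pcompose_pCons)
qed simp

lemma bit_poly_power_power2:
  fixes f :: "bit poly"
  shows "f ^ 2 ^ k = pcompose f (monom 1 (2 ^ k))"
proof (induction k)
  case 0
  then show ?case using pcompose_monom_1[of f] by simp
next
  case (Suc k)
  have "f ^ 2 ^ Suc k = (f ^ 2 ^ k) ^ 2" by (simp add: power_mult mult.commute flip: power_mult)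
  also have "\<dots> = pcompose (pcompose f (monom 1 (2 ^ k))) (monom 1 2)"
    by (simp add: Suc.IH bit_poly_square)
  finally show ?case by (simp add: pcompose_pcompose_monom mult.commute)
qed

section \<open>The group algebra of a cyclic group of order \<open>p\<close> over the field with two
  elements\<close>

locale odd_prime =
  fixes p :: nat
  assumes p: "Factorial_Ring.prime p" "p > 2"
begin

text \<open>Polynomials modulo \<open>M\<close> are bit sequences of period \<open>p\<close>, with
  multiplication by X as the cyclic shift.\<close>

definition M :: "bit poly" where "M = monom 1 p - 1"

text \<open>Its scalar multiples are the constant sequences.\<close>

definition J :: "bit poly" where "J = (\<Sum>i<p. monom 1 i)"

lemma degree_M: "degree M = p"
proof -
  have "degree (monom 1 p + - 1 :: bit poly) = degree (monom 1 p :: bit poly)"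
    using p by (intro degree_add_eq_left) (simp add: degree_monom_eq)
  thus ?thesis unfolding M_def diff_conv_add_uminus[of "monom 1 p"] by (simp add: degree_monom_eq)
qed

lemma monom_cong_1: "[monom 1 (p * k) = 1] (mod M)"
proof (induction k)
  case (Suc k)
  have "[monom 1 p = 1] (mod M)" by (simp add: cong_iff_dvd_diff M_def)
  from cong_mult[OF this Suc] show ?case by (simp add: mult_monom)
qed simp

lemma monom_cong:
  assumes "[a = b] (mod p)"
  shows "[monom c a = monom c b] (mod M)"
proof -
  have red: "[monom c a = monom c (a mod p)] (mod M)" for a
  proof -
    have "monom c a = monom c (a mod p) * monom 1 (p * (a div p))"
      by (simp add: mult_monom)
    also have "[\<dots> = monom c (a mod p) * 1] (mod M)" by (intro cong_mult monom_cong_1 cong_refl)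
    finally show ?thesis by simp
  qed
  show ?thesis using red[of a] red[of b] assms by (metis cong_def)
qed

lemma sum_monom_coeff: "degree f < p \<Longrightarrow> (\<Sum>i<p. monom (coeff f i) i) = f"
  using poly_as_sum_of_monoms'[of f "p - 1"] p by (simp add: lessThan_Suc_atMost[symmetric])

lemma cong_pcompose:
  assumes "[f = g] (mod M)"
  shows "[pcompose f (monom 1 a) = pcompose g (monom 1 a)] (mod M)"
proof -
  obtain h where h: "f - g = M * h" using assms unfolding cong_iff_dvd_diff by (rule dvdE)
  have "pcompose f (monom 1 a) - pcompose g (monom 1 a) = pcompose M (monom 1 a) * pcompose h (monom 1 a)"
    by (metis h pcompose_diff pcompose_mult)
  moreover have "M dvd pcompose M (monom 1 a)"
    using monom_cong_1[of a] by (simp add: M_def pcompose_diff pcompose_monom_monom cong_iff_dvd_diff mult.commute pcompose_1)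
  ultimately show ?thesis by (simp add: cong_iff_dvd_diff)
qed

lemma cong_pcompose_exponent:
  assumes "[a = b] (mod p)"
  shows "[pcompose f (monom 1 a) = pcompose f (monom 1 b)] (mod M)"
proof -
  have e: "pcompose f (monom 1 a) = (\<Sum>i\<le>degree f. monom (coeff f i) (a * i))" for a
    by (subst (1) poly_as_sum_of_monoms[symmetric]) (simp only: pcompose_sum pcompose_monom_monom)
  show ?thesis unfolding e
    by (intro cong_sum monom_cong cong_mult assms cong_refl)
qed

text \<open>\<open>J\<close> is annihilated by X - 1, so \<open>f\<close> acts on it through its
  value at 1.\<close>

lemma mult_J: "[f * J = smult (poly f 1) J] (mod M)"
proof -
  have "poly (f - [:poly f 1:]) 1 = 0" by simp
  hence "[:-1, 1:] dvd f - [:poly f 1:]" by (simp only: poly_eq_0_iff_dvd)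
  then obtain h where h: "f - [:poly f 1:] = [:-1, 1:] * h" by blast
  have "[:-1, 1:] * J = (\<Sum>i<p. monom 1 (Suc i) - monom 1 i)"
    unfolding J_def sum_distrib_left by (intro sum.cong) (simp_all add: monom_Suc numeral_poly)
  also have "\<dots> = M" unfolding sum_lessThan_telescope by (simp add: M_def)
  finally have M: "[:-1, 1:] * J = M" .
  have "f * J - smult (poly f 1) J = (f - [:poly f 1:]) * J"
    unfolding left_diff_distrib by simp
  also have "\<dots> = [:-1, 1:] * J * h" unfolding h by (simp only: mult_ac)
  also have "\<dots> = M * h" unfolding M ..
  finally show ?thesis by (simp add: cong_iff_dvd_diff)
qed

lemma cong_smult: "[f = g] (mod M) \<Longrightarrow> [smult c f = smult c g] (mod M)"
  using cong_scalar_left[of f g M "[:c:]"] by simp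

lemma cong_coeffs:
  assumes "[f = g] (mod M)" "degree f < p" "degree g < p"
  shows "f = g"
proof -
  have "degree (f - g) < p" using assms(2,3) by (rule degree_diff_less)
  hence "f - g = 0" using assms(1) degree_M dvd_imp_degree_le[of M "f - g"]
    by (auto simp: cong_iff_dvd_diff)
  thus ?thesis by simp
qed

text \<open>Modulo \<open>M\<close>, substituting X^a permutes the coefficients and moves the one at
  exponent 1 to \<open>a mod p\<close>.\<close>

lemma coeff_invariant:
  assumes "degree g < p" "[pcompose g (monom 1 a) = g] (mod M)" "coprime a p"
  shows "coeff g (a mod p) = coeff g 1"
proof -
  have "pcompose g (monom 1 a) = (\<Sum>i<p. monom (coeff g i) (a * i))"
    by (subst (1) sum_monom_coeff[OF assms(1), symmetric]) (simp only: pcompose_sum pcompose_monom_monom)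
  also have "[\<dots> = (\<Sum>i<p. monom (coeff g i) (a * i mod p))] (mod M)"
    by (intro cong_sum monom_cong) (simp add: cong_def)
  finally have "[(\<Sum>i<p. monom (coeff g i) (a * i mod p)) = g] (mod M)"
    using assms(2) cong_sym cong_trans by blast
  moreover have "degree (\<Sum>i<p. monom (coeff g i) (a * i mod p)) < p"
  proof (rule degree_sum_less)
    fix i show "degree (monom (coeff g i) (a * i mod p)) < p"
      using degree_monom_le[of "coeff g i" "a * i mod p"] p by (meson le_less_trans mod_less_divisor prime_gt_0_nat)
  qed (use p in simp)
  ultimately have eq: "(\<Sum>i<p. monom (coeff g i) (a * i mod p)) = g"
    using assms(1) by (intro cong_coeffs)
  have "coeff g (a mod p) = coeff (\<Sum>i<p. monom (coeff g i) (a * i mod p)) (a mod p)"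
    by (simp only: eq)
  also have "\<dots> = (\<Sum>i<p. if a * i mod p = a mod p then coeff g i else 0)"
    by (simp only: coeff_sum coeff_monom)
  also have "\<dots> = (\<Sum>i<p. if i = 1 then coeff g i else 0)"
  proof (rule sum.cong[OF refl])
    fix i assume i: "i \<in> {..<p}"
    have "a * i mod p = a * 1 mod p \<longleftrightarrow> i mod p = 1 mod p"
      using assms(3) cong_mult_lcancel_nat[of a p i 1] by (simp add: cong_def)
    hence "a * i mod p = a mod p \<longleftrightarrow> i = 1" using i p by simp
    thus "(if a * i mod p = a mod p then coeff g i else 0) = (if i = 1 then coeff g i else 0)"
      by simp
  qed
  also have "\<dots> = coeff g 1" using p by simp
  finally show ?thesis .
qed

text \<open>The orbits of multiplication by 2 on the exponents are the cyclotomic cosets, so the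
  assumption leaves no idempotents besides those spanned by \<open>1\<close> and \<open>J\<close>; the power
  \<open>t ^ (2 ^ (p - 1) - 1)\<close> is idempotent.\<close>

theorem annihilator_mod_J:
  assumes orbit: "\<And>i. 0 < i \<Longrightarrow> i < p \<Longrightarrow> (\<exists>k. [i = 2 ^ k] (mod p)) \<or>
      [pcompose t (monom 1 (p - 1)) = t] (mod M) \<and> (\<exists>k. [i = (p - 1) * 2 ^ k] (mod p))"
    and Bt: "[B * t = smult \<gamma> J] (mod M)"
  shows "(\<exists>\<delta>. [B = smult \<delta> J] (mod M)) \<or> (\<exists>\<delta>. [t = smult \<delta> J] (mod M))"
proof -
  have cop2: "coprime (2 ^ k) p" for k
    using p primes_coprime[of 2 p] by simp
  have copp: "coprime (p - 1) p" using p coprime_diff_one_left_nat[of p] by simp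
  \<comment> \<open>The \<open>E\<close>-th power map substitutes X^E, and \<open>E\<close> is 1
    modulo \<open>p\<close>; so \<open>t ^ E\<close> is \<open>t\<close> modulo \<open>M\<close>,
    and \<open>t ^ (E - 1)\<close> acts as identity on multiples of \<open>t\<close>.\<close>
  define E where "E = (2::nat) ^ (p - 1)"
  have E: "E \<ge> 2" unfolding E_def using p by (cases "p - 1") auto
  obtain e where e: "E = e + 2" using E by (metis le_add_diff_inverse2)
  \<comment> \<open>The reduced representative has degree below \<open>p\<close>, so congruences
    modulo \<open>M\<close> determine its coefficients.\<close>
  define g where "g = t ^ (E - 1) mod M"
  have g: "[g = t ^ (E - 1)] (mod M)" by (simp add: g_def)
  have "degree g < p" unfolding g_def using degree_mod_less[of M "t ^ (E - 1)"] degree_M p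
    by (metis degree_0 degree_mod_less' less_trans pos2 not_gr_zero)
  note deg_g = this
  have "\<not> p dvd 2" using p by (auto dest: dvd_imp_le)
  hence "[2 ^ (p - 1) = 1] (mod p)" using p fermat_theorem by blast
  from cong_pcompose_exponent[OF this, of t] have tE: "[t ^ E = t] (mod M)"
    unfolding E_def bit_poly_power_power2 pcompose_monom_1 .
  have "[g ^ 2 = t ^ (E - 1) * t ^ (E - 1)] (mod M)"
    unfolding power2_eq_square by (intro cong_mult g)
  also have "t ^ (E - 1) * t ^ (E - 1) = t ^ E * t ^ (E - 2)"
    by (simp add: e flip: power_add)
  also have "[\<dots> = t * t ^ (E - 2)] (mod M)" by (intro cong_mult tE cong_refl)
  also have "t * t ^ (E - 2) = t ^ (E - 1)"
    by (simp add: e)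
  also have "[\<dots> = g] (mod M)" using g by (rule cong_sym)
  finally have g2: "[g ^ 2 = g] (mod M)" .
  \<comment> \<open>Squaring fixes an idempotent and substitutes X^2, so the coefficients are
    constant along doublings of the exponent.\<close>
  have g2k: "[pcompose g (monom 1 (2 ^ k)) = g] (mod M)" for k
    unfolding bit_poly_power_power2[symmetric]
  proof (induction k)
    case (Suc k)
    have "g ^ 2 ^ Suc k = (g ^ 2 ^ k) ^ 2" by (simp add: power_mult mult.commute flip: power_mult)
    also have "[\<dots> = g ^ 2] (mod M)" by (rule cong_pow[OF Suc])
    also note g2
    finally show ?case .
  qed simp
  have "coeff g i = coeff g 1" if i: "0 < i" "i < p" for i
    using orbit[OF i]
  proof (elim disjE conjE exE)
    fix k assume k: "[i = 2 ^ k] (mod p)"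
    have "coeff g (2 ^ k mod p) = coeff g 1" by (rule coeff_invariant[OF deg_g g2k cop2])
    thus ?thesis using k i by (simp add: cong_def)
  next
    fix k assume sym: "[pcompose t (monom 1 (p - 1)) = t] (mod M)" and k: "[i = (p - 1) * 2 ^ k] (mod p)"
    have pow: "pcompose (t ^ n) q = pcompose t q ^ n" for n q
      by (induction n) (simp_all add: pcompose_mult pcompose_1)
    have "[pcompose g (monom 1 (p - 1)) = pcompose (t ^ (E - 1)) (monom 1 (p - 1))] (mod M)"
      by (rule cong_pcompose[OF g])
    also have "[pcompose (t ^ (E - 1)) (monom 1 (p - 1)) = t ^ (E - 1)] (mod M)"
      unfolding pow by (rule cong_pow[OF sym])
    also have "[t ^ (E - 1) = g] (mod M)" using g by (rule cong_sym)
    finally have "[pcompose (pcompose g (monom 1 (p - 1))) (monom 1 (2 ^ k)) = pcompose g (monom 1 (2 ^ k))] (mod M)"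
      by (rule cong_pcompose)
    also note g2k
    finally have "[pcompose g (monom 1 ((p - 1) * 2 ^ k)) = g] (mod M)"
      by (simp add: pcompose_pcompose_monom)
    moreover have "coprime ((p - 1) * 2 ^ k) p" using copp cop2 by simp
    ultimately have "coeff g ((p - 1) * 2 ^ k mod p) = coeff g 1"
      by (intro coeff_invariant[OF deg_g])
    thus ?thesis using k i by (simp add: cong_def)
  qed
  define \<alpha> \<beta> where "\<alpha> = coeff g 0 - coeff g 1" and "\<beta> = coeff g 1"
  have g_eq: "g = [:\<alpha>:] + smult \<beta> J"
  proof (rule poly_eqI)
    fix i
    have cJ: "coeff J i = (if i < p then 1 else 0)" by (simp add: J_def coeff_sum)
    show "coeff g i = coeff ([:\<alpha>:] + smult \<beta> J) i"
    proof (cases "i < p")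
      case True
      thus ?thesis using \<open>\<And>i. 0 < i \<Longrightarrow> i < p \<Longrightarrow> coeff g i = coeff g 1\<close>[of i] cJ
        by (cases "i = 0") (auto simp: \<alpha>_def \<beta>_def coeff_pCons split: nat.splits simp del: minus_bit_def)
    next
      case False
      thus ?thesis using deg_g cJ p by (auto simp: coeff_eq_0 coeff_pCons split: nat.splits)
    qed
  qed
  have gJ: "[f * smult \<beta> J = smult (\<beta> * poly f 1) J] (mod M)" for f \<beta>
    unfolding mult_smult_right smult_smult[symmetric] by (rule cong_smult[OF mult_J])
  show ?thesis
  \<comment> \<open>If \<open>g\<close> is a multiple of \<open>J\<close>, so is \<open>t\<close>,
    which is congruent to \<open>t * g\<close>. Otherwise \<open>g\<close> is 1 plus a multiple of
    \<open>J\<close>, and \<open>B * g\<close>, congruent to a multiple of \<open>B * t\<close>,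
    gives the claim for \<open>B\<close>.\<close>
  proof (cases "\<alpha> = 0")
    case True
    have "t ^ E = t * t ^ (E - 1)" using E by (cases E) simp_all
    hence "[t = t * t ^ (E - 1)] (mod M)" using tE cong_sym by metis
    also have "[t * t ^ (E - 1) = t * g] (mod M)" by (intro cong_mult cong_refl cong_sym[OF g])
    also have "t * g = t * smult \<beta> J" using True by (simp add: g_eq)
    also have "[\<dots> = smult (\<beta> * poly t 1) J] (mod M)" by (rule gJ)
    finally show ?thesis by blast
  next
    case False
    hence "\<alpha> = 1" by simp
    have "B * t ^ (E - 1) = t ^ (E - 2) * (B * t)"
      by (simp add: e mult_ac)
    also have "[\<dots> = t ^ (E - 2) * smult \<gamma> J] (mod M)" by (intro cong_mult cong_refl Bt)
    also have "[t ^ (E - 2) * smult \<gamma> J = smult (\<gamma> * poly (t ^ (E - 2)) 1) J] (mod M)" by (rule gJ)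
    finally have 1: "[B * t ^ (E - 1) = smult (\<gamma> * poly (t ^ (E - 2)) 1) J] (mod M)" .
    have "[B * t ^ (E - 1) = B * g] (mod M)" by (intro cong_mult cong_refl cong_sym[OF g])
    also have "B * g = B + B * smult \<beta> J" by (simp add: g_eq \<open>\<alpha> = 1\<close> distrib_left flip: one_pCons)
    also have "[\<dots> = B + smult (\<beta> * poly B 1) J] (mod M)" by (intro cong_add cong_refl gJ)
    finally have "[B + smult (\<beta> * poly B 1) J = smult (\<gamma> * poly (t ^ (E - 2)) 1) J] (mod M)"
      using 1 cong_sym cong_trans by blast
    from cong_diff[OF this cong_refl[of "smult (\<beta> * poly B 1) J"]]
    have "[B = smult (\<gamma> * poly (t ^ (E - 2)) 1 - \<beta> * poly B 1) J] (mod M)"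
      by (simp add: smult_diff_left del: minus_bit_def)
    thus ?thesis by blast
  qed
qed

lemma reflect_reflect: "[pcompose (pcompose f (monom 1 (p - 1))) (monom 1 (p - 1)) = f] (mod M)"
proof -
  have eq: "(p - 1) * (p - 1) = 1 + p * (p - 2)"
  proof -
    obtain r where "p = r + 2" using p by (metis le_add_diff_inverse2 less_imp_le_nat)
    thus ?thesis by (simp add: algebra_simps)
  qed
  have "[(p - 1) * (p - 1) = 1] (mod p)" unfolding eq cong_def by (rule mod_mult_self2)
  from cong_pcompose_exponent[OF this, of f] show ?thesis
    unfolding pcompose_monom_1 pcompose_pcompose_monom .
qed

text \<open>Multiplication by the reflection \<open>B(1/x)\<close> is correlation of coefficient sequences.\<close>

lemma correlation_cong:
  fixes b s :: "nat \<Rightarrow> bit"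
  assumes s: "\<And>i. s (i mod p) = s i"
  shows "[pcompose (\<Sum>i<p. monom (b i) i) (monom 1 (p - 1)) * (\<Sum>i<p. monom (s i) i) =
    (\<Sum>j<p. monom (\<Sum>i<p. b i * s (i + j)) j)] (mod M)"
proof -
  have shift: "[monom c ((p - 1) * i) * (\<Sum>k<p. monom (s k) k) = (\<Sum>j<p. monom (c * s (i + j)) j)] (mod M)"
    if i: "i < p" for c i
  proof -
    have bij: "bij_betw (\<lambda>j. (i + j) mod p) {..<p} {..<p}"
    proof -
      have "inj_on (\<lambda>j. (i + j) mod p) {..<p}"
        by (rule inj_onI) (metis cong_add_lcancel_nat cong_def lessThan_iff mod_less)
      moreover have "(\<lambda>j. (i + j) mod p) ` {..<p} \<subseteq> {..<p}" using p by auto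
      ultimately show ?thesis by (simp add: bij_betw_def card_image card_subset_eq)
    qed
    have "monom c ((p - 1) * i) * (\<Sum>k<p. monom (s k) k) = (\<Sum>k<p. monom (c * s k) ((p - 1) * i + k))"
      by (simp add: sum_distrib_left mult_monom)
    also have "\<dots> = (\<Sum>j<p. monom (c * s ((i + j) mod p)) ((p - 1) * i + (i + j) mod p))"
      by (rule sum.reindex_bij_betw[OF bij, symmetric])
    also have "[\<dots> = (\<Sum>j<p. monom (c * s ((i + j) mod p)) j)] (mod M)"
    proof (intro cong_sum monom_cong)
      fix j
      have "[(p - 1) * i + (i + j) mod p = (p - 1) * i + (i + j)] (mod p)"
        by (simp add: cong_def mod_add_right_eq)
      also have "(p - 1) * i + (i + j) = p * i + j" using p by (cases p) simp_all
      also have "[p * i + j = j] (mod p)" by (simp add: cong_def)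
      finally show "[(p - 1) * i + (i + j) mod p = j] (mod p)" .
    qed
    finally show ?thesis by (simp only: s)
  qed
  have "pcompose (\<Sum>i<p. monom (b i) i) (monom 1 (p - 1)) * (\<Sum>i<p. monom (s i) i) =
    (\<Sum>i<p. monom (b i) ((p - 1) * i) * (\<Sum>k<p. monom (s k) k))"
    by (simp only: pcompose_sum pcompose_monom_monom sum_distrib_right)
  also have "[\<dots> = (\<Sum>i<p. \<Sum>j<p. monom (b i * s (i + j)) j)] (mod M)"
    by (rule cong_sum) (use shift in simp)
  also have "(\<Sum>i<p. \<Sum>j<p. monom (b i * s (i + j)) j) = (\<Sum>j<p. \<Sum>i<p. monom (b i * s (i + j)) j)"
    by (rule sum.swap)
  also have "\<dots> = (\<Sum>j<p. monom (\<Sum>i<p. b i * s (i + j)) j)"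
    by (simp only: monom_sum)
  finally show ?thesis .
qed

lemma degree_sum_monom: "degree (\<Sum>i<p. monom (f i) i) < p"
proof (rule degree_sum_less)
  fix i assume "i \<in> {..<p}"
  thus "degree (monom (f i) i) < p" using degree_monom_le[of "f i" i] by simp
qed (use p in simp)

lemma const_if_cong_J:
  assumes "[(\<Sum>i<p. monom (f i) i) = smult \<delta> J] (mod M)" "i < p"
  shows "f i = \<delta>"
proof -
  have J: "smult \<delta> J = (\<Sum>i<p. monom \<delta> i)" by (simp add: J_def smult_sum2 smult_monom)
  have "(\<Sum>i<p. monom (f i) i) = (\<Sum>i<p. monom \<delta> i)"
    using assms(1) unfolding J by (rule cong_coeffs) (rule degree_sum_monom)+
  hence "coeff (\<Sum>i<p. monom (f i) i) i = coeff (\<Sum>i<p. monom \<delta> i) i" by simp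
  thus ?thesis using assms(2) by (simp add: coeff_sum)
qed

theorem correlation_injective:
  fixes b s :: "nat \<Rightarrow> bit"
  assumes orbit: "\<And>i. 0 < i \<Longrightarrow> i < p \<Longrightarrow> \<exists>k. [i = 2 ^ k] (mod p) \<or> [i = (p - 1) * 2 ^ k] (mod p)"
    and s: "\<And>i. s (i mod p) = s i"
    and s_const: "\<And>c. p mod 4 = 3 \<or> (\<exists>i<p. s i \<noteq> c)"
    and s_corr: "\<And>c. p mod 4 = 3 \<Longrightarrow> \<exists>j<p. (\<Sum>i<p. s i * s (i + j)) \<noteq> c"
    and orbit2: "\<And>i. p mod 4 \<noteq> 3 \<Longrightarrow> 0 < i \<Longrightarrow> i < p \<Longrightarrow> \<exists>k. [i = 2 ^ k] (mod p)"
    and b: "\<And>j. (\<Sum>i<p. b i * s (i + j)) = c"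
  shows "\<exists>\<delta>. \<forall>i<p. b i = \<delta>"
proof -
  let ?R = "\<lambda>f. pcompose f (monom 1 (p - 1))"
  define S where "S = (\<Sum>i<p. monom (s i) i)"
  define B where "B = (\<Sum>i<p. monom (b i) i)"
  have "[?R B * S = (\<Sum>j<p. monom (\<Sum>i<p. b i * s (i + j)) j)] (mod M)"
    unfolding B_def S_def by (rule correlation_cong) (rule s)
  also have "(\<Sum>j<p. monom (\<Sum>i<p. b i * s (i + j)) j) = (\<Sum>j<p. monom c j)"
    by (simp only: b)
  also have "\<dots> = smult c J" by (simp add: J_def smult_sum2 smult_monom)
  finally have RB: "[?R B * S = smult c J] (mod M)" .
  have "\<exists>\<delta>. [?R B = smult \<delta> J] (mod M)"
  proof (cases "p mod 4 = 3")
    case False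
    have "\<not> (\<exists>\<delta>. [S = smult \<delta> J] (mod M))"
      using s_const False const_if_cong_J unfolding S_def by blast
    moreover have "(\<exists>\<delta>. [?R B = smult \<delta> J] (mod M)) \<or> (\<exists>\<delta>. [S = smult \<delta> J] (mod M))"
      by (rule annihilator_mod_J[OF _ RB]) (use orbit2[OF False] in blast)
    ultimately show ?thesis by blast
  next
    case True
    \<comment> \<open>The autocorrelation polynomial. Its invariance under reflection is what
      \<open>annihilator_mod_J\<close> demands for exponents of the form
      \<open>(p - 1) * 2 ^ k\<close>.\<close>
    define t where "t = ?R S * S"
    have "[t = (\<Sum>j<p. monom (\<Sum>i<p. s i * s (i + j)) j)] (mod M)"
      unfolding t_def S_def by (rule correlation_cong) (rule s)
    hence tsum: "[(\<Sum>j<p. monom (\<Sum>i<p. s i * s (i + j)) j) = t] (mod M)" by (rule cong_sym)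
    have t: "\<not> (\<exists>\<delta>. [t = smult \<delta> J] (mod M))"
    proof
      assume "\<exists>\<delta>. [t = smult \<delta> J] (mod M)"
      then obtain \<delta> where "[t = smult \<delta> J] (mod M)" by blast
      with tsum have eq: "[(\<Sum>j<p. monom (\<Sum>i<p. s i * s (i + j)) j) = smult \<delta> J] (mod M)"
        by (rule cong_trans)
      obtain j where "j < p" "(\<Sum>i<p. s i * s (i + j)) \<noteq> \<delta>" using s_corr[OF True] by blast
      thus False using const_if_cong_J[OF eq] by blast
    qed
    have "?R t = ?R (?R S) * ?R S" by (simp add: t_def pcompose_mult)
    also have "[\<dots> = S * ?R S] (mod M)" by (intro cong_mult reflect_reflect cong_refl)
    finally have sym: "[?R t = t] (mod M)" by (simp add: t_def mult.commute)
    have "?R B * t = ?R S * (?R B * S)" by (simp add: t_def mult_ac)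
    also have "[\<dots> = ?R S * smult c J] (mod M)" by (intro cong_mult cong_refl RB)
    also have "?R S * smult c J = smult c (?R S * J)" by (rule mult_smult_right)
    also have "[\<dots> = smult c (smult (poly (?R S) 1) J)] (mod M)"
      by (rule cong_smult[OF mult_J])
    also have "smult c (smult (poly (?R S) 1) J) = smult (c * poly (?R S) 1) J" by (rule smult_smult)
    finally have "[?R B * t = smult (c * poly (?R S) 1) J] (mod M)" .
    from annihilator_mod_J[OF _ this] orbit sym t show ?thesis by blast
  qed
  then obtain \<delta> where "[?R B = smult \<delta> J] (mod M)" by blast
  \<comment> \<open>Reflecting again returns to \<open>B\<close>, and \<open>J\<close> is its own
    reflection.\<close>
  hence "[?R (?R B) = ?R (smult \<delta> J)] (mod M)" by (rule cong_pcompose)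
  hence "[B = ?R (smult \<delta> J)] (mod M)" using reflect_reflect[of B] cong_sym cong_trans by blast
  also have "?R (smult \<delta> J) = (\<Sum>i<p. monom \<delta> ((p - 1) * i))"
    by (simp add: J_def pcompose_smult pcompose_sum pcompose_monom_monom smult_sum2 smult_monom)
  also have "[\<dots> = smult \<delta> J] (mod M)"
  proof -
    have "coprime (p - 1) p" using p coprime_diff_one_left_nat[of p] by simp
    hence "inj_on (\<lambda>i. (p - 1) * i mod p) {..<p}"
      by (intro inj_onI) (metis cong_def cong_mult_lcancel_nat lessThan_iff mod_less)
    moreover have "(\<lambda>i. (p - 1) * i mod p) ` {..<p} \<subseteq> {..<p}" using p by auto
    ultimately have bij: "bij_betw (\<lambda>i. (p - 1) * i mod p) {..<p} {..<p}"
      by (simp add: bij_betw_def card_image card_subset_eq)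
    have "[(\<Sum>i<p. monom \<delta> ((p - 1) * i)) = (\<Sum>i<p. monom \<delta> ((p - 1) * i mod p))] (mod M)"
      by (intro cong_sum monom_cong) (simp add: cong_def)
    also have "(\<Sum>i<p. monom \<delta> ((p - 1) * i mod p)) = (\<Sum>i<p. monom \<delta> i)"
      by (rule sum.reindex_bij_betw[OF bij])
    also have "\<dots> = smult \<delta> J" by (simp add: J_def smult_sum2 smult_monom)
    finally show ?thesis .
  qed
  finally have "[B = smult \<delta> J] (mod M)" .
  thus ?thesis using const_if_cong_J[of b \<delta>] unfolding B_def by blast
qed

end

section \<open>Subset sums modulo an inert 2\<close>

lemma complex_ring_simps:
  fixes R :: "'a :: field_char_0 ring"
  defines "R \<equiv> ring_of_type_algebra"
  shows "carrier R = UNIV" "x \<otimes>\<^bsub>R\<^esub> y = x * y" "x \<oplus>\<^bsub>R\<^esub> y = x + y" "\<one>\<^bsub>R\<^esub> = 1" "\<zero>\<^bsub>R\<^esub> = 0"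
    "\<ominus>\<^bsub>R\<^esub> x = - x" "x \<noteq> 0 \<Longrightarrow> inv\<^bsub>R\<^esub> x = inverse x"
proof -
  interpret R: field R unfolding R_def ..
  show *: "carrier R = UNIV" "x \<otimes>\<^bsub>R\<^esub> y = x * y" "x \<oplus>\<^bsub>R\<^esub> y = x + y" "\<one>\<^bsub>R\<^esub> = 1" "\<zero>\<^bsub>R\<^esub> = 0" for x y
    by (simp_all add: R_def ring_of_type_algebra_def)
  show "\<ominus>\<^bsub>R\<^esub> x = - x"
    by (rule R.minus_equality) (simp_all add: *)
  show "inv\<^bsub>R\<^esub> x = inverse x" if "x \<noteq> 0"
    by (rule R.comm_inv_char) (simp_all add: * that)
qed

lemma rat_adjoin_closed:
  shows rat_adjoin_1: "1 \<in> rat_adjoin S"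
    and rat_adjoin_incl: "x \<in> S \<Longrightarrow> x \<in> rat_adjoin S"
    and rat_adjoin_uminus: "x \<in> rat_adjoin S \<Longrightarrow> - x \<in> rat_adjoin S"
    and rat_adjoin_add: "x \<in> rat_adjoin S \<Longrightarrow> y \<in> rat_adjoin S \<Longrightarrow> x + y \<in> rat_adjoin S"
    and rat_adjoin_mult: "x \<in> rat_adjoin S \<Longrightarrow> y \<in> rat_adjoin S \<Longrightarrow> x * y \<in> rat_adjoin S"
    and rat_adjoin_inverse: "x \<in> rat_adjoin S \<Longrightarrow> x \<noteq> 0 \<Longrightarrow> inverse x \<in> rat_adjoin S"
  using generate_field.one[of "ring_of_type_algebra :: complex ring" S]
    generate_field.incl[of x S "ring_of_type_algebra :: complex ring"]
    generate_field.a_inv[of x "ring_of_type_algebra :: complex ring" S]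
    generate_field.eng_add[of x "ring_of_type_algebra :: complex ring" S y]
    generate_field.eng_mult[of x "ring_of_type_algebra :: complex ring" S y]
    generate_field.m_inv[of x "ring_of_type_algebra :: complex ring" S]
  by (simp_all add: rat_adjoin_def complex_ring_simps)

lemma rat_adjoin_diff: "x \<in> rat_adjoin S \<Longrightarrow> y \<in> rat_adjoin S \<Longrightarrow> x - y \<in> rat_adjoin S"
  using rat_adjoin_add[of x S "- y"] rat_adjoin_uminus[of y S] by simp

lemma rat_adjoin_power: "x \<in> rat_adjoin S \<Longrightarrow> x ^ k \<in> rat_adjoin S"
  by (induction k) (auto intro: rat_adjoin_1 rat_adjoin_mult)

lemma rat_adjoin_induct [consumes 1, case_names one incl uminus inverse add mult]:
  assumes "x \<in> rat_adjoin S"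
    and "P 1" "\<And>x. x \<in> S \<Longrightarrow> P x" "\<And>x. P x \<Longrightarrow> P (- x)" "\<And>x. P x \<Longrightarrow> x \<noteq> 0 \<Longrightarrow> P (inverse x)"
    and "\<And>x y. P x \<Longrightarrow> P y \<Longrightarrow> P (x + y)" "\<And>x y. P x \<Longrightarrow> P y \<Longrightarrow> P (x * y)"
  shows "P x"
  using assms(1) unfolding rat_adjoin_def
  by (induction rule: generate_field.induct) (auto simp: complex_ring_simps intro: assms(2-))

text \<open>Works in the quotient of \<open>R\<close> by \<open>I\<close> without forming it:
  equality of classes is membership of a difference in \<open>I\<close>.\<close>

locale subring_prime_ideal =
  fixes R I :: "'a :: idom set"
  assumes one: "1 \<in> R" and diff: "x \<in> R \<Longrightarrow> y \<in> R \<Longrightarrow> x - y \<in> R" and mult: "x \<in> R \<Longrightarrow> y \<in> R \<Longrightarrow> x * y \<in> R"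
    and ideal_diff: "x \<in> I \<Longrightarrow> y \<in> I \<Longrightarrow> x - y \<in> I" and ideal_mult: "x \<in> R \<Longrightarrow> y \<in> I \<Longrightarrow> x * y \<in> I"
    and two: "2 \<in> I"
    and prime: "x \<in> R \<Longrightarrow> y \<in> R \<Longrightarrow> x * y \<in> I \<Longrightarrow> x \<in> I \<or> y \<in> I"
    and proper: "1 \<notin> I"
begin

lemma zero: "0 \<in> R" using diff[OF one one] by simp

lemma uminus: "x \<in> R \<Longrightarrow> - x \<in> R" using diff[OF zero] by simp

lemma add: "x \<in> R \<Longrightarrow> y \<in> R \<Longrightarrow> x + y \<in> R" using diff[of x "- y"] uminus by simp

lemma sum: "(\<And>i. i \<in> A \<Longrightarrow> f i \<in> R) \<Longrightarrow> (\<Sum>i\<in>A. f i) \<in> R"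
  by (induction A rule: infinite_finite_induct) (auto intro: zero add)

lemma power: "x \<in> R \<Longrightarrow> x ^ k \<in> R" by (induction k) (auto intro: one mult)

lemma ideal_zero: "0 \<in> I" using ideal_diff[OF two two] by simp

lemma ideal_add:
  assumes "x \<in> I" "y \<in> I"
  shows "x + y \<in> I"
proof -
  have "0 - y \<in> I" by (rule ideal_diff[OF ideal_zero assms(2)])
  from ideal_diff[OF assms(1) this] show ?thesis by simp
qed

lemma ideal_sum: "(\<And>i. i \<in> A \<Longrightarrow> f i \<in> I) \<Longrightarrow> (\<Sum>i\<in>A. f i) \<in> I"
  by (induction A rule: infinite_finite_induct) (auto intro: ideal_zero ideal_add)

lemma ideal_trans:
  assumes "x - y \<in> I" "y - z \<in> I"
  shows "x - z \<in> I"
  using ideal_add[OF assms] by simp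

lemma poly_closed:
  assumes "\<And>i. coeff f i \<in> R" "x \<in> R"
  shows "poly f x \<in> R"
  unfolding poly_altdef using assms by (intro sum mult power)

lemma synthetic_div_closed:
  assumes "\<And>i. coeff f i \<in> R" "x \<in> R"
  shows "coeff (synthetic_div f x) i \<in> R"
  using assms(1)
proof (induction f arbitrary: i)
  case 0
  then show ?case using zero by simp
next
  case (pCons a f)
  have f: "coeff f i \<in> R" for i using pCons.prems[of "Suc i"] by simp
  show ?case using pCons.IH[OF f] poly_closed[OF f assms(2)] by (cases i) auto
qed

text \<open>The root bound over a domain, carried out modulo \<open>I\<close>: a root
  \<open>s\<close> is split off by synthetic division, whose remainder \<open>poly f s\<close> lies
  in \<open>I\<close>.\<close>

lemma card_roots_le_degree:
  assumes "lead_coeff f = 1" "\<And>i. coeff f i \<in> R"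
    and "finite S" "S \<subseteq> R" "\<And>x. x \<in> S \<Longrightarrow> poly f x \<in> I"
    and "\<And>x y. x \<in> S \<Longrightarrow> y \<in> S \<Longrightarrow> x - y \<in> I \<Longrightarrow> x = y"
  shows "card S \<le> degree f"
  using assms
proof (induction "degree f" arbitrary: f S)
  case 0
  then obtain c where c: "f = [:c:]" by (metis degree_eq_zeroE)
  with 0 proper have "S = {}" by auto
  thus ?case by simp
next
  case (Suc d)
  show ?case
  proof (cases "S = {}")
    case False
    then obtain s where s: "s \<in> S" by blast
    define g where "g = synthetic_div f s"
    have deg: "degree g = d" using Suc.hyps(2) by (simp add: g_def degree_synthetic_div)
    have fg: "f = [:- s, 1:] * g + [:poly f s:]"
      using synthetic_div_correct'[of s f] by (simp add: g_def)
    have "g \<noteq> 0" using Suc.hyps(2) by (simp add: g_def synthetic_div_eq_0_iff)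
    have "coeff f (Suc d) = coeff g d + - s * coeff g (Suc d)"
      by (subst fg) simp
    hence lead: "lead_coeff g = 1" using deg Suc.hyps(2) Suc.prems(1) by (simp add: coeff_eq_0)
    have "card (S - {s}) \<le> degree g"
    proof (rule Suc.hyps(1))
      show "d = degree g" "lead_coeff g = 1" using deg lead by simp_all
      show "coeff g i \<in> R" for i
        unfolding g_def using Suc.prems s by (intro synthetic_div_closed) auto
      show "finite (S - {s})" "S - {s} \<subseteq> R" using Suc.prems by auto
      show "x = y" if "x \<in> S - {s}" "y \<in> S - {s}" "x - y \<in> I" for x y
        using that Suc.prems(6) by blast
      show "poly g x \<in> I" if x: "x \<in> S - {s}" for x
      proof -
        have "poly f x = (x - s) * poly g x + poly f s" by (subst fg) (simp add: algebra_simps)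
        hence "(x - s) * poly g x \<in> I"
          using ideal_diff[OF Suc.prems(5)[of x] Suc.prems(5)[OF s]] x by simp
        moreover have "x - s \<in> R" "poly g x \<in> R"
          using x s Suc.prems(2,4) unfolding g_def by (auto intro!: diff poly_closed synthetic_div_closed)
        moreover have "x - s \<notin> I" using Suc.prems(6)[of x s] x s by blast
        ultimately show ?thesis using prime by blast
      qed
    qed
    thus ?thesis using s Suc.prems(3) Suc.hyps(2) deg by simp
  qed simp
qed

lemma square_cong:
  assumes "x \<in> R" "y \<in> R" "x - y \<in> I"
  shows "x ^ 2 - y ^ 2 \<in> I"
proof -
  have "(x + y) * (x - y) \<in> I" using assms by (intro ideal_mult add)
  thus ?thesis by (simp add: power2_eq_square algebra_simps)
qed

lemma square_sum_cong:
  assumes "finite A" "\<And>i. i \<in> A \<Longrightarrow> f i \<in> R"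
  shows "(\<Sum>i\<in>A. f i) ^ 2 - (\<Sum>i\<in>A. f i ^ 2) \<in> I"
  using assms
proof (induction A)
  case empty
  then show ?case using ideal_zero by simp
next
  case (insert a A)
  have "f a * (\<Sum>i\<in>A. f i) \<in> R" using insert by (intro mult sum) auto
  hence "f a * (\<Sum>i\<in>A. f i) * 2 \<in> I" using two by (rule ideal_mult)
  from ideal_add[OF this insert.IH] insert
  have "f a * (\<Sum>i\<in>A. f i) * 2 + ((\<Sum>i\<in>A. f i) ^ 2 - (\<Sum>i\<in>A. f i ^ 2)) \<in> I" by blast
  also have "f a * (\<Sum>i\<in>A. f i) * 2 + ((\<Sum>i\<in>A. f i) ^ 2 - (\<Sum>i\<in>A. f i ^ 2)) =
      (\<Sum>i\<in>insert a A. f i) ^ 2 - (\<Sum>i\<in>insert a A. f i ^ 2)"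
    using insert.hyps by (simp add: power2_eq_square algebra_simps)
  finally show ?case .
qed

end

section \<open>Integrality of conjugates and the sums of a root of unity with its inverse\<close>

context prime_root_of_unity
begin

text \<open>An integral equation for \<open>rat_eval f z\<close>, composed with \<open>f\<close>,
  vanishes at \<open>z\<close> and hence at its conjugates.\<close>

lemma algebraic_int_conjugate:
  assumes "algebraic_int (rat_eval f z)" "\<not> n dvd a"
  shows "algebraic_int (rat_eval f (z ^ a))"
proof -
  obtain g where g: "poly (map_poly of_int g) (rat_eval f z) = 0" "lead_coeff g = 1"
    using assms(1) algebraic_int_altdef_ipoly by blast
  have eval: "rat_eval (map_poly of_int g) x = poly (map_poly of_int g) x" for x
    unfolding rat_eval_def by (subst map_poly_map_poly) (simp_all add: o_def)
  have "rat_eval (pcompose (map_poly of_int g) f) (z ^ a) = 0"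
    by (rule rat_eval_conjugate_zero) (simp_all add: eval g assms)
  hence "poly (map_poly of_int g) (rat_eval f (z ^ a)) = 0" by (simp add: eval)
  thus ?thesis using g(2) algebraic_int_altdef_ipoly by blast
qed

definition w :: "nat \<Rightarrow> complex" where "w k = z ^ k + inverse z ^ k"

lemma algebraic_int_w: "algebraic_int (w k)"
proof -
  have "inverse z ^ n = 1" by (simp add: power_inverse z)
  from algebraic_int_root_of_unity[OF this] have "algebraic_int (inverse z)" by simp
  thus ?thesis unfolding w_def by (intro algebraic_int_add algebraic_int_power algebraic_int_z)
qed

lemma w_double: "w (2 * k) = w k ^ 2 - 2"
proof -
  have "z ^ k * inverse z ^ k = 1" by (simp flip: power_mult_distrib)
  thus ?thesis unfolding w_def by (simp add: power2_sum power_even_eq)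
qed

lemma inverse_power: "k \<le> n \<Longrightarrow> inverse z ^ k = z ^ (n - k)"
  using z(1) by (simp add: power_diff power_one_over inverse_eq_divide)

text \<open>A finite Fourier transform isolates \<open>d j\<close>: the values of \<open>h\<close>
  at all \<open>z ^ a\<close>, weighted by \<open>z ^ (a * j)\<close>, add up to
  \<open>d j * n\<close>. The terms with \<open>a > 0\<close> are twice algebraic integers and the
  term at \<open>a = 0\<close> is an even integer, so \<open>d j * n\<close> is even.\<close>

lemma even_if_sum_w:
  assumes c: "algebraic_int c" "(\<Sum>k\<in>{1..(n - 1) div 2}. of_int (d k) * w k) = 2 * c"
    and j: "j \<in> {1..(n - 1) div 2}"
  shows "even (d j)"
proof -
  let ?r = "(n - 1) div 2"
  \<comment> \<open>The exponent \<open>n - k\<close> replaces \<open>- k\<close>, so that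
    \<open>h\<close> is a polynomial and can also be evaluated at 1.\<close>
  define h where "h = (\<Sum>k\<in>{1..?r}. monom (of_int (d k)) k + monom (of_int (d k)) (n - k) :: rat poly)"
  have eval_sum: "rat_eval (\<Sum>k\<in>A. f k) x = (\<Sum>k\<in>A. rat_eval (f k) x)" for A x and f :: "nat \<Rightarrow> rat poly"
    by (induction A rule: infinite_finite_induct) simp_all
  have h: "rat_eval h x = (\<Sum>k\<in>{1..?r}. of_int (d k) * (x ^ k + x ^ (n - k)))" for x
    by (simp add: h_def eval_sum distrib_left)
  have "rat_eval h z = (\<Sum>k\<in>{1..?r}. of_int (d k) * w k)"
    unfolding h w_def by (intro sum.cong refl) (auto simp: inverse_power)
  hence hz: "rat_eval (smult (1 / 2) h) z = c" using c(2) by (simp add: of_rat_divide)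
  have cj: "algebraic_int (rat_eval h (z ^ a) / 2)" if "a \<in> {1..<n}" for a
  proof -
    have "\<not> n dvd a" using that by (auto dest: dvd_imp_le)
    thus ?thesis using algebraic_int_conjugate[of "smult (1 / 2) h" a] c(1) hz by (simp add: of_rat_divide)
  qed
  define T where "T = (\<Sum>a\<in>{1..<n}. rat_eval h (z ^ a) / 2 * z ^ (a * j))"
  have T: "algebraic_int T"
    unfolding T_def using cj by (intro algebraic_int_sum algebraic_int_mult algebraic_int_power) auto
  have "(\<Sum>a<n. rat_eval h (z ^ a) * z ^ (a * j)) =
    (\<Sum>a<n. \<Sum>k\<in>{1..?r}. of_int (d k) * (z ^ ((k + j) * a) + z ^ ((n - k + j) * a)))"
    by (simp add: h sum_distrib_left sum_distrib_right mult_ac distrib_left distrib_right power_add flip: power_mult)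
  also have "\<dots> = (\<Sum>k\<in>{1..?r}. \<Sum>a<n. of_int (d k) * (z ^ ((k + j) * a) + z ^ ((n - k + j) * a)))"
    by (rule sum.swap)
  also have "\<dots> = (\<Sum>k\<in>{1..?r}. of_int (d k) * ((\<Sum>a<n. z ^ ((k + j) * a)) + (\<Sum>a<n. z ^ ((n - k + j) * a))))"
    by (simp add: sum_distrib_left distrib_left sum.distrib)
  also have "\<dots> = (\<Sum>k\<in>{1..?r}. if k = j then of_int (d k) * of_nat n else 0)"
  proof (rule sum.cong[OF refl])
    fix k assume k: "k \<in> {1..?r}"
    have "\<not> n dvd k + j" using k j n_gt_2 by (auto dest!: dvd_imp_le)
    moreover have "n dvd n - k + j \<longleftrightarrow> k = j"
    proof
      assume "n dvd n - k + j"
      moreover have "0 < n - k + j" "n - k + j < 2 * n" using k j n_gt_2 by auto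
      ultimately have "n - k + j = n" by (auto elim!: dvdE simp: less_2_cases_iff)
      thus "k = j" using k n_gt_2 by auto
    qed (use k in auto)
    ultimately show "of_int (d k) * ((\<Sum>a<n. z ^ ((k + j) * a)) + (\<Sum>a<n. z ^ ((n - k + j) * a))) =
        (if k = j then of_int (d k) * of_nat n else 0)"
      by (simp only: sum_powers) simp
  qed
  also have "\<dots> = of_int (d j) * of_nat n" using j by simp
  finally have "(\<Sum>a<n. rat_eval h (z ^ a) * z ^ (a * j)) = of_int (d j) * of_nat n" .
  moreover have "{..<n} = insert 0 {1..<n}" by auto
  ultimately have "rat_eval h 1 + 2 * T = of_int (d j) * of_nat n"
    by (simp add: T_def sum_distrib_left)
  moreover have "rat_eval h 1 = of_int (2 * (\<Sum>k\<in>{1..?r}. d k))" by (simp add: h sum_distrib_left mult.commute)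
  ultimately have "of_int (d j * int n - 2 * (\<Sum>k\<in>{1..?r}. d k)) = of_int 2 * T"
    by (simp add: algebra_simps)
  from int_dvd_if_algebraic_int[OF T this] have "even (d j * int n - 2 * (\<Sum>k\<in>{1..?r}. d k))" by simp
  thus ?thesis using n(2) by simp
qed

text \<open>The subset sums of the \<open>w k\<close> are incongruent modulo 2, and all of them are roots of
  \<open>X ^ (2 ^ f) - X\<close>.\<close>

lemma power2_period_ge:
  assumes "subring_prime_ideal R I" and I: "I = {2 * x | x. x \<in> R}"
    and R: "\<And>x. x \<in> R \<Longrightarrow> algebraic_int x" "\<And>k. w k \<in> R"
    and f: "f > 0" "[(2::int) ^ f = 1] (mod int n) \<or> [(2::int) ^ f = - 1] (mod int n)"
  shows "(n - 1) div 2 \<le> f"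
proof -
  interpret subring_prime_ideal R I by fact
  let ?r = "(n - 1) div 2"
  have z2: "z ^ (2 ^ f) = z \<or> z ^ (2 ^ f) = inverse z"
    using f(2)
  proof
    assume "[(2::int) ^ f = 1] (mod int n)"
    hence "[2 ^ f = 1] (mod n)" using cong_int_iff[of "2 ^ f" 1 n] by simp
    hence "2 ^ f mod n = 1" using n_gt_2 by (simp add: cong_def)
    thus ?thesis using power_mod[of "2 ^ f"] by simp
  next
    assume "[(2::int) ^ f = - 1] (mod int n)"
    hence "int n dvd int (2 ^ f + 1)" by (simp add: cong_iff_dvd_diff add.commute)
    hence "n dvd 2 ^ f + 1" by (simp only: int_dvd_int_iff)
    hence "z * z ^ (2 ^ f) = 1" using power_eq_1_iff[of "2 ^ f + 1"] by simp
    thus ?thesis by (metis inverse_unique)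
  qed
  have w_period: "w (2 ^ f * k) = w k" for k
    using z2 unfolding w_def power_mult by (elim disjE) (simp_all add: power_inverse)
  \<comment> \<open>Frobenius modulo 2: by \<open>w_double\<close>, each squaring doubles the
    indices.\<close>
  have frob: "(\<Sum>k\<in>A. w k) ^ (2 ^ g) - (\<Sum>k\<in>A. w (2 ^ g * k)) \<in> I" if "finite A" for A g
  proof (induction g)
    case 0
    then show ?case using ideal_zero by simp
  next
    case (Suc g)
    have "((\<Sum>k\<in>A. w k) ^ (2 ^ g)) ^ 2 - (\<Sum>k\<in>A. w (2 ^ g * k)) ^ 2 \<in> I"
      by (intro square_cong Suc.IH power sum R)
    moreover have "(\<Sum>k\<in>A. w (2 ^ g * k)) ^ 2 - (\<Sum>k\<in>A. w (2 ^ g * k) ^ 2) \<in> I"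
      by (intro square_sum_cong that R)
    moreover have "(\<Sum>k\<in>A. w (2 ^ g * k) ^ 2) - (\<Sum>k\<in>A. w (2 ^ Suc g * k)) \<in> I"
      unfolding sum_subtractf[symmetric] using w_double two
      by (intro ideal_sum) (simp add: mult.assoc)
    ultimately have "((\<Sum>k\<in>A. w k) ^ (2 ^ g)) ^ 2 - (\<Sum>k\<in>A. w (2 ^ Suc g * k)) \<in> I"
      using ideal_trans by blast
    thus ?case by (simp add: mult.commute flip: power_mult)
  qed
  define F :: "complex poly" where "F = monom 1 (2 ^ f) - monom 1 1"
  have "(1::nat) < 2 ^ f" using f(1) by (intro one_less_power) simp_all
  hence degF: "degree F = 2 ^ f"
    using degree_add_eq_left[of "- monom 1 1" "monom 1 (2 ^ f) :: complex poly"]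
    by (simp add: F_def degree_monom_eq)
  with \<open>1 < 2 ^ f\<close> have leadF: "lead_coeff F = 1" by (simp add: F_def)
  have dist: "A = B" if AB: "A \<subseteq> {1..?r}" "B \<subseteq> {1..?r}" "(\<Sum>k\<in>A. w k) - (\<Sum>k\<in>B. w k) \<in> I" for A B
  proof -
    define d :: "nat \<Rightarrow> int" where "d = (\<lambda>k. of_bool (k \<in> A) - of_bool (k \<in> B))"
    obtain c where c: "c \<in> R" "(\<Sum>k\<in>A. w k) - (\<Sum>k\<in>B. w k) = 2 * c" using AB(3) I by blast
    have ind: "(\<Sum>k\<in>C. w k) = (\<Sum>k\<in>{1..?r}. of_bool (k \<in> C) * w k)" if "C \<subseteq> {1..?r}" for C
      using that by (intro sum.mono_neutral_cong_left) auto
    have "(\<Sum>k\<in>{1..?r}. of_int (d k) * w k) = 2 * c"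
      unfolding c(2)[symmetric] ind[OF AB(1)] ind[OF AB(2)] d_def sum_subtractf[symmetric]
      by (simp add: left_diff_distrib)
    from even_if_sum_w[OF R(1)[OF c(1)] this] have ev: "even (d k)" if "k \<in> {1..?r}" for k
      using that by blast
    have "k \<in> A \<longleftrightarrow> k \<in> B" for k
      using ev[of k] AB(1,2) by (cases "k \<in> {1..?r}") (auto simp: d_def split: if_splits)
    thus ?thesis by blast
  qed
  let ?S = "(\<lambda>A. \<Sum>k\<in>A. w k) ` Pow {1..?r}"
  have S: "\<exists>A. A \<subseteq> {1..?r} \<and> x = (\<Sum>k\<in>A. w k)" if "x \<in> ?S" for x
    using that by (elim imageE) (auto simp only: Pow_iff)
  have "card ?S \<le> degree F"
  proof (rule card_roots_le_degree[OF leadF])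
    show "coeff F i \<in> R" for i
      unfolding F_def using one zero diff by (auto simp: coeff_diff)
    show "finite ?S" by simp
    show "?S \<subseteq> R" using R(2) by (auto intro!: sum)
    show "poly F x \<in> I" if x: "x \<in> ?S" for x
    proof -
      obtain A where A: "A \<subseteq> {1..?r}" "x = (\<Sum>k\<in>A. w k)" using S[OF x] by blast
      from frob[OF finite_subset[OF A(1)], of f] show ?thesis
        by (simp add: w_period A(2) F_def poly_monom)
    qed
    show "x = y" if xy: "x \<in> ?S" "y \<in> ?S" "x - y \<in> I" for x y
    proof -
      obtain A B where "A \<subseteq> {1..?r}" "x = (\<Sum>k\<in>A. w k)" "B \<subseteq> {1..?r}" "y = (\<Sum>k\<in>B. w k)"
        using S[OF xy(1)] S[OF xy(2)] by blast
      with dist[of A B] xy(3) show ?thesis by simp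
    qed
  qed
  moreover have "inj_on (\<lambda>A. \<Sum>k\<in>A. w k) (Pow {1..?r})"
    using dist ideal_zero by (intro inj_onI) auto
  ultimately have "2 ^ ?r \<le> (2::nat) ^ f" by (simp add: card_image card_Pow degF)
  thus ?thesis by (simp add: power_increasing_iff)
qed

lemma inert_power2_period_ge:
  assumes inert: "inert_in 2 (maximal_real_subfield (rat_adjoin {z}))"
    and f: "f > 0" "[(2::int) ^ f = 1] (mod int n) \<or> [(2::int) ^ f = - 1] (mod int n)"
  shows "(n - 1) div 2 \<le> f"
proof -
  define R where "R = {x \<in> maximal_real_subfield (rat_adjoin {z}). algebraic_int x}"
  define I where "I = {2 * x | x. x \<in> R}"
  have R_iff: "x \<in> R \<longleftrightarrow> x \<in> rat_adjoin {z} \<and> x \<in> \<real> \<and> algebraic_int x" for x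
    by (auto simp: R_def maximal_real_subfield_def)
  have ring: "ring_of_integers (maximal_real_subfield (rat_adjoin {z})) = ring_of_type_algebra\<lparr>carrier := R\<rparr>"
    by (simp add: ring_of_integers_def R_def)
  have PIdl: "PIdl\<^bsub>ring_of_type_algebra\<lparr>carrier := R\<rparr>\<^esub> (of_nat 2) = I"
    by (auto simp: cgenideal_def I_def complex_ring_simps mult.commute)
  have prime: "primeideal I (ring_of_type_algebra\<lparr>carrier := R\<rparr>)"
    using inert by (simp only: inert_in_def ring PIdl)
  have R_diff: "x - y \<in> R" if "x \<in> R" "y \<in> R" for x y
    using that unfolding R_iff by (auto intro!: rat_adjoin_diff algebraic_int_diff)
  have R_mult: "x * y \<in> R" if "x \<in> R" "y \<in> R" for x y
    using that unfolding R_iff by (auto intro!: rat_adjoin_mult algebraic_int_mult)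
  have R_1: "1 \<in> R" by (simp add: R_iff rat_adjoin_1)
  have R_w: "w k \<in> R" for k
  proof -
    have "cmod z ^ n = 1" using z(1) by (metis norm_one norm_power)
    hence "cmod z = 1" using power_eq_imp_eq_base[of "cmod z" n 1] by simp
    hence "inverse z = cnj z" by (metis complex_norm_square inverse_unique mult.commute of_real_1 one_power2)
    hence "w k \<in> \<real>" by (simp add: w_def complex_is_Real_iff flip: complex_cnj_power)
    moreover have "w k \<in> rat_adjoin {z}"
      unfolding w_def by (intro rat_adjoin_add rat_adjoin_power rat_adjoin_inverse rat_adjoin_incl) simp_all
    ultimately show ?thesis using algebraic_int_w by (simp add: R_iff)
  qed
  have proper: "1 \<notin> I"
  proof
    assume "1 \<in> I"
    hence "x \<in> I" if "x \<in> R" for x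
      using that R_mult unfolding I_def by (smt (verit) mem_Collect_eq mult.left_commute mult.right_neutral)
    hence "I = R" using R_diff[of _ _] ideal.Icarr[OF primeideal.axioms(1)[OF prime]] by auto
    thus False using primeideal.I_notcarr[OF prime] by simp
  qed
  have "subring_prime_ideal R I"
  proof
    fix x y assume xy: "x \<in> R" "y \<in> R" "x * y \<in> I"
    thus "x \<in> I \<or> y \<in> I" using primeideal.I_prime[OF prime, of x y] by (simp add: complex_ring_simps)
  next
    fix x y assume "x \<in> I" "y \<in> I"
    then obtain a b where ab: "a \<in> R" "b \<in> R" "x = 2 * a" "y = 2 * b" unfolding I_def by blast
    hence "x - y = 2 * (a - b)" by simp
    thus "x - y \<in> I" using R_diff[OF ab(1,2)] unfolding I_def by blast
  next
    fix x y assume "x \<in> R" "y \<in> I"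
    then obtain b where b: "b \<in> R" "y = 2 * b" unfolding I_def by blast
    hence "x * y = 2 * (x * b)" by simp
    thus "x * y \<in> I" using R_mult[OF \<open>x \<in> R\<close> b(1)] unfolding I_def by blast
  next
    show "2 \<in> I" using R_1 unfolding I_def by force
  qed (use R_1 R_diff R_mult proper in auto)
  from power2_period_ge[OF this I_def _ R_w f] show ?thesis using R_iff by blast
qed

text \<open>The period bound is exactly the order condition of
  \<open>bij_betw_signed_powers_of_2\<close>.\<close>

lemma inert_orbit:
  assumes inert: "inert_in 2 (maximal_real_subfield (rat_adjoin {z}))" and i: "0 < i" "i < n"
  obtains k where "[int i = 2 ^ k] (mod int n) \<or> [int i = - (2 ^ k)] (mod int n)"
proof -
  let ?r = "(n - 1) div 2"
  have nr: "n = 2 * ?r + 1" using n(2) by (elim oddE) simp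
  have bij: "bij_betw (\<lambda>(i, s). s * 2 ^ i * 1 mod int n) ({..<?r} \<times> {1, -1}) {1..<int n}"
  proof (rule bij_betw_signed_powers_of_2[OF n(1) nr])
    fix j assume "0 < j" "j < ?r"
    thus "\<not> ([(2::int) ^ j = 1] (mod int n) \<or> [(2::int) ^ j = - 1] (mod int n))"
      using inert_power2_period_ge[OF inert, of j] by linarith
  qed (use n_gt_2 in auto)
  have "int i \<in> {1..<int n}" using i by simp
  then obtain x where x: "x \<in> {..<?r} \<times> {1, -1 :: int}" "int i = (\<lambda>(i, s). s * 2 ^ i * 1 mod int n) x"
    using bij_betw_imp_surj_on[OF bij] by (metis (no_types, lifting) imageE)
  obtain k s where "x = (k, s)" by (cases x)
  with x have s: "s = 1 \<or> s = - 1" and eq: "int i = s * 2 ^ k mod int n" by simp_all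
  from eq have "[int i = s * 2 ^ k] (mod int n)" by (simp add: cong_def)
  thus ?thesis using that[of k] s by auto
qed

text \<open>Here \<open>(n - 1) / 2\<close> is even. If 2 to this power were 1, then 2 to half of it
  would be 1 or -1, against the period bound. So that power is -1 and absorbs the sign from
  \<open>inert_orbit\<close>.\<close>

lemma inert_orbit_unsigned:
  assumes inert: "inert_in 2 (maximal_real_subfield (rat_adjoin {z}))" and i: "0 < i" "i < n"
    and n4: "n mod 4 \<noteq> 3"
  obtains k where "[int i = 2 ^ k] (mod int n)"
proof -
  let ?r = "(n - 1) div 2" and ?n = "int n"
  have nr: "n = 2 * ?r + 1" using n(2) by (elim oddE) simp
  have "even ?r" using n(2) n4 by presburger
  then obtain e where e: "?r = 2 * e" by blast
  have e0: "e > 0" "e < ?r" using e nr n_gt_2 by simp_all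
  have pr: "Factorial_Ring.prime ?n" using n(1) by simp
  have root: "[x = 1] (mod ?n) \<or> [x = - 1] (mod ?n)" if "[x * x = 1] (mod ?n)" for x
  proof -
    have "?n dvd (x - 1) * (x - (- 1))" using that by (simp add: cong_iff_dvd_diff algebra_simps)
    thus ?thesis using pr by (simp only: cong_iff_dvd_diff prime_dvd_mult_iff)
  qed
  have "\<not> n dvd 2" using n_gt_2 by (auto dest: dvd_imp_le)
  hence "[2 ^ (n - 1) = 1] (mod n)" using n(1) fermat_theorem by blast
  moreover have "n - 1 = ?r + ?r" using nr by simp
  ultimately have "[2 ^ (?r + ?r) = 1] (mod n)" by simp
  hence "[int (2 ^ (?r + ?r)) = int 1] (mod ?n)" using cong_int_iff by blast
  hence "[(2::int) ^ ?r = 1] (mod ?n) \<or> [(2::int) ^ ?r = - 1] (mod ?n)"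
    using root[of "2 ^ ?r"] by (simp add: power_add)
  moreover have "\<not> [(2::int) ^ ?r = 1] (mod ?n)"
  proof
    assume "[(2::int) ^ ?r = 1] (mod ?n)"
    hence "[(2::int) ^ e * 2 ^ e = 1] (mod ?n)" by (simp only: e mult_2 power_add)
    from root[OF this] inert_power2_period_ge[OF inert e0(1)] e0(2) show False by linarith
  qed
  ultimately have m1: "[(2::int) ^ ?r = - 1] (mod ?n)" by blast
  obtain k where "[int i = 2 ^ k] (mod ?n) \<or> [int i = - (2 ^ k)] (mod ?n)"
    using inert_orbit[OF inert i] by blast
  thus ?thesis
  proof
    assume a: "[int i = - (2 ^ k)] (mod ?n)"
    have "[(2::int) ^ ?r * 2 ^ k = - 1 * 2 ^ k] (mod ?n)" using m1 by (rule cong_scalar_right)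
    hence "[(2::int) ^ (?r + k) = - (2 ^ k)] (mod ?n)" by (simp add: power_add)
    thus ?thesis using that a cong_sym cong_trans by blast
  qed (rule that)
qed

end

lemma rat_eval_cnj: "rat_eval f (cnj x) = cnj (rat_eval f x)"
proof -
  have "cnj (of_rat c) = of_rat c" for c by (cases c) (simp add: of_rat_rat)
  thus ?thesis by (simp add: rat_eval_altdef)
qed

section \<open>The cyclotomic field with its conjugations, trace and norm\<close>

context prime_root_of_unity
begin

definition K :: "complex set" where "K = range (\<lambda>f. rat_eval f z)"

text \<open>The automorphism of \<open>K\<close> that sends \<open>z\<close> to
  \<open>z ^ a\<close>. Unless \<open>n\<close> divides \<open>a\<close>, the result is independent
  of the chosen \<open>f\<close> by \<open>rat_eval_conjugate_zero\<close>.\<close>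

definition cj :: "nat \<Rightarrow> complex \<Rightarrow> complex" where
  "cj a x = rat_eval (SOME f. rat_eval f z = x) (z ^ a)"

lemma cj_rat_eval:
  assumes "\<not> n dvd a"
  shows "cj a (rat_eval f z) = rat_eval f (z ^ a)"
proof -
  define g where "g = (SOME g. rat_eval g z = rat_eval f z)"
  have "rat_eval g z = rat_eval f z" unfolding g_def by (rule someI[of _ f]) simp
  hence "rat_eval (g - f) z = 0" by simp
  from rat_eval_conjugate_zero[OF this assms] show ?thesis by (simp add: cj_def g_def)
qed

lemma K_cases:
  assumes "x \<in> K"
  obtains f where "x = rat_eval f z" "\<And>a. \<not> n dvd a \<Longrightarrow> cj a x = rat_eval f (z ^ a)"
  using assms cj_rat_eval unfolding K_def by blast

lemma K_rat_eval: "rat_eval f z \<in> K" by (simp add: K_def)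

lemma K_of_rat: "of_rat c \<in> K" using K_rat_eval[of "[:c:]"] by simp

lemma K_1: "1 \<in> K" using K_of_rat[of 1] by simp

lemma K_power_z: "z ^ k \<in> K" using K_rat_eval[of "monom 1 k"] by simp

lemma K_add: "x \<in> K \<Longrightarrow> y \<in> K \<Longrightarrow> x + y \<in> K"
  by (metis K_cases K_rat_eval rat_eval_simps(3))

lemma K_uminus: "x \<in> K \<Longrightarrow> - x \<in> K"
  by (metis K_cases K_rat_eval rat_eval_simps(5))

lemma K_mult: "x \<in> K \<Longrightarrow> y \<in> K \<Longrightarrow> x * y \<in> K"
  by (metis K_cases K_rat_eval rat_eval_simps(6))

lemma K_prod: "(\<And>i. i \<in> A \<Longrightarrow> f i \<in> K) \<Longrightarrow> (\<Prod>i\<in>A. f i) \<in> K"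
  by (induction A rule: infinite_finite_induct) (auto intro: K_1 K_mult)

lemma
  assumes a: "\<not> n dvd a"
  shows cj_of_rat: "cj a (of_rat c) = of_rat c"
    and cj_power_z: "cj a (z ^ k) = z ^ (a * k)"
    and cj_add: "x \<in> K \<Longrightarrow> y \<in> K \<Longrightarrow> cj a (x + y) = cj a x + cj a y"
    and cj_uminus: "x \<in> K \<Longrightarrow> cj a (- x) = - cj a x"
    and cj_mult: "x \<in> K \<Longrightarrow> y \<in> K \<Longrightarrow> cj a (x * y) = cj a x * cj a y"
proof -
  show "cj a (of_rat c) = of_rat c" using cj_rat_eval[OF a, of "[:c:]"] by simp
  show "cj a (z ^ k) = z ^ (a * k)" using cj_rat_eval[OF a, of "monom 1 k"] by (simp add: power_mult)
  show "cj a (x + y) = cj a x + cj a y" if "x \<in> K" "y \<in> K"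
    using that by (metis K_cases a cj_rat_eval rat_eval_simps(3))
  show "cj a (- x) = - cj a x" if "x \<in> K"
    using that by (metis K_cases a cj_rat_eval rat_eval_simps(5))
  show "cj a (x * y) = cj a x * cj a y" if "x \<in> K" "y \<in> K"
    using that by (metis K_cases a cj_rat_eval rat_eval_simps(6))
qed

lemma not_dvd_1: "\<not> n dvd 1" using n_gt_2 by simp

lemma not_dvd_mult: "\<not> n dvd a \<Longrightarrow> \<not> n dvd b \<Longrightarrow> \<not> n dvd a * b"
  using n(1) by (simp add: prime_dvd_mult_iff)

lemma not_dvd_small: "a \<in> {1..<n} \<Longrightarrow> \<not> n dvd a" by (auto dest: dvd_imp_le)

lemma cj_1 [simp]: "\<not> n dvd a \<Longrightarrow> cj a 1 = 1" using cj_of_rat[of a 1] by simp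

lemma cj_identity: "x \<in> K \<Longrightarrow> cj 1 x = x" using not_dvd_1 by (metis K_cases power_one_right)

lemma cj_prod:
  assumes "\<not> n dvd a" "\<And>i. i \<in> A \<Longrightarrow> f i \<in> K"
  shows "cj a (\<Prod>i\<in>A. f i) = (\<Prod>i\<in>A. cj a (f i))"
  using assms(2) by (induction A rule: infinite_finite_induct) (auto simp: assms(1) cj_mult K_prod)

lemma cj_mod: "cj (a mod n) = cj a" by (simp add: cj_def power_mod fun_eq_iff)

lemma cj_closed_cj:
  assumes "\<not> n dvd a" "x \<in> K"
  shows cj_closed: "cj a x \<in> K" and cj_cj: "\<not> n dvd b \<Longrightarrow> cj b (cj a x) = cj (a * b) x"
proof -
  obtain f where f: "x = rat_eval f z" "\<And>a. \<not> n dvd a \<Longrightarrow> cj a x = rat_eval f (z ^ a)"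
    using K_cases[OF assms(2)] by blast
  have eq: "cj a x = rat_eval (pcompose f (monom 1 a)) z" using f(2) assms(1) by simp
  show "cj a x \<in> K" unfolding eq by (rule K_rat_eval)
  show "cj b (cj a x) = cj (a * b) x" if "\<not> n dvd b"
    unfolding eq cj_rat_eval[OF that] using f(2)[OF not_dvd_mult[OF assms(1) that]]
    by (simp add: power_mult mult.commute flip: power_mult)
qed

lemma algebraic_int_cj: "\<not> n dvd a \<Longrightarrow> x \<in> K \<Longrightarrow> algebraic_int x \<Longrightarrow> algebraic_int (cj a x)"
  by (metis K_cases algebraic_int_conjugate)

lemma bij_betw_mult_mod:
  assumes "\<not> n dvd b"
  shows "bij_betw (\<lambda>a. a * b mod n) {1..<n} {1..<n}"
proof -
  have "inj_on (\<lambda>a. a * b mod n) {1..<n}"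
  proof (rule inj_onI)
    fix x y assume xy: "x \<in> {1..<n}" "y \<in> {1..<n}" "x * b mod n = y * b mod n"
    have "coprime b n" using assms n(1) by (metis coprime_commute prime_imp_coprime)
    hence "[x = y] (mod n)" using xy(3) cong_mult_rcancel_nat[of b n x y] by (simp add: cong_def)
    thus "x = y" using xy by (simp add: cong_def)
  qed
  moreover have "(\<lambda>a. a * b mod n) ` {1..<n} \<subseteq> {1..<n}"
  proof
    fix y assume "y \<in> (\<lambda>a. a * b mod n) ` {1..<n}"
    then obtain a where a: "a \<in> {1..<n}" "y = a * b mod n" by blast
    have "y \<noteq> 0" using not_dvd_mult[OF not_dvd_small[OF a(1)] assms] by (simp add: a(2) mod_eq_0_iff_dvd)
    thus "y \<in> {1..<n}" using a(2) by simp
  qed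
  ultimately show ?thesis by (simp add: bij_betw_def card_image card_subset_eq)
qed

text \<open>Summing over \<open>a = 0\<close> as well leaves only exponents divisible by
  \<open>n\<close>; the added term is the rational value of \<open>f\<close> at 1.\<close>

lemma trace_rational:
  assumes "x \<in> K"
  shows "(\<Sum>a\<in>{1..<n}. cj a x) \<in> \<rat>"
proof -
  obtain f where f: "x = rat_eval f z" "\<And>a. \<not> n dvd a \<Longrightarrow> cj a x = rat_eval f (z ^ a)"
    using K_cases[OF assms] by blast
  define c where "c = (\<lambda>i. \<Sum>j | j \<le> degree f \<and> j mod n = i. coeff f j)"
  have fold: "rat_eval f (z ^ a) = (\<Sum>i<n. of_rat (c i) * z ^ (a * i))" for a
    by (simp only: c_def rat_eval_fold)
  have "(\<Sum>a<n. rat_eval f (z ^ a)) = (\<Sum>i<n. \<Sum>a<n. of_rat (c i) * z ^ (i * a))"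
    unfolding fold by (subst sum.swap) (simp add: mult.commute)
  also have "\<dots> = (\<Sum>i<n. of_rat (c i) * (if n dvd i then of_nat n else 0))"
    unfolding sum_distrib_left[symmetric] sum_powers ..
  also have "\<dots> \<in> \<rat>" by (intro Rats_sum) auto
  finally have "(\<Sum>a<n. rat_eval f (z ^ a)) \<in> \<rat>" .
  moreover have "(\<Sum>i<n. of_rat (c i)) \<in> (\<rat> :: complex set)" by (intro Rats_sum) auto
  ultimately have "(\<Sum>a<n. rat_eval f (z ^ a)) - (\<Sum>i<n. of_rat (c i)) \<in> \<rat>" by (rule Rats_diff)
  moreover have "{..<n} = insert 0 {1..<n}" by auto
  hence "(\<Sum>a<n. rat_eval f (z ^ a)) = rat_eval f (z ^ 0) + (\<Sum>a\<in>{1..<n}. rat_eval f (z ^ a))"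
    by simp
  moreover have "rat_eval f (z ^ 0) = (\<Sum>i<n. of_rat (c i))" unfolding fold by simp
  moreover have "(\<Sum>a\<in>{1..<n}. cj a x) = (\<Sum>a\<in>{1..<n}. rat_eval f (z ^ a))"
    using f(2) not_dvd_small by (intro sum.cong) auto
  ultimately show ?thesis by simp
qed

definition norm_K :: "complex \<Rightarrow> complex" where
  "norm_K x = (\<Prod>a\<in>{1..<n}. cj a x)"

text \<open>The norm is fixed by every conjugation, so its trace is \<open>n - 1\<close> times
  itself.\<close>

lemma norm_K_rational:
  assumes "x \<in> K"
  shows "norm_K x \<in> \<rat>"
proof -
  have N: "norm_K x \<in> K"
    unfolding norm_K_def using assms not_dvd_small by (intro K_prod cj_closed) auto
  have "cj b (norm_K x) = norm_K x" if b: "b \<in> {1..<n}" for b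
  proof -
    have nb: "\<not> n dvd b" using not_dvd_small[OF b] .
    have "cj b (norm_K x) = (\<Prod>a\<in>{1..<n}. cj b (cj a x))"
      unfolding norm_K_def using assms not_dvd_small nb by (intro cj_prod cj_closed) auto
    also have "\<dots> = (\<Prod>a\<in>{1..<n}. cj (a * b mod n) x)"
      using assms not_dvd_small nb by (intro prod.cong refl) (simp add: cj_cj cj_mod)
    also have "\<dots> = norm_K x"
      unfolding norm_K_def by (rule prod.reindex_bij_betw[OF bij_betw_mult_mod[OF nb]])
    finally show ?thesis .
  qed
  hence "(\<Sum>b\<in>{1..<n}. cj b (norm_K x)) = of_nat (n - 1) * norm_K x" by simp
  hence "of_nat (n - 1) * norm_K x \<in> \<rat>" using trace_rational[OF N] by simp
  hence "of_nat (n - 1) * norm_K x / of_nat (n - 1) \<in> \<rat>" by (intro Rats_divide) auto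
  thus ?thesis using n_gt_2 by simp
qed

lemma cj_nonzero:
  assumes "x \<in> K" "x \<noteq> 0" "\<not> n dvd a"
  shows "cj a x \<noteq> 0"
proof
  assume 0: "cj a x = 0"
  have "coprime a n" using assms(3) n(1) by (metis coprime_commute prime_imp_coprime)
  then obtain b where "[a * b = Suc 0] (mod n)" using cong_solve_coprime_nat by blast
  hence ab: "a * b mod n = 1" using n_gt_2 by (simp add: cong_def)
  hence b: "\<not> n dvd b" by (metis dvd_mult mod_0_imp_dvd mod_eq_0_iff_dvd zero_neq_one)
  have "x = cj (a * b mod n) x" using cj_identity[OF assms(1)] ab by simp
  also have "\<dots> = cj b (cj a x)" using cj_cj[OF assms(3,1) b] cj_mod by simp
  also have "\<dots> = 0" using cj_of_rat[OF b, of 0] 0 by simp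
  finally show False using assms(2) by simp
qed

lemma norm_K_nonzero: "x \<in> K \<Longrightarrow> x \<noteq> 0 \<Longrightarrow> norm_K x \<noteq> 0"
  unfolding norm_K_def using cj_nonzero not_dvd_small by auto

text \<open>The remaining conjugates of \<open>x\<close> multiply to an element of \<open>K\<close>
  whose product with \<open>x\<close> is the rational norm.\<close>

lemma K_inverse:
  assumes "x \<in> K"
  shows "inverse x \<in> K"
proof (cases "x = 0")
  case False
  define y where "y = (\<Prod>a\<in>{2..<n}. cj a x)"
  have y: "y \<in> K"
    unfolding y_def using assms not_dvd_small by (intro K_prod cj_closed) auto
  have "{1..<n} = insert 1 {2..<n}" using n_gt_2 by auto
  hence "norm_K x = x * y" using cj_identity[OF assms] by (simp add: norm_K_def y_def)
  moreover obtain c where "norm_K x = of_rat c"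
    using norm_K_rational[OF assms] by (elim Rats_cases)
  ultimately have c: "x * y = of_rat c" "c \<noteq> 0"
    using norm_K_nonzero[OF assms False] by auto
  have "x * (y * of_rat (inverse c)) = of_rat (c * inverse c)"
    by (simp only: mult.assoc[symmetric] c(1) of_rat_mult)
  hence "inverse x = y * of_rat (inverse c)" using c(2) by (intro inverse_unique) simp
  thus ?thesis using y by (simp add: K_mult K_of_rat)
qed (use assms in simp)

lemma cj_inverse:
  assumes "x \<in> K" "\<not> n dvd a"
  shows "cj a (inverse x) = inverse (cj a x)"
proof (cases "x = 0")
  case True
  thus ?thesis using cj_of_rat[OF assms(2), of 0] by simp
next
  case False
  have "cj a x * cj a (inverse x) = cj a (x * inverse x)"
    using cj_mult[OF assms(2,1) K_inverse[OF assms(1)]] by simp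
  also have "\<dots> = 1" using False assms(2) by simp
  finally show ?thesis by (metis inverse_unique)
qed

lemma cmod_norm_K_unit:
  assumes x: "x \<in> K" "x \<noteq> 0" "algebraic_int x" "algebraic_int (inverse x)"
  shows "cmod (norm_K x) = 1"
proof -
  have int: "norm_K y \<in> \<int>" if "y \<in> K" "algebraic_int y" for y
  proof (rule rational_algebraic_int_is_int)
    show "algebraic_int (norm_K y)"
      unfolding norm_K_def using that not_dvd_small
      by (intro algebraic_int_prod algebraic_int_cj) auto
  qed (rule norm_K_rational[OF that(1)])
  have "norm_K x * norm_K (inverse x) = 1"
    unfolding norm_K_def prod.distrib[symmetric]
    using x not_dvd_small cj_nonzero by (intro prod.neutral) (auto simp: cj_inverse)
  moreover obtain a where a: "norm_K x = of_int a" using int[OF x(1,3)] by (elim Ints_cases)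
  moreover obtain b where "norm_K (inverse x) = of_int b" using int[OF K_inverse[OF x(1)] x(4)] by (elim Ints_cases)
  ultimately have "of_int (a * b) = (1 :: complex)" by simp
  hence "a * b = 1" by (simp only: of_int_eq_1_iff)
  hence "a = 1 \<or> a = - 1" by (simp add: zmult_eq_1_iff) blast
  thus ?thesis using a by auto
qed

text \<open>The traces of the \<open>x * z ^ j\<close> are bounded integers, and Fourier inversion
  recovers \<open>x\<close> from them; the exponent \<open>(n - 1) * j\<close> stands for
  \<open>- j\<close>.\<close>

lemma finite_bounded_algebraic_ints:
  "finite {x \<in> K. algebraic_int x \<and> (\<forall>a\<in>{1..<n}. cmod (cj a x) \<le> C)}" (is "finite ?F")
proof -
  define B where "B = \<lceil>of_nat n * C\<rceil>"
  let ?g = "\<lambda>t. (\<Sum>j<n. of_int (t j) * z ^ ((n - 1) * j)) / of_nat n"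
  have "?F \<subseteq> ?g ` ({..<n} \<rightarrow>\<^sub>E {- B..B})"
  proof
    fix x assume "x \<in> ?F"
    hence x: "x \<in> K" "algebraic_int x" "\<And>a. a \<in> {1..<n} \<Longrightarrow> cmod (cj a x) \<le> C" by auto
    have "0 \<le> cmod (cj 1 x)" by simp
    also have "\<dots> \<le> C" using n_gt_2 by (intro x(3)) simp
    finally have "0 \<le> C" .
    define T where "T = (\<lambda>j. \<Sum>a\<in>{1..<n}. cj a x * z ^ (a * j))"
    have xz: "x * z ^ j \<in> K" for j by (intro K_mult x K_power_z)
    have cj_xz: "cj a (x * z ^ j) = cj a x * z ^ (a * j)" if "a \<in> {1..<n}" for a j
      using cj_mult[OF not_dvd_small[OF that] x(1) K_power_z] cj_power_z[OF not_dvd_small[OF that]] by simp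
    have "T j \<in> \<int>" for j
    proof (rule rational_algebraic_int_is_int)
      show "T j \<in> \<rat>" using trace_rational[OF xz[of j]] cj_xz by (simp add: T_def)
      show "algebraic_int (T j)"
        unfolding T_def using x not_dvd_small
        by (intro algebraic_int_sum algebraic_int_mult algebraic_int_power algebraic_int_cj) auto
    qed
    hence "\<forall>j. \<exists>t. T j = of_int t" by (auto elim: Ints_cases)
    then obtain t where t: "\<And>j. T j = of_int (t j)" by metis
    have tB: "t j \<in> {- B..B}" for j
    proof -
      have "cmod z ^ n = 1" using z(1) by (metis norm_one norm_power)
      hence "cmod z = 1" using power_eq_imp_eq_base[of "cmod z" n 1] by simp
      hence "cmod (T j) \<le> (\<Sum>a\<in>{1..<n}. C)"
        unfolding T_def by (intro sum_norm_le) (simp add: norm_mult norm_power x(3))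
      also have "\<dots> \<le> of_nat n * C" using \<open>0 \<le> C\<close> n_gt_2 by (simp add: mult_right_mono)
      finally have "\<bar>of_int (t j)\<bar> \<le> of_nat n * C" by (simp add: t)
      hence "\<bar>t j\<bar> \<le> B" unfolding B_def by linarith
      thus ?thesis by auto
    qed
    have "x = ?g t"
    proof -
      have "(\<Sum>j<n. of_int (t j) * z ^ ((n - 1) * j)) = (\<Sum>j<n. \<Sum>a\<in>{1..<n}. cj a x * z ^ ((a + (n - 1)) * j))"
        unfolding t[symmetric] T_def sum_distrib_right distrib_right power_add mult.assoc ..
      also have "\<dots> = (\<Sum>a\<in>{1..<n}. cj a x * (\<Sum>j<n. z ^ ((a + (n - 1)) * j)))"
        unfolding sum_distrib_left by (rule sum.swap)
      also have "\<dots> = (\<Sum>a\<in>{1..<n}. if a = 1 then x * of_nat n else 0)"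
      proof (rule sum.cong[OF refl])
        fix a assume a: "a \<in> {1..<n}"
        have "n dvd a + (n - 1) \<longleftrightarrow> a = 1"
        proof
          assume "n dvd a + (n - 1)"
          moreover have "a + (n - 1) = (a - 1) + n" using a by auto
          ultimately have "n dvd a - 1" by simp
          moreover have "a - 1 < n" using a by auto
          ultimately show "a = 1" using a by (cases "a - 1 = 0") (auto dest: dvd_imp_le)
        qed auto
        thus "cj a x * (\<Sum>j<n. z ^ ((a + (n - 1)) * j)) = (if a = 1 then x * of_nat n else 0)"
          unfolding sum_powers using cj_identity[OF x(1)] by simp
      qed
      also have "\<dots> = x * of_nat n" using n_gt_2 by simp
      finally show ?thesis by simp
    qed
    hence "x = ?g (restrict t {..<n})" by simp
    moreover have "restrict t {..<n} \<in> {..<n} \<rightarrow>\<^sub>E {- B..B}" using tB by (intro restrict_PiE_iff[THEN iffD2] ballI)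
    ultimately show "x \<in> ?g ` ({..<n} \<rightarrow>\<^sub>E {- B..B})" by (rule image_eqI)
  qed
  thus ?thesis by (rule finite_subset) (intro finite_imageI finite_PiE, auto)
qed

section \<open>The real subfield\<close>

definition L :: "complex set" where "L = rat_adjoin {z + inverse z}"

lemma cnj_z: "cnj z = inverse z"
proof -
  have "cmod z ^ n = 1" using z(1) by (metis norm_one norm_power)
  hence "cmod z = 1" using power_eq_imp_eq_base[of "cmod z" n 1] by simp
  thus ?thesis by (metis complex_norm_square inverse_unique of_real_1 one_power2)
qed

lemma L_subset_K_real:
  assumes "x \<in> L"
  shows "x \<in> K \<and> (\<forall>a. \<not> n dvd a \<longrightarrow> cj a x \<in> \<real>)"
  using assms unfolding L_def
proof (induction rule: rat_adjoin_induct)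
  case one
  then show ?case by (simp add: K_1)
next
  case (incl x)
  hence x: "x = z ^ 1 + z ^ (n - 1)" using inverse_power[of 1] n_gt_2 by simp
  have "cj a x \<in> \<real>" if a: "\<not> n dvd a" for a
  proof -
    have "cj a x = z ^ (a * 1) + z ^ (a * (n - 1))"
      unfolding x by (simp only: a cj_add K_power_z cj_power_z not_False_eq_True)
    also have "z ^ (a * (n - 1)) = (inverse z ^ 1) ^ a"
      using inverse_power[of 1] n_gt_2 by (simp add: power_mult mult.commute flip: power_mult)
    also have "\<dots> = cnj (z ^ a)" by (simp add: cnj_z)
    finally show ?thesis by (simp add: complex_is_Real_iff flip: complex_cnj_power)
  qed
  moreover have "x \<in> K" unfolding x by (intro K_add K_power_z)
  ultimately show ?case by blast
qed (auto simp: K_uminus K_inverse K_add K_mult cj_uminus cj_inverse cj_add cj_mult)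

lemma L_in_K: "x \<in> L \<Longrightarrow> x \<in> K" and cj_L_real: "x \<in> L \<Longrightarrow> \<not> n dvd a \<Longrightarrow> cj a x \<in> \<real>"
  using L_subset_K_real by blast+

text \<open>Opposite exponents give complex conjugate images, and the images of \<open>L\<close> are
  real.\<close>

lemma cj_L_uminus:
  assumes "x \<in> L" "\<not> n dvd a" "n dvd a + b"
  shows "cj b x = cj a x"
proof -
  have b: "\<not> n dvd b" using assms(2,3) by (meson dvd_add_left_iff)
  obtain f where f: "\<And>a. \<not> n dvd a \<Longrightarrow> cj a x = rat_eval f (z ^ a)"
    using K_cases[OF L_in_K[OF assms(1)]] by blast
  have "z ^ a * z ^ b = 1" using assms(3) power_eq_1_iff[of "a + b"] by (simp add: power_add)
  hence "z ^ b = cnj (z ^ a)" by (simp add: cnj_z power_inverse) (metis inverse_unique)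
  hence "cj b x = cnj (cj a x)" using f assms(2) b rat_eval_cnj[of f "z ^ a"] by simp
  thus ?thesis using cj_L_real[OF assms(1,2)] by (simp add: Reals_cnj_iff)
qed

end

section \<open>Multiplicative relations between units\<close>

context prime_root_of_unity
begin

lemma w_altdef: "w k = z ^ k + z ^ ((n - 1) * k)"
  using inverse_power[of 1] n_gt_2 by (simp add: w_def power_mult)

lemma cj_w:
  assumes "\<not> n dvd a"
  shows "cj a (w k) = w (a * k)"
  unfolding w_altdef cj_add[OF assms K_power_z K_power_z] cj_power_z[OF assms]
  by (simp add: mult.left_commute)

lemma w_power2_in_L: "w (2 ^ k) \<in> L"
proof (induction k)
  case 0
  then show ?case by (simp add: w_def L_def rat_adjoin_incl)
next
  case (Suc k)
  have "1 + 1 \<in> L" unfolding L_def by (intro rat_adjoin_add rat_adjoin_1)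
  with Suc have "w (2 ^ k) ^ 2 - 2 \<in> L" unfolding L_def by (intro rat_adjoin_diff rat_adjoin_power) simp_all
  then show ?case by (simp add: w_double)
qed

definition real_units :: "complex set" where
  "real_units = {x \<in> L. x \<noteq> 0 \<and> algebraic_int x \<and> algebraic_int (inverse x)}"

text \<open>Up to a power of \<open>z\<close>, \<open>w k\<close> is \<open>1 + \<eta>\<close>, the
  quotient of \<open>1 - \<eta> ^ 2\<close> by \<open>1 - \<eta>\<close>. As \<open>n\<close> is
  odd, \<open>\<eta>\<close> is a power of \<open>\<eta> ^ 2\<close>, so the inverse quotient is the
  geometric sum \<open>S\<close>.\<close>

lemma w_unit:
  assumes "\<not> n dvd 2 * k" "w k \<in> L"
  shows "w k \<in> real_units"
proof -
  define \<eta> where "\<eta> = z ^ (2 * k)"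
  define S where "S = (\<Sum>i<(n + 1) div 2. (\<eta> ^ 2) ^ i)"
  have \<eta>: "\<eta> \<noteq> 1" "\<eta> ^ n = 1"
    using assms(1) power_eq_1_iff[of "2 * k"] power_eq_1_iff[of "2 * k * n"] by (simp_all add: \<eta>_def flip: power_mult)
  have n2: "2 * ((n + 1) div 2) = n + 1" using n(2) by simp
  have "(1 - \<eta> ^ 2) * S = 1 - (\<eta> ^ 2) ^ ((n + 1) div 2)"
    unfolding S_def by (rule one_diff_power_eq[symmetric])
  also have "(\<eta> ^ 2) ^ ((n + 1) div 2) = \<eta> ^ (n + 1)"
    unfolding power_mult[symmetric] n2 ..
  also have "\<dots> = \<eta>" using \<eta>(2) by simp
  finally have "(1 - \<eta>) * ((1 + \<eta>) * S) = (1 - \<eta>) * 1"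
    by (simp add: power2_eq_square algebra_simps)
  hence S: "(1 + \<eta>) * S = 1" using \<eta>(1) by (subst (asm) mult_cancel_left) auto
  have "w k * z ^ k = 1 + \<eta>"
    by (simp add: w_def distrib_right \<eta>_def mult_2 power_add flip: power_mult_distrib)
  hence "w k * (z ^ k * S) = 1" using S by (simp add: mult.assoc[symmetric])
  moreover from this have "w k \<noteq> 0" by auto
  moreover from calculation have "inverse (w k) = z ^ k * S" by (metis inverse_unique)
  moreover have "algebraic_int (z ^ k * S)"
    unfolding S_def \<eta>_def
    by (intro algebraic_int_mult algebraic_int_sum algebraic_int_power algebraic_int_z)
  ultimately show ?thesis using assms(2) algebraic_int_w by (simp add: real_units_def)
qed

lemma real_units_L: "x \<in> real_units \<Longrightarrow> x \<in> L" and real_units_nonzero: "x \<in> real_units \<Longrightarrow> x \<noteq> 0"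
  by (simp_all add: real_units_def)

lemma real_units_1: "1 \<in> real_units"
  by (simp add: real_units_def L_def rat_adjoin_1)

lemma real_units_mult: "x \<in> real_units \<Longrightarrow> y \<in> real_units \<Longrightarrow> x * y \<in> real_units"
  unfolding real_units_def L_def by (auto intro: rat_adjoin_mult algebraic_int_mult)

lemma real_units_inverse: "x \<in> real_units \<Longrightarrow> inverse x \<in> real_units"
  unfolding real_units_def L_def by (auto intro: rat_adjoin_inverse)

lemma real_units_power: "x \<in> real_units \<Longrightarrow> x ^ k \<in> real_units"
  by (induction k) (auto intro: real_units_1 real_units_mult)

lemma real_units_power_int: "x \<in> real_units \<Longrightarrow> x powi k \<in> real_units"
  by (auto simp: power_int_def intro: real_units_power real_units_inverse)

lemma real_units_prod: "(\<And>i. i \<in> A \<Longrightarrow> f i \<in> real_units) \<Longrightarrow> (\<Prod>i\<in>A. f i) \<in> real_units"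
  by (induction A rule: infinite_finite_induct) (auto intro: real_units_1 real_units_mult)

end

lemma of_int_bit: "(of_int k :: bit) = (if even k then 0 else 1)"
proof (cases "even k")
  case True
  then obtain l where "k = 2 * l" by blast
  hence "(of_int k :: bit) = 2 * of_int l" by (simp only: of_int_mult of_int_numeral)
  also have "\<dots> = 0" by (simp only: bit_2_eq_0 mult_zero_left)
  finally show ?thesis using True by simp
next
  case False
  then obtain l where "k = 2 * l + 1" by (elim oddE)
  hence "(of_int k :: bit) = 2 * of_int l + 1" by (simp only: of_int_mult of_int_numeral of_int_add of_int_1)
  also have "\<dots> = 1" by (simp only: bit_2_eq_0 mult_zero_left add_0_left)
  finally show ?thesis using False by simp
qed

text \<open>A homomorphism on the nonzero reals, which turns sign conditions on products into linear
  equations in the exponents.\<close>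

definition sign_bit :: "real \<Rightarrow> bit" where "sign_bit x = (if x < 0 then 1 else 0)"

lemma sign_bit_mult: "x \<noteq> 0 \<Longrightarrow> y \<noteq> 0 \<Longrightarrow> sign_bit (x * y) = sign_bit x + sign_bit y"
  by (auto simp: sign_bit_def mult_less_0_iff)

lemma sign_bit_prod:
  "(\<And>i. i \<in> A \<Longrightarrow> f i \<noteq> 0) \<Longrightarrow> sign_bit (\<Prod>i\<in>A. f i) = (\<Sum>i\<in>A. sign_bit (f i))"
proof (induction A rule: infinite_finite_induct)
  case (insert x A)
  have "(\<Prod>i\<in>A. f i) \<noteq> 0" using insert.hyps insert.prems by simp
  thus ?case using insert sign_bit_mult[of "f x" "\<Prod>i\<in>A. f i"] by simp
qed (simp_all add: sign_bit_def)

lemma sign_bit_power_int: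
  assumes "x \<noteq> 0"
  shows "sign_bit (x powi k) = of_int k * sign_bit x"
proof (cases "even k")
  case True
  then obtain l where "k = l + l" by (metis evenE mult_2)
  hence "x powi k = x powi l * x powi l" using assms power_int_add[of x l l] by simp
  moreover have "\<dots> \<ge> 0" by simp
  ultimately have "\<not> x powi k < 0" by linarith
  thus ?thesis using True unfolding of_int_bit sign_bit_def by simp
next
  case False
  then obtain l where "k = l + l + 1" by (metis oddE mult_2)
  hence "x powi k = x powi l * x powi l * x"
    using assms power_int_add[of x l l] power_int_add[of x "l + l" 1] by simp
  moreover have "x powi l * x powi l > 0" using assms by (metis not_real_square_gt_zero power_int_not_zero)
  ultimately have "x powi k < 0 \<longleftrightarrow> x < 0" by (metis mult_less_0_iff not_less_iff_gr_or_eq)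
  thus ?thesis using False unfolding of_int_bit sign_bit_def by simp
qed

section \<open>Real embeddings and logarithms of units\<close>

locale safe_prime_root_of_unity = safe_prime p q + prime_root_of_unity q z
  for p q :: nat and z :: complex
begin

lemma not_q_dvd_power2 [simp]: "\<not> q dvd 2 ^ j"
  using not_dvd_power2[of j] by (metis int_dvd_int_iff of_nat_numeral of_nat_power)

text \<open>The indices \<open>j < p\<close> give all conjugations on \<open>L\<close>, see
  \<open>cj_is_emb\<close>; with powers of 2 as exponents, they act on the \<open>w (2 ^ k)\<close>
  by shifting \<open>k\<close>.\<close>

definition emb :: "nat \<Rightarrow> complex \<Rightarrow> real" where "emb j x = Re (cj (2 ^ j) x)"

lemma of_real_emb: "x \<in> L \<Longrightarrow> of_real (emb j x) = cj (2 ^ j) x"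
  using cj_L_real[of x "2 ^ j"] by (simp add: emb_def)

lemma emb_0: "x \<in> L \<Longrightarrow> of_real (emb 0 x) = x"
  using of_real_emb[of x 0] cj_identity[OF L_in_K] by simp

lemma emb_1 [simp]: "emb j 1 = 1" by (simp add: emb_def)

lemma emb_minus_1 [simp]: "emb j (- 1) = - 1"
  using cj_uminus[of "2 ^ j" 1] by (simp add: emb_def K_1)

lemma emb_mult: "x \<in> L \<Longrightarrow> y \<in> L \<Longrightarrow> emb j (x * y) = emb j x * emb j y"
  using cj_mult[OF not_q_dvd_power2 L_in_K L_in_K, of x y j] cj_L_real[of x "2 ^ j"] cj_L_real[of y "2 ^ j"]
  by (simp add: emb_def complex_is_Real_iff)

lemma emb_inverse: "x \<in> L \<Longrightarrow> emb j (inverse x) = inverse (emb j x)"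
  using cj_inverse[OF L_in_K not_q_dvd_power2, of x j] of_real_emb[of x j]
  by (metis Re_complex_of_real emb_def of_real_inverse)

lemma emb_nonzero: "x \<in> real_units \<Longrightarrow> emb j x \<noteq> 0"
  using cj_nonzero[OF L_in_K _ not_q_dvd_power2, of x j] of_real_emb[of x j]
  by (auto simp: real_units_def)

lemma emb_power: "x \<in> real_units \<Longrightarrow> emb j (x ^ k) = emb j x ^ k"
proof (induction k)
  case (Suc k)
  then show ?case using emb_mult[OF real_units_L real_units_L, of x "x ^ k" j] real_units_power by simp
qed simp

lemma emb_power_int: "x \<in> real_units \<Longrightarrow> emb j (x powi k) = emb j x powi k"
  using emb_power emb_inverse[OF real_units_L] real_units_power real_units_inverse
  by (simp add: power_int_def)

lemma emb_prod:
  "(\<And>i. i \<in> A \<Longrightarrow> f i \<in> real_units) \<Longrightarrow> emb j (\<Prod>i\<in>A. f i) = (\<Prod>i\<in>A. emb j (f i))"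
proof (induction A rule: infinite_finite_induct)
  case (insert a A)
  have "(\<Prod>i\<in>A. f i) \<in> real_units" using insert.prems by (intro real_units_prod) auto
  with insert show ?case using emb_mult[OF real_units_L real_units_L, of "f a" "\<Prod>i\<in>A. f i" j] by simp
qed simp_all

lemma cj_is_emb:
  assumes "x \<in> L" "a \<in> {1..<q}"
  obtains k where "k < p" "cj a x = of_real (emb k x)"
proof -
  have a: "\<not> q dvd a" using not_dvd_small assms(2) .
  hence "\<not> int q dvd int a" by simp
  then obtain k where k: "k < p" "[int a = 2 ^ k] (mod int q) \<or> [int a = - (2 ^ k)] (mod int q)"
    using signed_power2 by blast
  from k(2) have "cj a x = cj (2 ^ k) x"
  proof
    assume "[int a = 2 ^ k] (mod int q)"
    hence "[a = 2 ^ k] (mod q)" using cong_int_iff[of a "2 ^ k" q] by simp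
    thus ?thesis using cj_mod[of a] cj_mod[of "2 ^ k"] by (simp add: cong_def)
  next
    assume "[int a = - (2 ^ k)] (mod int q)"
    hence "int q dvd int (2 ^ k + a)" by (simp add: cong_iff_dvd_diff add.commute)
    hence "q dvd 2 ^ k + a" by (simp only: int_dvd_int_iff)
    thus ?thesis using cj_L_uminus[OF assms(1) not_q_dvd_power2] by blast
  qed
  thus ?thesis using that k(1) of_real_emb[OF assms(1)] by simp
qed

text \<open>The norm of a unit has absolute value 1, and each real embedding occurs twice among the
  \<open>q - 1\<close> conjugations in it.\<close>

lemma sum_ln_emb:
  assumes x: "x \<in> real_units"
  shows "(\<Sum>k<p. ln \<bar>emb k x\<bar>) = 0"
proof -
  have xL: "x \<in> L" "x \<in> K" using real_units_L[OF x] L_in_K by blast+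
  define F where "F = (\<lambda>i. ln (cmod (cj (nat (i mod int q)) x)))"
  have F: "even_periodic F"
    unfolding even_periodic_def
  proof (intro conjI allI impI)
    fix i assume i: "\<not> int q dvd i"
    define a b where "a = nat (i mod int q)" and "b = nat (- i mod int q)"
    have ab: "int a = i mod int q" "int b = - i mod int q"
      using mod_bounds(1)[of i] mod_bounds(1)[of "- i"] by (simp_all add: a_def b_def)
    have "int q dvd int a" if "q dvd a" using that by simp
    hence a: "\<not> q dvd a" using i by (auto simp: ab dvd_mod_iff)
    have "int (a + b) mod int q = (i + - i) mod int q"
      by (simp only: of_nat_add ab mod_add_eq)
    hence "int q dvd int (a + b)" by (simp add: dvd_eq_mod_eq_0)
    hence "q dvd a + b" by (simp only: int_dvd_int_iff)
    from cj_L_uminus[OF xL(1) a this] show "F (- i) = F i" by (simp add: F_def a_def b_def)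
  qed (simp add: F_def)
  have F_nat: "F (int a) = ln (cmod (cj a x))" for a
  proof -
    have "nat (int a mod int q) = a mod q" by (metis nat_int zmod_int)
    thus ?thesis using cj_mod[of a] by (simp add: F_def)
  qed
  have "(\<Sum>k<p. F (2 ^ k * 1)) = (\<Sum>k<p. ln \<bar>emb k x\<bar>)"
  proof (rule sum.cong[OF refl])
    fix k
    have "F (2 ^ k * 1) = F (int (2 ^ k))" by simp
    also have "\<dots> = ln (cmod (of_real (emb k x)))" unfolding F_nat of_real_emb[OF xL(1)] ..
    finally show "F (2 ^ k * 1) = ln \<bar>emb k x\<bar>" by simp
  qed
  moreover have "(\<Sum>i\<in>{1..<int q}. F i) = 2 * (\<Sum>k<p. F (2 ^ k * 1))"
    by (rule sum_even_periodic[OF F]) simp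
  moreover have "(\<Sum>i\<in>{1..<int q}. F i) = (\<Sum>a\<in>{1..<q}. F (int a))"
  proof -
    have "int ` {1..<q} = {1..<int q}" using image_int_atLeastLessThan[of 1 q] by simp
    thus ?thesis by (metis (no_types, lifting) sum.reindex inj_on_of_nat o_apply sum.cong)
  qed
  moreover have "(\<Sum>a\<in>{1..<q}. F (int a)) = ln (\<Prod>a\<in>{1..<q}. cmod (cj a x))"
    unfolding F_nat using cj_nonzero[OF xL(2) real_units_nonzero[OF x]] prime_root_of_unity.not_dvd_small[OF prime_root_of_unity_axioms]
    by (intro ln_prod[symmetric]) auto
  moreover have "(\<Prod>a\<in>{1..<q}. cmod (cj a x)) = 1"
    using cmod_norm_K_unit[OF xL(2)] x by (simp add: real_units_def norm_K_def prod_norm)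
  ultimately show ?thesis by simp
qed

text \<open>A pigeonhole argument in the style of Dirichlet: as the logarithms of the conjugates of a
  unit add up to 0, there are only \<open>p - 1\<close> independent coordinates for products of \<open>p\<close> units.\<close>

lemma unit_relation:
  assumes g: "\<And>k. k < p \<Longrightarrow> g k \<in> real_units"
  obtains B where "\<exists>k<p. B k \<noteq> 0" "(\<Prod>k<p. g k powi B k) = 1"
proof -
  define l where "l = (\<lambda>j k. ln \<bar>emb j (g k)\<bar>)"
  \<comment> \<open>The spare 1 leaves room for rounding down in \<open>box\<close>.\<close>
  define D where "D = nat \<lceil>\<Sum>j<p. \<Sum>k<p. \<bar>l j k\<bar>\<rceil> + 1"
  \<comment> \<open>Contains the quotients of products from the same box: \<open>p - 1\<close> of
    their logarithms are at most 1 in absolute value, and the last is minus the sum of the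
    others.\<close>
  define W where "W = {x \<in> K. algebraic_int x \<and> (\<forall>a\<in>{1..<q}. cmod (cj a x) \<le> exp (real p))}"
  define N where "N = card W"
  \<comment> \<open>Makes the number \<open>H ^ p\<close> of exponent vectors exceed the bound
    \<open>(2 * (H * D) + 1) ^ (p - 1) * N\<close> for the number of values of
    \<open>f\<close>.\<close>
  define H where "H = N * (3 * D) ^ (p - 1) + 1"
  define A where "A = {..<p} \<rightarrow>\<^sub>E {..<H}"
  define P where "P = (\<lambda>e. \<Prod>k<p. g k ^ e k)"
  define lam where "lam = (\<lambda>e :: nat \<Rightarrow> nat. \<lambda>j. \<Sum>k<p. real (e k) * l j k)"
  define box where "box = (\<lambda>e. restrict (\<lambda>j. \<lfloor>lam e j\<rfloor>) {..<p - 1})"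
  define boxes where "boxes = {..<p - 1} \<rightarrow>\<^sub>E {- int (H * D)..int (H * D)}"
  \<comment> \<open>With one fixed vector per box, equal values of \<open>f\<close> yield equal
    products \<open>P e\<close>.\<close>
  define rep where "rep = (\<lambda>b. SOME e. e \<in> A \<and> box e = b)"
  define f where "f = (\<lambda>e. (box e, P e * inverse (P (rep (box e)))))"
  have finW: "finite W" unfolding W_def by (rule finite_bounded_algebraic_ints)
  have P_unit: "P e \<in> real_units" for e
    unfolding P_def using g by (intro real_units_prod real_units_power) auto
  have ln_P: "ln \<bar>emb j (P e)\<bar> = lam e j" for j e
  proof -
    have "emb j (P e) = (\<Prod>k<p. emb j (g k ^ e k))"
      unfolding P_def using g by (intro emb_prod real_units_power) auto
    also have "\<dots> = (\<Prod>k<p. emb j (g k) ^ e k)" using g emb_power by (intro prod.cong) auto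
    finally have "\<bar>emb j (P e)\<bar> = (\<Prod>k<p. \<bar>emb j (g k)\<bar> ^ e k)" by (simp add: abs_prod power_abs)
    also have "ln \<dots> = (\<Sum>k<p. ln (\<bar>emb j (g k)\<bar> ^ e k))" using g emb_nonzero by (intro ln_prod) auto
    also have "\<dots> = lam e j" unfolding lam_def l_def by (intro sum.cong refl ln_realpow)
    finally show ?thesis .
  qed
  have lD: "\<bar>l j k\<bar> \<le> (\<Sum>j<p. \<Sum>k<p. \<bar>l j k\<bar>)" if "j < p" "k < p" for j k
  proof -
    have "\<bar>l j k\<bar> \<le> (\<Sum>k<p. \<bar>l j k\<bar>)" using that by (intro member_le_sum) auto
    also have "\<dots> \<le> (\<Sum>j<p. \<Sum>k<p. \<bar>l j k\<bar>)"
      using that by (intro member_le_sum[where f = "\<lambda>j. \<Sum>k<p. \<bar>l j k\<bar>"]) (auto intro: sum_nonneg)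
    finally show ?thesis .
  qed
  have box_boxes: "box e \<in> boxes" if "e \<in> A" for e
  proof -
    have lam_le: "\<bar>lam e j\<bar> \<le> real (H * (D - 1))" if j: "j < p - 1" for j
    proof -
      have "\<bar>lam e j\<bar> \<le> (\<Sum>k<p. \<bar>real (e k) * l j k\<bar>)" unfolding lam_def by (rule sum_abs)
      also have "\<dots> \<le> (\<Sum>k<p. real H * \<bar>l j k\<bar>)"
      proof (rule sum_mono)
        fix k assume "k \<in> {..<p}"
        hence "e k < H" using \<open>e \<in> A\<close> by (auto simp: A_def)
        thus "\<bar>real (e k) * l j k\<bar> \<le> real H * \<bar>l j k\<bar>" by (simp add: abs_mult mult_right_mono)
      qed
      also have "\<dots> = real H * (\<Sum>k<p. \<bar>l j k\<bar>)" by (simp add: sum_distrib_left)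
      also have "\<dots> \<le> real H * (\<Sum>j<p. \<Sum>k<p. \<bar>l j k\<bar>)"
        using j by (intro mult_left_mono member_le_sum[where f = "\<lambda>j. \<Sum>k<p. \<bar>l j k\<bar>"]) (auto intro: sum_nonneg)
      also have "\<dots> \<le> real H * real (D - 1)"
        unfolding D_def by (intro mult_left_mono) (simp_all add: real_nat_ceiling_ge)
      finally show ?thesis by simp
    qed
    have "H * (D - 1) + 1 \<le> H * D" by (simp add: D_def H_def)
    hence "real (H * (D - 1)) + 1 \<le> real_of_int (int (H * D))" by (simp del: of_nat_mult)
    hence "\<lfloor>lam e j\<rfloor> \<in> {- int (H * D)..int (H * D)}" if "j < p - 1" for j
      using lam_le[OF that] unfolding atLeastAtMost_iff by linarith
    thus ?thesis unfolding box_def boxes_def by (intro restrict_PiE_iff[THEN iffD2]) blast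
  qed
  have f_range: "f e \<in> boxes \<times> W" if e: "e \<in> A" for e
  proof -
    define r where "r = rep (box e)"
    have "r \<in> A \<and> box r = box e" unfolding r_def rep_def using e by (intro someI_ex[where P = "\<lambda>r. r \<in> A \<and> box r = box e"]) blast
    hence r: "box r = box e" by blast
    define x where "x = P e * inverse (P r)"
    have xU: "x \<in> real_units" unfolding x_def by (intro real_units_mult real_units_inverse P_unit)
    have ln_x: "ln \<bar>emb j x\<bar> = lam e j - lam r j" for j
      unfolding x_def using emb_mult[OF real_units_L[OF P_unit] real_units_L[OF real_units_inverse[OF P_unit]]]
        emb_inverse[OF real_units_L[OF P_unit]] emb_nonzero[OF P_unit]
      by (simp add: abs_mult ln_mult ln_inverse flip: ln_P)
    have small: "\<bar>ln \<bar>emb j x\<bar>\<bar> \<le> 1" if "j < p - 1" for j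
    proof -
      have "\<lfloor>lam e j\<rfloor> = \<lfloor>lam r j\<rfloor>" using fun_cong[OF r, of j] that by (simp add: box_def)
      thus ?thesis unfolding ln_x by linarith
    qed
    have "\<bar>ln \<bar>emb j x\<bar>\<bar> \<le> real p" if j: "j < p" for j
    proof (cases "j = p - 1")
      case True
      have "{..<p} = insert (p - 1) {..<p - 1}" using p by auto
      hence "ln \<bar>emb (p - 1) x\<bar> = - (\<Sum>k<p - 1. ln \<bar>emb k x\<bar>)" using sum_ln_emb[OF xU] by simp
      hence "\<bar>ln \<bar>emb j x\<bar>\<bar> \<le> (\<Sum>k<p - 1. \<bar>ln \<bar>emb k x\<bar>\<bar>)" using True by (simp only: abs_minus_cancel sum_abs)
      also have "\<dots> \<le> (\<Sum>k<p - 1. 1)" using small by (intro sum_mono) auto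
      also have "\<dots> \<le> real p" by simp
      finally show ?thesis .
    next
      case False
      hence "\<bar>ln \<bar>emb j x\<bar>\<bar> \<le> 1" using small j by simp
      also have "1 \<le> real p" using p by simp
      finally show ?thesis .
    qed
    hence emb_le: "\<bar>emb j x\<bar> \<le> exp (real p)" if "j < p" for j
      using that emb_nonzero[OF xU, of j]
      by (metis abs_ge_self abs_of_nonneg exp_le_cancel_iff exp_ln order_trans zero_less_abs_iff)
    have "cmod (cj a x) \<le> exp (real p)" if a: "a \<in> {1..<q}" for a
    proof -
      obtain k where "k < p" "cj a x = of_real (emb k x)" using cj_is_emb[OF real_units_L[OF xU] a] .
      thus ?thesis using emb_le by simp
    qed
    hence "x \<in> W" using xU L_in_K by (simp add: W_def real_units_def)
    thus ?thesis using box_boxes[OF e] by (simp add: f_def x_def r_def)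
  qed
  have "finite boxes" unfolding boxes_def by (intro finite_PiE) auto
  have "card (f ` A) \<le> card (boxes \<times> W)"
    using f_range finW \<open>finite boxes\<close>
    by (intro card_mono finite_cartesian_product image_subsetI)
  also have "\<dots> = (2 * (H * D) + 1) ^ (p - 1) * N"
  proof -
    have "card {- int (H * D)..int (H * D)} = 2 * (H * D) + 1" unfolding card_atLeastAtMost_int by linarith
    thus ?thesis unfolding card_cartesian_product boxes_def N_def by (simp only: card_PiE finite_lessThan prod_constant card_lessThan)
  qed
  also have "\<dots> \<le> (3 * (H * D)) ^ (p - 1) * N"
    by (intro mult_right_mono power_mono) (simp_all add: H_def D_def)
  also have "\<dots> = H ^ (p - 1) * (N * (3 * D) ^ (p - 1))" by (simp add: power_mult_distrib mult_ac)
  also have "\<dots> < H ^ (p - 1) * H" by (intro mult_strict_left_mono) (simp_all add: H_def)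
  also have "\<dots> = H ^ p" using p by (simp add: power_eq_if)
  also have "\<dots> = card A" by (simp add: A_def card_PiE)
  finally have "\<not> inj_on f A" by (rule pigeonhole)
  then obtain e e' where e: "e \<in> A" "e' \<in> A" "e \<noteq> e'" "f e = f e'" unfolding inj_on_def by blast
  have "P (rep (box e)) \<noteq> 0" using real_units_nonzero[OF P_unit] .
  hence Pe: "P e = P e'" using e(4) by (auto simp: f_def)
  define B where "B = (\<lambda>k. int (e k) - int (e' k))"
  have "\<exists>k<p. B k \<noteq> 0"
  proof (rule ccontr)
    assume "\<not> ?thesis"
    hence "e k = e' k" if "k < p" for k using that by (simp add: B_def)
    hence "e = e'" using e(1,2) unfolding A_def by (intro PiE_ext[of e "{..<p}" _ e']) auto
    thus False using e(3) by simp
  qed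
  moreover have "(\<Prod>k<p. g k powi B k) = (\<Prod>k<p. g k ^ e k / g k ^ e' k)"
    using real_units_nonzero[OF g] by (intro prod.cong refl) (simp add: B_def power_int_diff)
  hence "(\<Prod>k<p. g k powi B k) = P e / P e'" by (simp add: P_def prod_dividef)
  hence "(\<Prod>k<p. g k powi B k) = 1" using Pe real_units_nonzero[OF P_unit, of e'] by simp
  ultimately show ?thesis using that by blast
qed

lemma unit_relation_odd:
  assumes g: "\<And>k. k < p \<Longrightarrow> g k \<in> real_units"
  obtains B where "\<exists>k<p. odd (B k)" "(\<Prod>k<p. g k powi B k) \<in> {1, - 1}"
proof -
  have "\<exists>B. (\<exists>k<p. odd (B k)) \<and> (\<Prod>k<p. g k powi B k) \<in> {1, - 1}"
    if "\<exists>k<p. B k \<noteq> 0" "(\<Prod>k<p. g k powi B k) \<in> {1, - 1}" for B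
    using that
  proof (induction "\<Sum>k<p. nat \<bar>B k\<bar>" arbitrary: B rule: less_induct)
    case less
    show ?case
    proof (cases "\<exists>k<p. odd (B k)")
      case False
      define B' where "B' = (\<lambda>k. B k div 2)"
      have B: "B k = B' k * 2" if "k < p" for k using False that by (simp add: B'_def)
      define y where "y = (\<Prod>k<p. g k powi B' k)"
      have "y \<in> real_units" unfolding y_def using g by (intro real_units_prod real_units_power_int) auto
      then obtain r where r: "y = of_real r" using emb_0[OF real_units_L] by metis
      have "(\<Prod>k<p. g k powi B k) = y ^ 2"
        unfolding y_def prod_power_distrib by (intro prod.cong refl) (simp add: B power_int_mult)
      hence "of_real (r ^ 2) \<in> {1, - 1 :: complex}" using less.prems(2) r by simp
      hence "r ^ 2 = 1 \<or> r ^ 2 = - 1" by (metis insertE of_real_1 of_real_eq_iff of_real_minus singletonD)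
      hence "r ^ 2 = 1" using zero_le_power2[of r] by linarith
      hence "y \<in> {1, - 1}" using r by (auto simp: power2_eq_1_iff)
      moreover have "\<exists>k<p. B' k \<noteq> 0" using less.prems(1) B by auto
      moreover have "(\<Sum>k<p. nat \<bar>B' k\<bar>) < (\<Sum>k<p. nat \<bar>B k\<bar>)"
      proof (rule sum_strict_mono_ex1)
        show "\<forall>k\<in>{..<p}. nat \<bar>B' k\<bar> \<le> nat \<bar>B k\<bar>" using B by auto
        obtain k where "k < p" "B' k \<noteq> 0" using \<open>\<exists>k<p. B' k \<noteq> 0\<close> by blast
        thus "\<exists>k\<in>{..<p}. nat \<bar>B' k\<bar> < nat \<bar>B k\<bar>" using B by (intro bexI[of _ k]) auto
      qed simp
      ultimately show ?thesis using less.hyps[of B'] unfolding y_def by blast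
    qed (use less.prems in blast)
  qed
  moreover obtain B where "\<exists>k<p. B k \<noteq> 0" "(\<Prod>k<p. g k powi B k) = 1"
    by (rule unit_relation[OF g])
  ultimately have "\<exists>B. (\<exists>k<p. odd (B k)) \<and> (\<Prod>k<p. g k powi B k) \<in> {1, - 1}" by blast
  thus ?thesis using that by blast
qed

end

section \<open>Totally positive units are squares\<close>

lemma real_ring_simps:
  "carrier (ring_of_type_algebra :: real ring) = UNIV" "x \<otimes>\<^bsub>ring_of_type_algebra\<^esub> y = (x * y :: real)"
  "x \<oplus>\<^bsub>ring_of_type_algebra\<^esub> y = (x + y :: real)" "\<one>\<^bsub>ring_of_type_algebra\<^esub> = (1 :: real)"
  using complex_ring_simps[where ?'a = real] by blast+

context safe_prime
begin

lemma hi_sin: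
  assumes "\<not> int q dvd x"
  shows "hi x = 1 \<and> sin (2 * pi * of_int x / of_nat q) < 0 \<or> hi x = 0 \<and> sin (2 * pi * of_int x / of_nat q) > 0"
proof -
  define r where "r = x mod int q"
  have "r \<noteq> 0" using assms by (simp add: r_def dvd_eq_mod_eq_0)
  moreover have "0 \<le> r" "r < int q" unfolding r_def by (rule mod_bounds)+
  ultimately have r: "0 < r" "r < int q" by linarith+
  have q0: "real q > 0" using q_ge by simp
  have "x = r + int q * (x div int q)" by (simp add: r_def)
  hence "real_of_int x = of_int r + real q * of_int (x div int q)" by (metis of_int_add of_int_mult of_int_of_nat_eq)
  hence "2 * pi * of_int x / real q = 2 * pi * of_int r / real q + 2 * pi * of_int (x div int q)"
    using q0 by (simp add: field_simps)
  hence eq: "sin (2 * pi * of_int x / real q) = sin (2 * pi * of_int r / real q)"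
    by (simp add: sin_add)
  show ?thesis
  proof (cases "r > int p")
    case True
    hence "real_of_int (2 * r) > of_int (int q)" unfolding of_int_less_iff using int_q by linarith
    moreover have "real_of_int r < real q" using r(2) by linarith
    ultimately have "sin (2 * pi * of_int r / real q) < 0"
      using q0 by (intro sin_lt_zero) (simp_all add: field_simps)
    thus ?thesis using True eq by (simp add: hi_def r_def)
  next
    case False
    hence "real_of_int (2 * r) < of_int (int q)" unfolding of_int_less_iff using int_q by linarith
    moreover have "real_of_int r > 0" using r(1) by simp
    ultimately have "sin (2 * pi * of_int r / real q) > 0"
      using q0 by (intro sin_gt_zero) (simp_all add: field_simps)
    thus ?thesis using False eq by (simp add: hi_def r_def)
  qed
qed

text \<open>By the formula for the sine of a double angle, the cosine is negative exactly if the
  sines of the angle and of its double differ in sign.\<close>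

lemma cos_less_0_iff_sg:
  assumes "\<not> int q dvd x"
  shows "cos (2 * pi * of_int x / of_nat q) < 0 \<longleftrightarrow> sg x = 1"
proof -
  let ?t = "2 * pi * of_int x / of_nat q"
  have "\<not> int q dvd 2 * x" using assms by (simp add: units_def)
  from hi_sin[OF this] have "hi (2 * x) = 1 \<and> sin (2 * ?t) < 0 \<or> hi (2 * x) = 0 \<and> sin (2 * ?t) > 0"
    by (simp add: mult.assoc)
  with hi_sin[OF assms] show ?thesis
    unfolding sin_double by (auto simp: dis_def zero_less_mult_iff mult_less_0_iff)
qed

lemma sg_01: "sg x = 0 \<or> sg x = 1" by (simp add: dis_def)

text \<open>Modulo \<open>q\<close>, \<open>2 ^ p\<close> is 1 or -1, and \<open>sg\<close> is
  even.\<close>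

lemma sg_periodic:
  assumes "\<not> int q dvd m"
  shows "sg (2 ^ (i mod p) * m) = sg (2 ^ i * m)"
proof -
  have step: "sg (2 ^ (i + p) * m) = sg (2 ^ i * m)" for i
  proof -
    have sg_mod: "sg (x mod int q) = sg x" and sg_minus: "\<not> int q dvd x \<Longrightarrow> sg (- x) = sg x" for x
      using even_periodic_dis[of 1] unfolding even_periodic_def by blast+
    have sg_cong: "sg x = sg y" if "[x = y] (mod int q)" for x y
      using that sg_mod[of x] sg_mod[of y] by (simp add: cong_def)
    have nd: "\<not> int q dvd 2 ^ i * m" using assms by (simp add: units_def)
    have "[2 ^ p * (2 ^ i * m) = 1 * (2 ^ i * m)] (mod int q) \<or> [2 ^ p * (2 ^ i * m) = - 1 * (2 ^ i * m)] (mod int q)"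
      using power2_p by (metis cong_scalar_right)
    moreover have "2 ^ (i + p) * m = 2 ^ p * (2 ^ i * m)" by (simp add: power_add)
    ultimately show ?thesis using sg_cong sg_minus[OF nd] by (metis mult_1 mult_minus1)
  qed
  have "sg (2 ^ (i mod p + p * k) * m) = sg (2 ^ (i mod p) * m)" for k
  proof (induction k)
    case (Suc k)
    then show ?case using step[of "i mod p + p * k"] by (simp add: algebra_simps)
  qed simp
  from this[of "i div p"] show ?thesis by simp
qed

lemma sign_correlation_injective:
  fixes b s :: "nat \<Rightarrow> bit"
  assumes m: "\<not> int q dvd m" and s: "\<And>i. s i = of_int (sg (2 ^ i * m))"
    and y: "prime_root_of_unity p y" and inert: "inert_in 2 (maximal_real_subfield (rat_adjoin {y}))"
    and b: "\<And>j. (\<Sum>i<p. b i * s (i + j)) = c"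
  shows "\<exists>\<delta>. \<forall>i<p. b i = \<delta>"
proof -
  interpret Y: prime_root_of_unity p y by fact
  interpret odd_prime p by unfold_locales (use p in auto)
  have s_mod: "s (i mod p) = s i" for i unfolding s sg_periodic[OF m] ..
  show ?thesis
  proof (rule correlation_injective[where s = s, OF _ s_mod _ _ _ b])
    fix i :: nat assume i: "0 < i" "i < p"
    obtain k where "[int i = 2 ^ k] (mod int p) \<or> [int i = - (2 ^ k)] (mod int p)"
      using Y.inert_orbit[OF inert i] .
    moreover have "[int i = int ((p - 1) * 2 ^ k)] (mod int p)" if "[int i = - (2 ^ k)] (mod int p)"
    proof -
      have "int p dvd (int i - - (2 ^ k)) - int p * 2 ^ k"
        using that unfolding cong_iff_dvd_diff by (rule dvd_diff) simp
      also have "(int i - - (2 ^ k)) - int p * 2 ^ k = int i - int ((p - 1) * 2 ^ k)"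
        using p by (simp add: of_nat_diff algebra_simps)
      finally show ?thesis by (simp only: cong_iff_dvd_diff)
    qed
    ultimately have "[int i = int (2 ^ k)] (mod int p) \<or> [int i = int ((p - 1) * 2 ^ k)] (mod int p)" by auto
    thus "\<exists>k. [i = 2 ^ k] (mod p) \<or> [i = (p - 1) * 2 ^ k] (mod p)"
      unfolding cong_int_iff by blast
  next
    fix i :: nat assume i: "p mod 4 \<noteq> 3" "0 < i" "i < p"
    obtain k where "[int i = 2 ^ k] (mod int p)" using Y.inert_orbit_unsigned[OF inert i(2,3,1)] .
    hence "[int i = int (2 ^ k)] (mod int p)" by simp
    thus "\<exists>k. [i = 2 ^ k] (mod p)" unfolding cong_int_iff by blast
  next
    fix c :: bit
    \<comment> \<open>A constant sequence of signs would add up to 0 or \<open>p\<close>, but the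
      sum \<open>(p + 1) / 2\<close> lies strictly in between.\<close>
    have "\<exists>i<p. s i \<noteq> c"
    proof (rule ccontr)
      assume "\<not> ?thesis"
      hence c: "s i = c" if "i < p" for i using that by blast
      have ev: "even (sg (2 ^ i * m)) \<longleftrightarrow> c = 0" if "i < p" for i
        using c[OF that] unfolding s of_int_bit by (auto split: if_splits)
      have "sg (2 ^ i * m) = (if c = 0 then 0 else 1)" if "i < p" for i
        using ev[OF that] sg_01[of "2 ^ i * m"] by auto
      hence "(\<Sum>i<p. sg (2 ^ i * m)) = (\<Sum>i<p. if c = 0 then 0 else 1)" by (intro sum.cong) auto
      thus False using sum_sg[OF m] p(2) by (auto split: if_splits)
    qed
    thus "p mod 4 = 3 \<or> (\<exists>i<p. s i \<noteq> c)" by blast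
  next
    fix c :: bit assume p4: "p mod 4 = 3"
    obtain j where j: "\<not> [(\<Sum>i<p. sg (2 ^ i * m) * sg (2 ^ (i + j) * m)) = (\<Sum>i<p. sg (2 ^ i * m))] (mod 2)"
      using sign_autocorrelation_not_const[OF m p4] .
    have of_int_cong: "[x = y] (mod 2)" if "(of_int x :: bit) = of_int y" for x y :: int
      using that unfolding of_int_bit by (auto simp: cong_def mod2_eq_if split: if_splits)
    have sq: "s i * s i = s i" for i by (cases "s i") simp_all
    \<comment> \<open>The autocorrelation at shift 0 is the sum of the signs, so the values at
      shifts 0 and \<open>j\<close> differ and no \<open>c\<close> equals both.\<close>
    have ne: "(\<Sum>i<p. s i * s (i + j)) \<noteq> (\<Sum>i<p. s i * s (i + 0))"
    proof
      assume "(\<Sum>i<p. s i * s (i + j)) = (\<Sum>i<p. s i * s (i + 0))"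
      hence "(\<Sum>i<p. s i * s (i + j)) = (\<Sum>i<p. s i)" by (simp only: add_0_right sq)
      hence "(of_int (\<Sum>i<p. sg (2 ^ i * m) * sg (2 ^ (i + j) * m)) :: bit) = of_int (\<Sum>i<p. sg (2 ^ i * m))"
        unfolding of_int_sum of_int_mult s .
      thus False using of_int_cong j by blast
    qed
    have "s (i + j mod p) = s (i + j)" for i
      using s_mod[of "i + j mod p"] s_mod[of "i + j"] by (simp add: mod_add_right_eq)
    hence "(\<Sum>i<p. s i * s (i + j)) = (\<Sum>i<p. s i * s (i + j mod p))" by (simp only:)
    with ne have "(\<Sum>i<p. s i * s (i + j mod p)) \<noteq> c \<or> (\<Sum>i<p. s i * s (i + 0)) \<noteq> c" by argo
    moreover have "j mod p < p" "0 < p" using p by simp_all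
    ultimately show "\<exists>j<p. (\<Sum>i<p. s i * s (i + j)) \<noteq> c" by blast
  qed
qed

end

context safe_prime_root_of_unity
begin

lemma w_power2_unit: "w (2 ^ k) \<in> real_units"
  using w_unit[OF _ w_power2_in_L, of k] not_q_dvd_power2[of "Suc k"] by simp

text \<open>The number \<open>m\<close> records which root of unity \<open>z\<close> is; the
  conjugation with index \<open>j\<close> adds \<open>j\<close> to the exponent of 2.\<close>

lemma sign_bit_emb_w:
  obtains m where "\<not> int q dvd m"
    "\<And>j k. sign_bit (emb j (w (2 ^ k))) = of_int (sg (2 ^ (k + j) * m))"
proof -
  have "z \<in> (\<lambda>k. cis (2 * pi * real k / real q)) ` {..<q}"
    using bij_betw_imp_surj_on[OF bij_betw_roots_unity[of q]] z(1) by simp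
  then obtain m where m: "m < q" "z = cis (2 * pi * real m / real q)" by blast
  hence "m \<noteq> 0" using z(2) by (intro notI) simp
  hence nd: "\<not> int q dvd int m" using m(1) by (auto dest: dvd_imp_le)
  have "sign_bit (emb j (w (2 ^ k))) = of_int (sg (2 ^ (k + j) * int m))" for j k
  proof -
    let ?a = "2 ^ (k + j) :: nat"
    have "cj (2 ^ j) (w (2 ^ k)) = z ^ ?a + cnj (z ^ ?a)"
      using cj_w[OF not_q_dvd_power2, of j "2 ^ k"] by (simp add: w_def cnj_z power_add mult.commute)
    hence "emb j (w (2 ^ k)) = 2 * Re (z ^ ?a)" by (simp add: emb_def flip: complex_cnj_power)
    also have "z ^ ?a = cis (2 * pi * of_int (2 ^ (k + j) * int m) / real q)"
      unfolding m(2) DeMoivre by (simp add: mult_ac)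
    finally have "emb j (w (2 ^ k)) = 2 * cos (2 * pi * of_int (2 ^ (k + j) * int m) / real q)" by simp
    moreover have "\<not> int q dvd 2 ^ (k + j) * int m" using nd units_def by simp
    note cos_less_0_iff_sg[OF this]
    ultimately have "emb j (w (2 ^ k)) < 0 \<longleftrightarrow> sg (2 ^ (k + j) * int m) = 1" by simp
    thus ?thesis using sg_01[of "2 ^ (k + j) * int m"] unfolding sign_bit_def of_int_bit by auto
  qed
  thus ?thesis using that nd by blast
qed

theorem totally_positive_unit_is_square:
  assumes y: "prime_root_of_unity p y" and inert: "inert_in 2 (maximal_real_subfield (rat_adjoin {y}))"
    and v: "v \<in> real_units" and pos: "\<And>j. emb j v > 0"
  obtains u where "u \<in> real_units" "v = u ^ 2"
proof -
  obtain m where m: "\<not> int q dvd m" "\<And>j k. sign_bit (emb j (w (2 ^ k))) = of_int (sg (2 ^ (k + j) * m))"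
    using sign_bit_emb_w by blast
  define g where "g = (\<lambda>k. if k < p - 1 then w (2 ^ k) else v)"
  have g: "g k \<in> real_units" for k by (simp add: g_def w_power2_unit v)
  obtain B where B: "\<exists>k<p. odd (B k)" "(\<Prod>k<p. g k powi B k) \<in> {1, - 1}"
    using unit_relation_odd[OF g] .
  define s :: "nat \<Rightarrow> bit" where "s = (\<lambda>i. of_int (sg (2 ^ i * m)))"
  \<comment> \<open>Position \<open>p - 1\<close> belongs to \<open>v\<close>, whose sign bits are
    all 0. The entry 0 there is harmless for the correlation and later forces
    \<open>\<delta>\<close> to be 0.\<close>
  define b :: "nat \<Rightarrow> bit" where "b = (\<lambda>k. if k < p - 1 then of_int (B k) else 0)"
  define c :: bit where "c = (if (\<Prod>k<p. g k powi B k) = 1 then 0 else 1)"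
  have "(\<Sum>i<p. b i * s (i + j)) = c" for j
  proof -
    have "emb j (\<Prod>k<p. g k powi B k) = (\<Prod>k<p. emb j (g k) powi B k)"
      using g by (simp add: emb_prod real_units_power_int emb_power_int)
    hence "sign_bit (emb j (\<Prod>k<p. g k powi B k)) = (\<Sum>k<p. sign_bit (emb j (g k) powi B k))"
      using emb_nonzero[OF g] by (simp add: sign_bit_prod)
    also have "\<dots> = (\<Sum>k<p. b k * s (k + j))"
    proof (rule sum.cong[OF refl])
      fix k
      have "sign_bit (emb j (g k) powi B k) = of_int (B k) * sign_bit (emb j (g k))"
        by (rule sign_bit_power_int[OF emb_nonzero[OF g]])
      also have "\<dots> = b k * s (k + j)"
      proof (cases "k < p - 1")
        case True
        then show ?thesis by (simp only: g_def b_def s_def m(2) if_True)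
      next
        case False
        have "sign_bit (emb j v) = 0" using pos[of j] by (simp add: sign_bit_def)
        then show ?thesis using False by (simp only: g_def b_def if_False mult_zero_left mult_zero_right)
      qed
      finally show "sign_bit (emb j (g k) powi B k) = b k * s (k + j)" .
    qed
    finally have "sign_bit (emb j (\<Prod>k<p. g k powi B k)) = (\<Sum>k<p. b k * s (k + j))" .
    moreover have "sign_bit (emb j (\<Prod>k<p. g k powi B k)) = c"
      using B(2) by (auto simp: c_def sign_bit_def)
    ultimately show ?thesis by simp
  qed
  from sign_correlation_injective[OF m(1) _ y inert this] obtain \<delta> where \<delta>: "\<And>i. i < p \<Longrightarrow> b i = \<delta>"
    unfolding s_def by blast
  have "\<delta> = 0" using \<delta>[of "p - 1"] p by (simp add: b_def)
  have ev: "even (B k)" if "k < p - 1" for k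
  proof -
    have "b k = 0" using \<delta>[of k] that \<open>\<delta> = 0\<close> by simp
    hence "of_int (B k) = (0 :: bit)" using that by (simp only: b_def if_True)
    thus ?thesis unfolding of_int_bit by (metis zero_neq_one)
  qed
  hence "odd (B (p - 1))" using B(1) p by (metis One_nat_def Suc_pred less_Suc_eq prime_gt_0_nat)
  then obtain l where l: "B (p - 1) = 2 * l + 1" by (elim oddE)
  define u where "u = (\<Prod>k<p - 1. w (2 ^ k) powi (B k div 2)) * v powi l"
  have u: "u \<in> real_units"
    unfolding u_def by (intro real_units_mult real_units_prod real_units_power_int w_power2_unit v)
  have "{..<p} = insert (p - 1) {..<p - 1}" using p by auto
  hence "(\<Prod>k<p. g k powi B k) = (\<Prod>k<p - 1. w (2 ^ k) powi B k) * v powi (2 * l + 1)"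
    by (simp add: g_def l[unfolded One_nat_def] mult.commute)
  also have "(\<Prod>k<p - 1. w (2 ^ k) powi B k) = (\<Prod>k<p - 1. w (2 ^ k) powi (B k div 2)) ^ 2"
    unfolding prod_power_distrib using ev by (intro prod.cong refl) (simp add: power_int_power')
  also have "v powi (2 * l + 1) = (v powi l) ^ 2 * v"
    using real_units_nonzero[OF v] by (simp add: power_int_add power_int_power' mult.commute)
  finally have "(\<Prod>k<p. g k powi B k) = u ^ 2 * v" by (simp add: u_def power_mult_distrib)
  with B(2) have uv: "u ^ 2 * v \<in> {1, - 1}" by simp
  moreover have "u ^ 2 * v \<noteq> - 1"
  proof
    assume "u ^ 2 * v = - 1"
    hence "emb 0 (u ^ 2) * emb 0 v = - 1"
      using emb_mult[OF real_units_L real_units_L, of "u ^ 2" v 0] real_units_power[OF u] v by simp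
    hence "emb 0 u ^ 2 * emb 0 v = - 1" by (simp add: emb_power[OF u])
    moreover have "emb 0 u ^ 2 * emb 0 v \<ge> 0" using pos[of 0] by simp
    ultimately show False by linarith
  qed
  ultimately have "u ^ 2 * v = 1" by blast
  hence "v = inverse u ^ 2" by (metis inverse_unique power_inverse)
  thus ?thesis using that real_units_inverse[OF u] by blast
qed

section \<open>From the unit group to the vector space over the field with two elements\<close>

lemma unit_group_simps:
  shows carrier_unit_group: "carrier (unit_group L) = real_units"
    and mult_unit_group: "x \<otimes>\<^bsub>unit_group L\<^esub> y = x * y" and one_unit_group: "\<one>\<^bsub>unit_group L\<^esub> = 1"
proof -
  have "x \<in> Units (ring_of_integers L) \<longleftrightarrow> x \<in> real_units" for x
  proof
    assume "x \<in> Units (ring_of_integers L)"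
    then obtain y where "x \<in> L" "algebraic_int x" "algebraic_int y" "x * y = 1"
      by (auto simp: Units_def ring_of_integers_def complex_ring_simps)
    moreover from this have "y = inverse x" by (metis inverse_unique)
    ultimately show "x \<in> real_units" by (auto simp: real_units_def)
  next
    assume "x \<in> real_units"
    moreover from this have "inverse x \<in> real_units" by (rule real_units_inverse)
    ultimately show "x \<in> Units (ring_of_integers L)"
      by (auto simp: Units_def ring_of_integers_def complex_ring_simps real_units_def intro!: bexI[of _ "inverse x"])
  qed
  thus "carrier (unit_group L) = real_units" by (auto simp: unit_group_def units_of_def)
  show "x \<otimes>\<^bsub>unit_group L\<^esub> y = x * y" "\<one>\<^bsub>unit_group L\<^esub> = 1"
    by (simp_all add: unit_group_def units_of_def ring_of_integers_def complex_ring_simps)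
qed

lemma unit_squares_altdef: "unit_squares L = {u ^ 2 | u. u \<in> real_units}"
proof -
  have "u [^]\<^bsub>unit_group L\<^esub> (2 :: nat) = u ^ 2" for u
    by (simp add: numeral_2_eq_2 nat_pow_def unit_group_simps)
  thus ?thesis by (simp add: unit_squares_def unit_group_simps)
qed

lemma totally_positive_square:
  assumes "u \<in> real_units"
  shows "totally_positive L (u ^ 2)"
  unfolding totally_positive_def
proof
  fix \<sigma> assume \<sigma>: "\<sigma> \<in> Ring.ring_hom (subfield_ring L) (ring_of_type_algebra :: real ring)"
  have \<sigma>_mult: "\<sigma> (x * y) = \<sigma> x * \<sigma> y" if "x \<in> L" "y \<in> L" for x y
    using Ring.ring_hom_mult[OF \<sigma>, of x y] that by (simp add: subfield_ring_def complex_ring_simps real_ring_simps)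
  have "\<sigma> 1 = 1" using Ring.ring_hom_one[OF \<sigma>] by (simp add: subfield_ring_def complex_ring_simps real_ring_simps)
  moreover have u: "u \<in> L" "inverse u \<in> L" "u \<noteq> 0"
    using assms real_units_inverse real_units_L real_units_nonzero by blast+
  ultimately have "\<sigma> u * \<sigma> (inverse u) = 1" using \<sigma>_mult[of u "inverse u"] by simp
  hence "\<sigma> u \<noteq> 0" by auto
  thus "\<sigma> (u ^ 2) > 0" using \<sigma>_mult[of u u] u(1) by (simp add: power2_eq_square) (metis not_real_square_gt_zero)
qed

lemma emb_pos_if_totally_positive:
  assumes "totally_positive L v" "v \<in> L"
  shows "emb j v > 0"
proof -
  have "cj (2 ^ j) (x + y) = cj (2 ^ j) x + cj (2 ^ j) y" if "x \<in> L" "y \<in> L" for x y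
    using cj_add[OF not_q_dvd_power2] that L_in_K by blast
  hence "emb j \<in> Ring.ring_hom (subfield_ring L) (ring_of_type_algebra :: real ring)"
    by (intro Ring.ring_hom_memI) (simp_all add: subfield_ring_def complex_ring_simps real_ring_simps emb_mult, simp add: emb_def)
  thus ?thesis using assms unfolding totally_positive_def by blast
qed

lemma carrier_totally_positive_unit_group:
  assumes "prime_root_of_unity p y" "inert_in 2 (maximal_real_subfield (rat_adjoin {y}))"
  shows "carrier (totally_positive_unit_group L) = unit_squares L"
proof
  show "carrier (totally_positive_unit_group L) \<subseteq> unit_squares L"
  proof
    fix v assume "v \<in> carrier (totally_positive_unit_group L)"
    hence v: "v \<in> real_units" "totally_positive L v"
      by (simp_all add: totally_positive_unit_group_def unit_group_simps)
    hence "emb j v > 0" for j using emb_pos_if_totally_positive real_units_L by blast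
    from totally_positive_unit_is_square[OF assms v(1) this] show "v \<in> unit_squares L"
      unfolding unit_squares_altdef by blast
  qed
  show "unit_squares L \<subseteq> carrier (totally_positive_unit_group L)"
    using totally_positive_square real_units_power
    by (auto simp: unit_squares_altdef totally_positive_unit_group_def unit_group_simps)
qed

text \<open>Closure and inverses are read off from square roots, without reference to the
  embeddings.\<close>

lemma comm_group_totally_positive_units:
  assumes "carrier (totally_positive_unit_group L) = unit_squares L"
  shows "comm_group (totally_positive_unit_group L)"
proof (rule comm_groupI)
  let ?G = "totally_positive_unit_group L"
  have ops: "x \<otimes>\<^bsub>?G\<^esub> y = x * y" "\<one>\<^bsub>?G\<^esub> = 1" for x y
    by (simp_all add: totally_positive_unit_group_def unit_group_simps)
  note simps = ops assms unit_squares_altdef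
  show "x \<otimes>\<^bsub>?G\<^esub> y \<in> carrier ?G" if "x \<in> carrier ?G" "y \<in> carrier ?G" for x y
    using that real_units_mult unfolding simps by (auto simp flip: power_mult_distrib)
  show "\<one>\<^bsub>?G\<^esub> \<in> carrier ?G" using real_units_1 unfolding simps by (auto intro!: exI[of _ 1])
  show "\<exists>y\<in>carrier ?G. y \<otimes>\<^bsub>?G\<^esub> x = \<one>\<^bsub>?G\<^esub>" if "x \<in> carrier ?G" for x
  proof -
    obtain u where u: "u \<in> real_units" "x = u ^ 2" using \<open>x \<in> carrier ?G\<close> unfolding simps by blast
    hence "inverse u ^ 2 \<in> unit_squares L" "inverse u ^ 2 * x = 1"
      using real_units_inverse real_units_nonzero unfolding unit_squares_altdef
      by (auto simp flip: power_mult_distrib)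
    thus ?thesis unfolding simps(1-3) by blast
  qed
qed (simp_all add: totally_positive_unit_group_def unit_group_simps)

end

text \<open>The span of the empty set consists of the zero vector, which is the identity of
  \<open>G\<close>; so a generating set of cardinality 0 exists.\<close>

lemma F2_module_trivial_group:
  assumes "comm_group G" "carrier G = {\<one>\<^bsub>G\<^esub>}"
  shows "vectorspace F2 (F2_module G) \<and> vectorspace.fin_dim F2 (F2_module G) \<and> vectorspace.dim F2 (F2_module G) = 0"
proof -
  interpret G: comm_group G by fact
  have vs: "vectorspace F2 (F2_module G)"
    by (rule F2_module_vectorspace[OF assms(1)]) (simp add: assms(2))
  interpret V: vectorspace F2 "F2_module G" by (rule vs)
  have gen: "V.gen_set {}"
    using assms(2) by (simp add: V.span_empty) (simp add: F2_module_def)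
  hence "V.fin_dim" unfolding V.fin_dim_def by (intro exI[of _ "{}"]) simp
  moreover have "V.dim = 0"
    unfolding V.dim_def using gen by (intro Least_eq_0 exI[of _ "{}"]) simp
  ultimately show ?thesis using vs by blast
qed

lemma trivial_quotient:
  assumes "comm_group G"
  shows "comm_group (G Mod carrier G)" "carrier (G Mod carrier G) = {\<one>\<^bsub>G Mod carrier G\<^esub>}"
proof -
  interpret G: comm_group G by fact
  show "comm_group (G Mod carrier G)" by (rule G.abelian_FactGroup[OF G.subgroup_self])
  have "carrier G #>\<^bsub>G\<^esub> x = carrier G" if "x \<in> carrier G" for x
    using G.coset_join2[OF that G.subgroup_self that] .
  thus "carrier (G Mod carrier G) = {\<one>\<^bsub>G Mod carrier G\<^esub>}"
    by (auto simp: FactGroup_def RCOSETS_def intro!: bexI[of _ "\<one>\<^bsub>G\<^esub>"])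
qed

lemma prime_root_of_unity_if_primitive:
  assumes "Factorial_Ring.prime n" "n > 2" "primitive_root_of_unity n z"
  shows "prime_root_of_unity n z"
proof
  show "odd n" using assms(1,2) primes_dvd_imp_eq[of 2 n] by auto
  have "z ^ 1 \<noteq> 1" using assms(2,3) unfolding primitive_root_of_unity_def
    by (elim conjE allE[of _ 1]) simp
  thus "z \<noteq> 1" by simp
qed (use assms in \<open>simp_all add: primitive_root_of_unity_def\<close>)

theorem theorem2p18:
  fixes p q :: nat and \<zeta>\<^sub>p \<zeta>\<^sub>q :: complex and L :: "complex set"
  assumes "Factorial_Ring.prime p" and "p > 2" and "Factorial_Ring.prime q" and "q = 2 * p + 1"
    and "primitive_root_of_unity p \<zeta>\<^sub>p" and "primitive_root_of_unity q \<zeta>\<^sub>q"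
    and "L = rat_adjoin {\<zeta>\<^sub>q + inverse \<zeta>\<^sub>q}"
    and "inert_in 2 (maximal_real_subfield (rat_adjoin {\<zeta>\<^sub>p}))"
  shows "vectorspace F2 (positive_units_mod_squares L)
    \<and> vectorspace.fin_dim F2 (positive_units_mod_squares L)
    \<and> rho_infinity L = 0"
proof -
  interpret Q: prime_root_of_unity q \<zeta>\<^sub>q
    by (rule prime_root_of_unity_if_primitive) (use assms in simp_all)
  interpret S: safe_prime_root_of_unity p q \<zeta>\<^sub>q
    by unfold_locales (use assms in simp_all)
  have "prime_root_of_unity p \<zeta>\<^sub>p"
    by (rule prime_root_of_unity_if_primitive) (use assms in simp_all)
  note * = S.carrier_totally_positive_unit_group[OF this assms(8)]
  have L: "L = Q.L" unfolding assms(7) Q.L_def ..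
  note G = S.comm_group_totally_positive_units[OF *]
  show ?thesis
    unfolding rho_infinity_def positive_units_mod_squares_def L
    using F2_module_trivial_group[OF trivial_quotient[OF G]] unfolding * .
qed

end
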